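(* Let $r,s\in\mathbb N$ and let $\boldsymbol{\alpha}=\{\alpha_k\}_{k=1}^r$ and $\boldsymbol{\beta}=\{\beta_\ell\}_{\ell=1}^s$ be sequences of positive real numbers with $\sum_{k=1}^r \alpha_k < \sum_{\ell=1}^s \beta_\ell$. Let $\{\mu_k\}_{k=1}^r, \{\nu_\ell\}_{\ell=1}^s \subset \mathbb N_0$, where $\mu_1 < \mu_2 < \cdots < \mu_r$ and $\nu_1 < \nu_2 < \cdots < \nu_s$. Then there exists an $N$ (depending on $\boldsymbol{\alpha}$, $\boldsymbol{\beta}$ and $\mu_r$) such that for all integers $n>N$, $$\sum_{k=1}^r \alpha_k \, q(n+\mu_k) \leq \sum_{\ell=1}^s \beta_\ell \, q(n+\nu_\ell).$$ Specifically, for any choice of real $A,B,C>0$ with $\frac1A+\frac1B+\frac1C<1$, we may take $N=N_{\boldsymbol{\alpha},\boldsymbol{\beta},\mu_r}:=N_{A,B,C}(\varepsilon,L)$ with $L:=\mu_r$ and $\varepsilon:=\left(\sum_{k=1}^r\alpha_k\right)^{-1}\left(\sum_{\ell=1}^s\beta_\ell-\sum_{k=1}^r\alpha_k\right)$.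
   Context: $\mathbb N=\{1,2,\dots\}$ and $\mathbb N_0=\{0,1,2,\dots\}$. $q(n)$ denotes the number of partitions of $n$ into distinct parts (with $q(0)=1$). For real $A,B,C>0$ with $D:=\frac1A+\frac1B+\frac1C<1$, real $\varepsilon>0$ and integer $L\ge 0$, define $$N_{A,B,C}(\varepsilon,L):=\max(N_A,N_B,N_C,N_D,26),$$ where $$N_A=\frac{12A^2(2+\varepsilon)^2}{\pi^2\varepsilon^2}-L-\frac1{24},\qquad N_B=\frac{910787328\,B^4(2+\varepsilon)^4}{10000\,\pi^8\varepsilon^4}-L-\frac1{24},$$ $$N_C=\frac{3}{4\pi^2}\log^2\!\left(\frac{2C(2+\varepsilon)(1+L)}{\varepsilon}\right)-\frac1{24},\qquad N_D=\frac{L^2\pi^2}{12\log^2\!\left(\frac{1+\varepsilon}{1+\varepsilon D}\right)}-\frac1{24},$$ and $\log$ is the natural logarithm ($\log^2(x)=(\log x)^2$). *)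

theory Defs
  imports "HOL-Analysis.Analysis"
begin

text \<open>
  A partition of \<open>n\<close> into distinct parts is encoded as the finite set of its parts, which are
  positive integers; since no part is repeated, this loses no information.
\<close>

definition distinct_partitions :: "nat \<Rightarrow> nat set set" where
  "distinct_partitions n = {S. finite S \<and> 0 \<notin> S \<and> \<Sum>S = n}"

definition q :: "nat \<Rightarrow> nat" where
  "q n = card (distinct_partitions n)"

lemma finite_distinct_partitions: "finite (distinct_partitions n)"
proof (rule finite_subset)
  show "distinct_partitions n \<subseteq> Pow {..n}"
    by (auto simp: distinct_partitions_def intro: member_le_sum[where f = "\<lambda>x. x", simplified])
qed simp

lemma q_0: "q 0 = 1"
proof -
  have "distinct_partitions 0 = {{}}"
    by (auto simp: distinct_partitions_def)
  then show ?thesis by (simp add: q_def)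
qed

definition N_A :: "real \<Rightarrow> real \<Rightarrow> nat \<Rightarrow> real" where
  "N_A A \<epsilon> L = 12 * A\<^sup>2 * (2 + \<epsilon>)\<^sup>2 / (pi\<^sup>2 * \<epsilon>\<^sup>2) - real L - 1 / 24"

definition N_B :: "real \<Rightarrow> real \<Rightarrow> nat \<Rightarrow> real" where
  "N_B B \<epsilon> L =
     910787328 * B ^ 4 * (2 + \<epsilon>) ^ 4 / (10000 * pi ^ 8 * \<epsilon> ^ 4) - real L - 1 / 24"

definition N_C :: "real \<Rightarrow> real \<Rightarrow> nat \<Rightarrow> real" where
  "N_C C \<epsilon> L =
     3 / (4 * pi\<^sup>2) * (ln (2 * C * (2 + \<epsilon>) * (1 + real L) / \<epsilon>))\<^sup>2 - 1 / 24"

definition N_D :: "real \<Rightarrow> real \<Rightarrow> nat \<Rightarrow> real" where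
  "N_D D \<epsilon> L =
     (real L)\<^sup>2 * pi\<^sup>2 / (12 * (ln ((1 + \<epsilon>) / (1 + \<epsilon> * D)))\<^sup>2) - 1 / 24"

definition N_ABC :: "real \<Rightarrow> real \<Rightarrow> real \<Rightarrow> real \<Rightarrow> nat \<Rightarrow> real" where
  "N_ABC A B C \<epsilon> L =
     Max {N_A A \<epsilon> L, N_B B \<epsilon> L, N_C C \<epsilon> L, N_D (1 / A + 1 / B + 1 / C) \<epsilon> L, 26}"

end

theory Submission
  imports Defs "HOL-Real_Asymp.Real_Asymp"
begin

text \<open>
  By monotonicity of \<open>q\<close> the weighted inequality reduces to a single comparison: \<open>q (n + L) \<le> (1 + \<epsilon>) * q n\<close>
  (\<open>q_shift_le\<close>, \<open>weighted_sum_q_le\<close>). The hypotheses on \<open>n\<close> leave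
  room for a factor beyond the expected growth \<open>R = exp (t * L)\<close> with
  \<open>t = pi / (2 * sqrt (3 * (n + 1/24)))\<close>, and this factor exceeds \<open>1\<close> by an amount of order
  \<open>(n + L) powr (-1/4)\<close> at least. It is made explicit by \<open>slack\<close>, and the precise claim
  about \<open>q\<close> is \<open>(1 - R * a) * q (n + L) \<le> R * (1 + a) * q n\<close> with \<open>a = slack (n + L)\<close> (\<open>q_shift_bound\<close>).

  For \<open>n \<ge> 1000\<close> this is a saddle point estimate. Up to a common normalisation, \<open>q m * exp (-t * m)\<close> is
  the integral over \<open>{0..pi}\<close> of the real part of \<open>F(\<theta>) * cis (- m * \<theta>)\<close>, where
  \<open>F(\<theta>) = \<Prod>k. 1 + exp (-t * k) * cis (k * \<theta>)\<close>. For \<open>m = n + L\<close> the integral is at most the integral of the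
  modulus of \<open>F\<close>. For \<open>m = n\<close> the phase nearly vanishes where the modulus is not small, since \<open>t\<close> is chosen
  so that the mean \<open>\<Sum>k. k * exp (-t * k) / (1 + exp (-t * k))\<close> agrees with \<open>n\<close> up to a bounded error
  (\<open>fermi_mean_bounds\<close>). Hence the quotient of the two integrals is at least \<open>1 - O(sqrt t)\<close>, with an explicit
  constant that is small enough for the available slack (\<open>q_shift_bound_saddle\<close>, \<open>slack_lower_bound\<close>).
  The ingredients are a bound for the decay of the modulus (\<open>tail_exponent_lower_bound\<close>), a cubic bound
  for the phase (\<open>phase_cubic_bound\<close>, \<open>re_dp_poly_ge\<close>), and a lower bound for the integral of the modulus from
  the second moment (\<open>cmod_dp_poly_sq_ge\<close>).

  For \<open>27 \<le> n < 1000\<close> even \<open>q (n + 1) \<le> exp (t) * q n\<close> holds with the \<open>t\<close> that belongs to \<open>n\<close>. This is checked on a table of the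
  exact values of \<open>q\<close> (\<open>distinct_partition_table\<close>), which is produced by a two-term recurrence for
  sets of positive integers in which the largest element is counted with an additional weight
  (\<open>weighted_count_ne_rec\<close>). Downward induction on \<open>n\<close> then extends the claim from \<open>n = 1000\<close> to
  smaller \<open>n\<close>.
\<close>

section \<open>Coefficients of the generating polynomial\<close>

lemma prod_one_plus_power:
  fixes z :: "'a::comm_ring_1"
  shows "(\<Prod>k=1..M. 1 + z ^ k) = (\<Sum>S\<in>Pow {1..M}. z ^ \<Sum>S)"
proof -
  have "(\<Prod>k=1..M. z ^ k + 1) = (\<Sum>S\<in>Pow {1..M}. (\<Prod>k\<in>S. z ^ k) * (\<Prod>k\<in>{1..M}-S. 1))"
    by (rule prod_add) simp
  also have "\<dots> = (\<Sum>S\<in>Pow {1..M}. z ^ \<Sum>S)"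
    by (intro sum.cong refl) (simp add: power_sum)
  finally show ?thesis by (simp add: add.commute)
qed

lemma q_eq_card_Pow:
  assumes "m \<le> M"
  shows "q m = card {S \<in> Pow {1..M}. \<Sum>S = m}"
proof -
  have "distinct_partitions m = {S \<in> Pow {1..M}. \<Sum>S = m}"
  proof (intro equalityI subsetI)
    fix S assume "S \<in> distinct_partitions m"
    then have S: "finite S" "0 \<notin> S" "\<Sum>S = m" by (auto simp: distinct_partitions_def)
    have "x \<in> {1..M}" if "x \<in> S" for x
      using member_le_sum[of x S "\<lambda>x. x"] S that assms by (cases x) auto
    with S show "S \<in> {S \<in> Pow {1..M}. \<Sum>S = m}" by auto
  next
    fix S assume "S \<in> {S \<in> Pow {1..M}. \<Sum>S = m}"
    then show "S \<in> distinct_partitions m"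
      by (auto simp: distinct_partitions_def intro: finite_subset[of _ "{Suc 0..M}"])
  qed
  then show ?thesis by (simp add: q_def)
qed

lemma has_integral_cos_int:
  fixes j :: int
  shows "((\<lambda>\<theta>. cos (of_int j * \<theta>)) has_integral (if j = 0 then pi else 0)) {0..pi}"
proof (cases "j = 0")
  case True
  then show ?thesis using has_integral_const_real[of "1::real" 0 pi] by simp
next
  case False
  have "((\<lambda>\<theta>. cos (of_int j * \<theta>)) has_integral
      sin (of_int j * pi) / of_int j - sin (of_int j * 0) / of_int j) {0..pi}"
    by (intro fundamental_theorem_of_calculus)
       (auto intro!: derivative_eq_intros simp: False
             simp flip: has_real_derivative_iff_has_vector_derivative)
  moreover have "sin (of_int j * pi) = 0"
    by (simp add: mult.commute sin_zero_iff_int2)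
  ultimately show ?thesis using False by simp
qed

definition dp_poly :: "nat \<Rightarrow> complex \<Rightarrow> complex" where
  "dp_poly M z = (\<Prod>k=1..M. 1 + z ^ k)"

text \<open>
  Choosing a subset of the factors of \<open>dp_poly M z\<close> that contribute a power of \<open>z\<close> chooses a partition
  into distinct parts of size at most \<open>M\<close>, so for \<open>m \<le> M\<close> the coefficient of \<open>z ^ m\<close> is \<open>q m\<close>. It is
  extracted by orthogonality on the circle of radius \<open>p\<close>; the integrand is even, which is why half of
  the circle is enough.
\<close>
lemma has_integral_dp_poly_coeff:
  assumes "m \<le> M"
  shows "((\<lambda>\<theta>. Re (dp_poly M (rcis p \<theta>) * cis (- (real m * \<theta>)))) has_integral
           pi * (real (q m) * p ^ m)) {0..pi}"
proof -
  have eq: "Re (dp_poly M (rcis p \<theta>) * cis (- (real m * \<theta>))) =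
      (\<Sum>S\<in>Pow {1..M}. p ^ \<Sum>S * cos (of_int (int (\<Sum>S) - int m) * \<theta>))" for \<theta>
  proof -
    have "Re (rcis p \<theta> ^ \<Sum>S * cis (- (real m * \<theta>))) =
        p ^ \<Sum>S * cos (of_int (int (\<Sum>S) - int m) * \<theta>)" for S
      unfolding DeMoivre2
      by (simp add: rcis_def mult.assoc cis_mult cos_diff algebra_simps)
    then show ?thesis
      unfolding dp_poly_def prod_one_plus_power sum_distrib_right Re_sum
      by (intro sum.cong refl)
  qed
  have "((\<lambda>\<theta>. \<Sum>S\<in>Pow {1..M}. p ^ \<Sum>S * cos (of_int (int (\<Sum>S) - int m) * \<theta>)) has_integral
      (\<Sum>S\<in>Pow {1..M}. p ^ \<Sum>S * (if int (\<Sum>S) - int m = 0 then pi else 0))) {0..pi}"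
    by (intro has_integral_sum has_integral_mult_right has_integral_cos_int) simp
  moreover have "(\<Sum>S\<in>Pow {1..M}. p ^ \<Sum>S * (if int (\<Sum>S) - int m = 0 then pi else 0))
      = (\<Sum>S\<in>{S\<in>Pow {1..M}. \<Sum>S = m}. p ^ m * pi)"
    by (subst sum.inter_filter) (auto intro!: sum.cong simp flip: of_nat_sum)
  ultimately show ?thesis
    unfolding eq by (simp add: q_eq_card_Pow[OF assms] mult_ac)
qed

section \<open>Moments and hyperbolic functions\<close>

text \<open>
  Each of the three series telescopes: there is a polynomial \<open>g\<close> of the same degree as the weight \<open>f\<close>
  with \<open>f k = g k - p * g (Suc k)\<close>, and the sum is \<open>g 0\<close>.
\<close>
lemma sums_power_nat_times_geometric:
  fixes p :: real
  assumes "0 < p" "p < 1"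
  shows "(\<lambda>k. real k * p ^ k) sums (p / (1 - p)\<^sup>2)"
    and "(\<lambda>k. (real k)\<^sup>2 * p ^ k) sums (p * (1 + p) / (1 - p) ^ 3)"
    and "(\<lambda>k. (real k) ^ 3 * p ^ k) sums (p * (1 + 4 * p + p\<^sup>2) / (1 - p) ^ 4)"
proof -
  \<comment> \<open>here \<open>f\<close> includes the factor \<open>p ^ k\<close>, whereas \<open>g\<close> does not\<close>
  have tele: "f sums (g 0 * p ^ 0 - 0)"
    if "\<And>k. f k = g k * p ^ k - g (Suc k) * p ^ Suc k" "(\<lambda>k. g k * p ^ k) \<longlonglongrightarrow> 0" for f g :: "nat \<Rightarrow> real"
  proof -
    have "f = (\<lambda>k. g k * p ^ k - g (Suc k) * p ^ Suc k)"
      by (rule ext) (rule that(1))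
    with telescope_sums'[OF that(2)] show ?thesis by simp
  qed
  have nz: "1 - p \<noteq> 0" using assms by simp
  define d where "d = 1 - p"
  have p: "p = 1 - d" by (simp add: d_def)
  have d0: "d \<noteq> 0" using nz by (simp add: d_def)
  have "(\<lambda>k. (real k / (1 - p) + p / (1 - p)\<^sup>2) * p ^ k) \<longlonglongrightarrow> 0"
    using assms by real_asymp
  from tele[OF _ this, of "\<lambda>k. real k * p ^ k"]
  show "(\<lambda>k. real k * p ^ k) sums (p / (1 - p)\<^sup>2)"
    using d0 unfolding d_def[symmetric] unfolding p by (simp add: field_simps power2_eq_square)
  have "(\<lambda>k. ((real k)\<^sup>2 / (1 - p) + 2 * p * real k / (1 - p)\<^sup>2 + p * (1 + p) / (1 - p) ^ 3) * p ^ k)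
      \<longlonglongrightarrow> 0"
    using assms by real_asymp
  from tele[OF _ this, of "\<lambda>k. (real k)\<^sup>2 * p ^ k"]
  show "(\<lambda>k. (real k)\<^sup>2 * p ^ k) sums (p * (1 + p) / (1 - p) ^ 3)"
    using d0 unfolding d_def[symmetric] unfolding p
    by (simp add: field_simps power2_eq_square power3_eq_cube)
  have "(\<lambda>k. ((real k) ^ 3 / (1 - p) + 3 * p * (real k)\<^sup>2 / (1 - p)\<^sup>2
        + 3 * p * (1 + p) * real k / (1 - p) ^ 3 + p * (1 + 4 * p + p\<^sup>2) / (1 - p) ^ 4) * p ^ k)
      \<longlonglongrightarrow> 0"
    using assms by real_asymp
  from tele[OF _ this, of "\<lambda>k. (real k) ^ 3 * p ^ k"]
  show "(\<lambda>k. (real k) ^ 3 * p ^ k) sums (p * (1 + 4 * p + p\<^sup>2) / (1 - p) ^ 4)"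
    using d0 unfolding d_def[symmetric] unfolding p
    by (simp add: field_simps power2_eq_square power3_eq_cube power4_eq_xxxx)
qed

text \<open>
  Since \<open>4 * sinh x ^ 3 = sinh (3 * x) - 3 * sinh x\<close>, the power series can be compared term by term; for
  odd \<open>n\<close> this is \<open>4 * n * (n - 1) * (n - 2) \<le> 3 ^ n - 3\<close>, with equality for \<open>n = 1, 3, 5\<close>. The inequality
  is used twice: it bounds the second moment, and it makes \<open>csch_defect\<close> decreasing.
\<close>
lemma cube_cosh_le_sinh_cube:
  fixes x :: real
  assumes "x \<ge> 0"
  shows "x ^ 3 * cosh x \<le> sinh x ^ 3"
proof -
  have key: "4 * real n * (real n - 1) * (real n - 2) \<le> 3 ^ n - 3" if "odd n" for n :: nat
  proof -
    have big: "4 * (real n) ^ 3 \<le> 3 ^ n - 3" if "n \<ge> 7" for n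
      using that
    proof (induction n rule: dec_induct)
      case (step n)
      define m where "m = real n"
      have m: "m \<ge> 7" using step by (simp add: m_def)
      have "7 * m \<le> m * m" "7 * (m * m) \<le> m * (m * m)"
        using m by (intro mult_right_mono; simp)+
      with m have "1 + 3 * m + 3 * (m * m) \<le> 2 * (m * (m * m))" by linarith
      then have "(real (Suc n)) ^ 3 \<le> 3 * real n ^ 3"
        by (simp add: power3_eq_cube algebra_simps flip: m_def)
      with step show ?case by simp
    qed simp
    show ?thesis
    proof (cases "n \<ge> 7")
      case True
      have "(real n - 1) * (real n - 2) \<le> real n * real n"
        using True by (intro mult_mono) auto
      then have "4 * real n * ((real n - 1) * (real n - 2)) \<le> 4 * real n * (real n * real n)"
        by (intro mult_left_mono) auto
      with big[OF True] show ?thesis by (simp add: power3_eq_cube mult.assoc)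
    next
      case False
      then have "n \<in> {..<7}" by simp
      also have "{..<7::nat} = {0,1,2,3,4,5,6}" by auto
      finally show ?thesis using that by auto
    qed
  qed
  have s3: "(\<lambda>n. if even n then 0 else (3 * x) ^ n / fact n) sums sinh (3 * x)"
    using sinh_converges[of "3 * x"] by (simp add: scaleR_conv_of_real divide_inverse mult.commute cong: if_cong)
  have s1: "(\<lambda>n. if even n then 0 else x ^ n / fact n) sums sinh x"
    using sinh_converges[of x] by (simp add: scaleR_conv_of_real divide_inverse mult.commute cong: if_cong)
  have L: "(\<lambda>n. ((if even n then 0 else (3 * x) ^ n / fact n) - 3 * (if even n then 0 else x ^ n / fact n)) / 4)
      sums ((sinh (3 * x) - 3 * sinh x) / 4)"
    by (intro sums_divide sums_diff s3 sums_mult s1)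
  have "(\<lambda>n. x ^ 3 * (if even n then x ^ n / fact n else 0)) sums (x ^ 3 * cosh x)"
    using sums_mult[OF cosh_converges[of x], of "x ^ 3"]
    by (simp add: scaleR_conv_of_real divide_inverse mult.commute cong: if_cong)
  moreover have "x ^ 3 * (if even n then x ^ n / fact n else 0) =
      (if even (n + 3) then 0 else real (n+3) * (real (n+3) - 1) * (real (n+3) - 2) * x ^ (n+3) / fact (n + 3))" for n
  proof -
    have f: "fact (n + 3) = (real n + 3) * (real n + 2) * (real n + 1) * fact n"
      by (simp add: numeral_3_eq_3 algebra_simps)
    have "(real n + 3) * (real n + 2) * (real n + 1) \<noteq> 0" by (simp add: add_nonneg_eq_0_iff)
    then have "(real n + 3) * (real n + 2) * (real n + 1) * (x ^ n * x ^ 3) / fact (n + 3) = x ^ 3 * (x ^ n / fact n)"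
      unfolding f by (simp add: mult.commute)
    then show ?thesis by (simp add: power_add add.commute)
  qed
  ultimately have "(\<lambda>n. if even (n + 3) then 0 else real (n+3) * (real (n+3) - 1) * (real (n+3) - 2) * x ^ (n+3) / fact (n + 3)) sums (x ^ 3 * cosh x)"
    by simp
  then have R: "(\<lambda>n. if even n then 0 else real n * (real n - 1) * (real n - 2) * x ^ n / fact n) sums (x ^ 3 * cosh x)"
    using sums_iff_shift[of "\<lambda>n. if even n then 0 else real n * (real n - 1) * (real n - 2) * x ^ n / fact n" 3 "x ^ 3 * cosh x"]
    by (simp add: numeral_3_eq_3 lessThan_Suc)
  have "x ^ 3 * cosh x \<le> (sinh (3 * x) - 3 * sinh x) / 4"
  proof (rule sums_le[OF _ R L])
    fix n
    show "(if even n then 0 else real n * (real n - 1) * (real n - 2) * x ^ n / fact n)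
      \<le> ((if even n then 0 else (3 * x) ^ n / fact n) - 3 * (if even n then 0 else x ^ n / fact n)) / 4"
    proof (cases "even n")
      case False
      define y where "y = x ^ n / fact n"
      have "(4 * real n * (real n - 1) * (real n - 2)) * y \<le> (3 ^ n - 3) * y"
        using key[OF False] assms by (intro mult_right_mono) (auto simp: y_def)
      moreover have "real n * (real n - 1) * (real n - 2) * x ^ n / fact n = real n * (real n - 1) * (real n - 2) * y"
        "(3 * x) ^ n / fact n = 3 ^ n * y" by (simp_all add: y_def power_mult_distrib)
      ultimately show ?thesis using False by (simp add: y_def[symmetric] left_diff_distrib)
    qed auto
  qed
  also have "\<dots> = sinh x ^ 3"
  proof -
    have "sinh (3 * x) = sinh (2 * x + x)" by simp
    also have "\<dots> = sinh x * (3 * (cosh x)\<^sup>2 + (sinh x)\<^sup>2)"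
      unfolding sinh_add sinh_double cosh_double by (simp add: algebra_simps power2_eq_square)
    also have "\<dots> = 3 * sinh x + 4 * sinh x ^ 3"
      unfolding cosh_square_eq by (simp add: algebra_simps power2_eq_square power3_eq_cube)
    finally show ?thesis by simp
  qed
  finally show ?thesis .
qed

lemma sinh_le_x_cosh: "x \<ge> 0 \<Longrightarrow> sinh x \<le> x * cosh (x::real)"
proof -
  assume "x \<ge> 0"
  have "(\<lambda>x. x * cosh x - sinh x) 0 \<le> (\<lambda>x. x * cosh x - sinh x) x"
  proof (rule DERIV_nonneg_imp_nondecreasing[OF \<open>x \<ge> 0\<close>])
    fix y :: real assume "0 \<le> y"
    then show "\<exists>d. ((\<lambda>x. x * cosh x - sinh x) has_real_derivative d) (at y) \<and> d \<ge> 0"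
      by (intro exI[of _ "y * sinh y"]) (auto intro!: derivative_eq_intros)
  qed
  then show ?thesis by simp
qed

lemma x_le_sinh: "x \<ge> 0 \<Longrightarrow> x \<le> sinh (x::real)"
proof -
  assume "x \<ge> 0"
  have "(\<lambda>x. sinh x - x) 0 \<le> (\<lambda>x. sinh x - x) x"
  proof (rule DERIV_nonneg_imp_nondecreasing[OF \<open>x \<ge> 0\<close>])
    fix y :: real
    show "\<exists>d. ((\<lambda>x. sinh x - x) has_real_derivative d) (at y) \<and> d \<ge> 0"
      by (intro exI[of _ "cosh y - 1"]) (auto intro!: derivative_eq_intros simp: cosh_real_ge_1)
  qed
  then show ?thesis by simp
qed

text \<open>
  In terms of \<open>sinh (t/2)\<close> the closed forms of the moments can be compared with their leading terms
  \<open>1 / t\<^sup>2\<close>, \<open>2 / t ^ 3\<close> and \<open>6 / t ^ 4\<close>.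
\<close>
lemma sums_exp_moments:
  fixes t :: real
  assumes "t > 0"
  shows "(\<lambda>k. real k * exp (-t) ^ k) sums (1 / (4 * sinh (t/2) ^ 2))"
    and "(\<lambda>k. (real k)\<^sup>2 * exp (-t) ^ k) sums (cosh (t/2) / (4 * sinh (t/2) ^ 3))"
    and "(\<lambda>k. (real k) ^ 3 * exp (-t) ^ k) sums ((3 + 2 * sinh (t/2) ^ 2) / (8 * sinh (t/2) ^ 4))"
proof -
  define e where "e = exp (-(t/2))"
  have e: "0 < e" "e < 1" using assms by (auto simp: e_def)
  have p: "exp (-t) = e\<^sup>2" by (simp add: e_def power2_eq_square flip: exp_add)
  have i: "exp (t/2) = 1 / e" by (simp add: e_def exp_minus field_simps)
  have sh: "sinh (t/2) = (1 - e\<^sup>2) / (2 * e)" and ch: "cosh (t/2) = (1 + e\<^sup>2) / (2 * e)"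
    using e unfolding sinh_field_def cosh_field_def i e_def[symmetric] by (simp_all add: field_simps power2_eq_square)
  have "e\<^sup>2 < 1\<^sup>2" using e by (intro power_strict_mono) auto
  then have d: "1 - e\<^sup>2 \<noteq> 0" by simp
  have p1: "0 < exp (-t)" "exp (-t) < 1" using assms by auto
  note s = sums_power_nat_times_geometric[OF p1, unfolded p]
  have "e\<^sup>2 / (1 - e\<^sup>2)\<^sup>2 = 1 / (4 * sinh (t/2) ^ 2)"
    using e d unfolding sh by (simp add: field_simps)
  with s(1) show "(\<lambda>k. real k * exp (-t) ^ k) sums (1 / (4 * sinh (t/2) ^ 2))" by (simp add: p)
  have "e\<^sup>2 * (1 + e\<^sup>2) / (1 - e\<^sup>2) ^ 3 = cosh (t/2) / (4 * sinh (t/2) ^ 3)"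
  proof -
    define D where "D = 1 - e\<^sup>2"
    show ?thesis
      using e d unfolding sh ch D_def[symmetric]
      by (simp add: power_divide field_simps) (simp add: eval_nat_numeral)
  qed
  with s(2) show "(\<lambda>k. (real k)\<^sup>2 * exp (-t) ^ k) sums (cosh (t/2) / (4 * sinh (t/2) ^ 3))" by (simp add: p)
  have "e\<^sup>2 * (1 + 4 * e\<^sup>2 + (e\<^sup>2)\<^sup>2) / (1 - e\<^sup>2) ^ 4 = (3 + 2 * sinh (t/2) ^ 2) / (8 * sinh (t/2) ^ 4)"
  proof -
    have "(3 + 2 * sinh (t/2) ^ 2) = (1 + 4 * e\<^sup>2 + (e\<^sup>2)\<^sup>2) / (2 * e\<^sup>2)"
      using e unfolding sh by (simp add: field_simps power2_eq_square)
    moreover have "8 * sinh (t/2) ^ 4 = (1 - e\<^sup>2) ^ 4 / (2 * e ^ 4)"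
      using e unfolding sh by (simp add: power_divide field_simps)
    ultimately have "(3 + 2 * sinh (t/2) ^ 2) / (8 * sinh (t/2) ^ 4) =
        ((1 + 4 * e\<^sup>2 + (e\<^sup>2)\<^sup>2) / (2 * e\<^sup>2)) / ((1 - e\<^sup>2) ^ 4 / (2 * e ^ 4))" by simp
    also have "\<dots> = e\<^sup>2 * (1 + 4 * e\<^sup>2 + (e\<^sup>2)\<^sup>2) / (1 - e\<^sup>2) ^ 4"
      using e by (simp add: eval_nat_numeral)
    finally show ?thesis by simp
  qed
  with s(3) show "(\<lambda>k. (real k) ^ 3 * exp (-t) ^ k) sums ((3 + 2 * sinh (t/2) ^ 2) / (8 * sinh (t/2) ^ 4))" by (simp add: p)
qed

section \<open>The mean of the tilted distribution\<close>

text \<open>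
  The difference between \<open>1 / y\<^sup>2\<close> and the closed form of \<open>\<Sum>k. k * exp (-y) ^ k\<close>. Comparing the mean
  below with \<open>\<Sum>j. (-1) ^ j / (j + 1)\<^sup>2\<close> leaves exactly an alternating sum of these defects.
\<close>
definition csch_defect :: "real \<Rightarrow> real" where
  "csch_defect y = 1 / y\<^sup>2 - 1 / (4 * sinh (y / 2) ^ 2)"

text \<open>
  Both bounds come from \<open>x \<le> sinh x \<le> x * cosh x\<close> at \<open>x = y / 2\<close>, squared.
\<close>
lemma csch_defect_bounds:
  assumes "y > 0"
  shows "0 \<le> csch_defect y" "csch_defect y \<le> 1 / 4"
proof -
  define x s where "x = y / 2" and "s = sinh x"
  have x: "x > 0" and y: "y = 2 * x" using assms by (auto simp: x_def)
  have s: "x \<le> s" using x_le_sinh[of x] x by (simp add: s_def)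
  have "s \<le> x * cosh x" using sinh_le_x_cosh[of x] x by (simp add: s_def)
  then have "s\<^sup>2 \<le> (x * cosh x)\<^sup>2" using s x by (intro power_mono) auto
  also have "\<dots> = x\<^sup>2 + x\<^sup>2 * s\<^sup>2"
    by (simp add: power_mult_distrib cosh_square_eq s_def algebra_simps)
  finally have u: "s\<^sup>2 \<le> x\<^sup>2 + x\<^sup>2 * s\<^sup>2" .
  have eq: "csch_defect y = (1 / x\<^sup>2 - 1 / s\<^sup>2) / 4"
    unfolding csch_defect_def y by (simp add: s_def power_mult_distrib field_simps)
  have "x\<^sup>2 \<le> s\<^sup>2" using s x by (intro power_mono) auto
  then have "1 / s\<^sup>2 \<le> 1 / x\<^sup>2" using x by (intro divide_left_mono) (auto simp: s_def)
  then show "0 \<le> csch_defect y" unfolding eq by simp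
  have "1 / x\<^sup>2 - 1 / s\<^sup>2 \<le> 1"
    using u x s by (simp add: divide_simps)
  then show "csch_defect y \<le> 1 / 4" unfolding eq by simp
qed

lemma csch_defect_antimono:
  assumes "0 < a" "a \<le> b"
  shows "csch_defect b \<le> csch_defect a"
proof (rule DERIV_nonpos_imp_nonincreasing[OF assms(2)])
  fix y assume "a \<le> y" "y \<le> b"
  then have y: "y > 0" using assms by simp
  let ?x = "y / 2"
  have s: "sinh ?x > 0" using y by simp
  have "(csch_defect has_real_derivative (- 2 / y ^ 3 + cosh ?x / (4 * sinh ?x ^ 3))) (at y)"
    unfolding csch_defect_def[abs_def] using y s
    by (auto intro!: derivative_eq_intros simp: field_simps) (simp add: eval_nat_numeral field_simps)
  moreover have "cosh ?x / (4 * sinh ?x ^ 3) \<le> 2 / y ^ 3"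
  proof -
    have "?x ^ 3 * cosh ?x \<le> sinh ?x ^ 3" using cube_cosh_le_sinh_cube[of ?x] y by simp
    then have "y ^ 3 * cosh ?x \<le> 8 * sinh ?x ^ 3" by (simp add: power_divide)
    then show ?thesis using y s by (simp add: divide_simps) (simp add: algebra_simps)
  qed
  ultimately show "\<exists>d. (csch_defect has_real_derivative d) (at y) \<and> d \<le> 0"
    by (intro exI conjI) auto
qed

lemma alternating_partial_sum_bounds:
  fixes a :: "nat \<Rightarrow> real"
  assumes "\<And>i. a (Suc i) \<le> a i" "\<And>i. 0 \<le> a i"
  shows "0 \<le> (\<Sum>i<n. (-1) ^ i * a i) \<and> (\<Sum>i<n. (-1) ^ i * a i) \<le> a 0"
  using assms
proof (induction n arbitrary: a)
  case (Suc n)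
  have "(\<Sum>i<Suc n. (-1) ^ i * a i) = a 0 - (\<Sum>i<n. (-1) ^ i * a (Suc i))"
    by (subst sum.lessThan_Suc_shift) (simp add: sum_negf)
  with Suc.IH[of "\<lambda>i. a (Suc i)"] Suc.prems(1)[of 0] Suc.prems(2)[of 0] show ?case
    using Suc.prems order_trans by (fastforce simp del: sum.lessThan_Suc)
qed simp

text \<open>
  Remove from \<open>\<Sum>i. 1 / (i + 1)\<^sup>2 = pi\<^sup>2 / 6\<close> twice its terms with even \<open>i + 1\<close>, which are a quarter of
  the whole series.
\<close>
lemma alternating_inverse_squares_sums:
  "(\<lambda>i. (-1) ^ i / (real i + 1)\<^sup>2) sums (pi\<^sup>2 / 12)"
proof -
  let ?f = "\<lambda>i. if odd i then 2 / (real i + 1)\<^sup>2 else 0"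
  have S: "(\<lambda>i. 1 / (real i + 1)\<^sup>2) sums (pi\<^sup>2 / 6)" using inverse_squares_sums by (simp add: add.commute)
  have "(\<lambda>i. (1 / 2) * (1 / (real i + 1)\<^sup>2)) sums ((1 / 2) * (pi\<^sup>2 / 6))"
    by (rule sums_mult[OF S])
  also have "(\<lambda>i. (1 / 2) * (1 / (real i + 1)\<^sup>2)) = (\<lambda>i. ?f (2 * i + 1))"
  proof
    fix i :: nat
    have "(2 + real (2 * i))\<^sup>2 = 4 * (real i + 1)\<^sup>2" by (simp add: power2_eq_square algebra_simps)
    then show "(1 / 2) * (1 / (real i + 1)\<^sup>2) = ?f (2 * i + 1)" by simp
  qed
  also have "(\<lambda>i. ?f (2 * i + 1)) sums ((1 / 2) * (pi\<^sup>2 / 6)) \<longleftrightarrow> ?f sums ((1 / 2) * (pi\<^sup>2 / 6))"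
  proof (rule sums_mono_reindex)
    show "?f i = 0" if "i \<notin> range (\<lambda>i. 2 * i + 1)" for i
      using that by (metis (mono_tags) oddE rangeI)
  qed (simp add: strict_mono_def)
  finally have "?f sums ((1 / 2) * (pi\<^sup>2 / 6))" .
  from sums_diff[OF S this]
  have "(\<lambda>i. 1 / (real i + 1)\<^sup>2 - ?f i) sums (pi\<^sup>2 / 12)" by simp
  moreover have "1 / (real i + 1)\<^sup>2 - ?f i = (-1) ^ i / (real i + 1)\<^sup>2" for i
    by (simp add: diff_divide_distrib[symmetric])
  ultimately show ?thesis by simp
qed

lemma alternating_geometric_sum:
  fixes x :: real
  shows "(1 + x) * (\<Sum>j<N. (-1) ^ j * x ^ Suc j) = x * (1 - (- x) ^ N)"
proof (induction N)
  case (Suc N)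
  have "(-1) ^ N * x ^ N = (- x) ^ N" by (simp add: power_mult_distrib[symmetric])
  with Suc show ?case by (simp add: algebra_simps)
qed simp

text \<open>
  The mean of the tilted distribution, up to a bounded error. Expanding \<open>x / (1 + x)\<close> into the
  alternating geometric series and summing over \<open>k\<close> first gives
  \<open>\<Sum>j. (-1) ^ j / (4 * sinh ((j + 1) * t / 2) ^ 2)\<close>. Replacing each term by \<open>1 / ((j + 1) * t)\<^sup>2\<close> produces
  the main term, and the error is an alternating sum of the decreasing values of \<open>csch_defect\<close>, so it
  lies between \<open>0\<close> and \<open>1 / 4\<close>. The exchange of the two summations is avoided: partial sums of even and
  of odd length bound \<open>x / (1 + x)\<close> from the two sides.
\<close>
lemma fermi_mean_bounds:
  fixes t :: real
  assumes "t > 0"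
  shows "summable (\<lambda>k. real k * (exp (-t) ^ k / (1 + exp (-t) ^ k)))"
    and "pi\<^sup>2 / (12 * t\<^sup>2) - 1 / 4 \<le> (\<Sum>k. real k * (exp (-t) ^ k / (1 + exp (-t) ^ k)))"
    and "(\<Sum>k. real k * (exp (-t) ^ k / (1 + exp (-t) ^ k))) \<le> pi\<^sup>2 / (12 * t\<^sup>2)"
proof -
  define p where "p = exp (-t)"
  have p: "0 < p" "p < 1" using assms by (auto simp: p_def)
  have pk: "0 < p ^ k" "p ^ k \<le> 1" for k using p by (auto simp: power_le_one)
  define f where "f = (\<lambda>k. real k * (p ^ k / (1 + p ^ k)))"
  have "summable (\<lambda>k. real k * p ^ k)"
    using sums_exp_moments(1)[OF assms] by (auto simp: sums_iff p_def)
  then have sf: "summable f"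
  proof (rule summable_comparison_test'[where N = 0])
    fix k :: nat
    have "p ^ k / (1 + p ^ k) \<le> p ^ k" using pk[of k] by (simp add: divide_simps)
    then have "f k \<le> real k * p ^ k" unfolding f_def by (intro mult_left_mono) auto
    moreover have "0 \<le> f k" using pk[of k] by (simp add: f_def)
    ultimately show "norm (f k) \<le> real k * p ^ k" by simp
  qed
  then show "summable (\<lambda>k. real k * (exp (-t) ^ k / (1 + exp (-t) ^ k)))"
    by (simp add: f_def p_def)
  define b where "b = (\<lambda>j. 1 / (real j + 1)\<^sup>2 :: real)"
  define h where "h = (\<lambda>j. csch_defect ((real j + 1) * t))"
  define P where "P = (\<lambda>N. (\<Sum>j<N. (-1) ^ j * b j) / t\<^sup>2 - (\<Sum>j<N. (-1) ^ j * h j))"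
  have partial: "(\<lambda>k. real k * (\<Sum>j<N. (-1) ^ j * (p ^ k) ^ Suc j)) sums P N" for N
  proof -
    have "(\<lambda>k. real k * (p ^ k) ^ Suc j) sums (b j / t\<^sup>2 - h j)" for j
    proof -
      have "(real j + 1) * t > 0" using assms by simp
      from sums_exp_moments(1)[OF this]
      have "(\<lambda>k. real k * exp (- ((real j + 1) * t)) ^ k) sums (1 / (4 * sinh ((real j + 1) * t / 2) ^ 2))" .
      moreover have "exp (- ((real j + 1) * t)) ^ k = (p ^ k) ^ Suc j" for k
        by (simp add: p_def exp_of_nat_mult[symmetric] algebra_simps flip: exp_add)
      moreover have "1 / (4 * sinh ((real j + 1) * t / 2) ^ 2) = b j / t\<^sup>2 - h j"
        by (simp add: h_def b_def csch_defect_def power_mult_distrib)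
      ultimately show ?thesis by simp
    qed
    then have "(\<lambda>k. \<Sum>j<N. (-1) ^ j * (real k * (p ^ k) ^ Suc j)) sums (\<Sum>j<N. (-1) ^ j * (b j / t\<^sup>2 - h j))"
      by (intro sums_sum sums_mult)
    moreover have "(\<Sum>j<N. (-1) ^ j * (b j / t\<^sup>2 - h j)) = P N"
      by (simp add: P_def sum_subtractf right_diff_distrib sum_divide_distrib)
    moreover have "(\<Sum>j<N. (-1) ^ j * (real k * (p ^ k) ^ Suc j)) = real k * (\<Sum>j<N. (-1) ^ j * (p ^ k) ^ Suc j)" for k
      by (simp add: sum_distrib_left mult_ac)
    ultimately show ?thesis by simp
  qed
  have geo: "(\<Sum>j<N. (-1) ^ j * (p ^ k) ^ Suc j) = p ^ k / (1 + p ^ k) * (1 - (- (p ^ k)) ^ N)" for k N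
    using alternating_geometric_sum[of "p ^ k" N] pk[of k] by (simp add: field_simps)
  have h: "0 \<le> (\<Sum>j<N. (-1) ^ j * h j)" "(\<Sum>j<N. (-1) ^ j * h j) \<le> 1 / 4" for N
  proof -
    have "h (Suc i) \<le> h i" for i unfolding h_def using assms by (intro csch_defect_antimono) auto
    moreover have "0 \<le> h i" "h 0 \<le> 1 / 4" for i unfolding h_def using assms by (intro csch_defect_bounds; simp)+
    ultimately show "0 \<le> (\<Sum>j<N. (-1) ^ j * h j)" "(\<Sum>j<N. (-1) ^ j * h j) \<le> 1 / 4"
      using alternating_partial_sum_bounds[of h N] by fastforce+
  qed
  have lim: "(\<lambda>N. (\<Sum>j<N. (-1) ^ j * b j) / t\<^sup>2) \<longlonglongrightarrow> pi\<^sup>2 / 12 / t\<^sup>2"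
    using alternating_inverse_squares_sums assms unfolding sums_def b_def
    by (intro tendsto_divide) auto
  have even: "P (2 * J) \<le> suminf f" for J
  proof (rule sums_le[OF _ partial summable_sums[OF sf]])
    fix k
    have "p ^ k / (1 + p ^ k) * (1 - (- (p ^ k)) ^ (2 * J)) \<le> p ^ k / (1 + p ^ k) * 1"
      using pk[of k] by (intro mult_left_mono) auto
    then show "real k * (\<Sum>j<2 * J. (-1) ^ j * (p ^ k) ^ Suc j) \<le> f k"
      unfolding geo f_def by (intro mult_left_mono) auto
  qed
  have odd: "suminf f \<le> P (2 * J + 1)" for J
  proof (rule sums_le[OF _ summable_sums[OF sf] partial])
    fix k
    have "p ^ k / (1 + p ^ k) * 1 \<le> p ^ k / (1 + p ^ k) * (1 - (- (p ^ k)) ^ (2 * J + 1))"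
      using pk[of k] by (intro mult_left_mono) auto
    then show "f k \<le> real k * (\<Sum>j<2 * J + 1. (-1) ^ j * (p ^ k) ^ Suc j)"
      unfolding geo f_def by (intro mult_left_mono) auto
  qed
  have "pi\<^sup>2 / 12 / t\<^sup>2 - 1 / 4 \<le> suminf f"
  proof (rule LIMSEQ_le_const2)
    show "(\<lambda>J. (\<Sum>j<2 * J. (-1) ^ j * b j) / t\<^sup>2 - 1 / 4) \<longlonglongrightarrow> pi\<^sup>2 / 12 / t\<^sup>2 - 1 / 4"
      by (intro tendsto_diff tendsto_const filterlim_compose[OF lim] mult_nat_left_at_top) simp
    have "(\<Sum>j<2 * J. (-1) ^ j * b j) / t\<^sup>2 - 1 / 4 \<le> suminf f" for J
      using even[of J] h(2)[of "2 * J"] by (simp add: P_def)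
    then show "\<exists>N. \<forall>n\<ge>N. (\<Sum>j<2 * n. (-1) ^ j * b j) / t\<^sup>2 - 1 / 4 \<le> suminf f" by blast
  qed
  then show "pi\<^sup>2 / (12 * t\<^sup>2) - 1 / 4 \<le> (\<Sum>k. real k * (exp (-t) ^ k / (1 + exp (-t) ^ k)))"
    by (simp add: f_def p_def)
  have "suminf f \<le> pi\<^sup>2 / 12 / t\<^sup>2"
  proof (rule LIMSEQ_le_const)
    show "(\<lambda>J. (\<Sum>j<2 * J + 1. (-1) ^ j * b j) / t\<^sup>2) \<longlonglongrightarrow> pi\<^sup>2 / 12 / t\<^sup>2"
      by (rule filterlim_compose[OF lim]) real_asymp
    have "suminf f \<le> (\<Sum>j<2 * J + 1. (-1) ^ j * b j) / t\<^sup>2" for J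
      using odd[of J] h(1)[of "2 * J + 1"] by (simp add: P_def)
    then show "\<exists>N. \<forall>n\<ge>N. suminf f \<le> (\<Sum>j<2 * n + 1. (-1) ^ j * b j) / t\<^sup>2" by blast
  qed
  then show "(\<Sum>k. real k * (exp (-t) ^ k / (1 + exp (-t) ^ k))) \<le> pi\<^sup>2 / (12 * t\<^sup>2)"
    by (simp add: f_def p_def)
qed

section \<open>Decay of the modulus\<close>

text \<open>
  Real part of the geometric series with ratio \<open>exp (-t) * cis \<theta>\<close>.
\<close>
lemma sums_geometric_one_minus_cos:
  fixes t \<theta> :: real
  assumes "t > 0"
  defines "u \<equiv> 1 - cos \<theta>"
  shows "(\<lambda>k. exp (-t) ^ k * (1 - cos (real k * \<theta>))) sums
           ((1 + exp (-t)) / (1 - exp (-t)) * (u / (u + (cosh t - 1))) / 2)"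
proof -
  define p where "p = exp (-t)"
  have p: "0 < p" "p < 1" using assms by (auto simp: p_def)
  have "(\<lambda>k. rcis p \<theta> ^ k) sums (1 / (1 - rcis p \<theta>))"
    using p by (intro geometric_sums) simp
  then have "(\<lambda>k. Re (rcis p \<theta> ^ k)) sums Re (1 / (1 - rcis p \<theta>))"
    by (rule sums_Re)
  then have c: "(\<lambda>k. p ^ k * cos (real k * \<theta>)) sums Re (1 / (1 - rcis p \<theta>))"
    by (simp add: DeMoivre2)
  have "Re (1 / (1 - rcis p \<theta>)) = (1 - p * cos \<theta>) / ((1 - p * cos \<theta>)\<^sup>2 + (p * sin \<theta>)\<^sup>2)"
    by (simp add: Re_divide power2_eq_square)
  also have "(1 - p * cos \<theta>)\<^sup>2 + (p * sin \<theta>)\<^sup>2 = 1 - 2 * p * cos \<theta> + p\<^sup>2 * ((cos \<theta>)\<^sup>2 + (sin \<theta>)\<^sup>2)"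
    by algebra
  also have "\<dots> = (1 - p)\<^sup>2 + 2 * p * u"
    unfolding sin_cos_squared_add2 by (simp add: u_def power2_eq_square algebra_simps)
  also have "1 - p * cos \<theta> = 1 - p + p * u" by (simp add: u_def algebra_simps)
  finally have re: "Re (1 / (1 - rcis p \<theta>)) = (1 - p + p * u) / ((1 - p)\<^sup>2 + 2 * p * u)" .
  have u: "u \<ge> 0" by (simp add: u_def)
  have "(\<lambda>k. p ^ k - p ^ k * cos (real k * \<theta>)) sums
      (1 / (1 - p) - (1 - p + p * u) / ((1 - p)\<^sup>2 + 2 * p * u))"
    using c p unfolding re by (intro sums_diff geometric_sums) auto
  moreover have "1 / (1 - p) - (1 - p + p * u) / ((1 - p)\<^sup>2 + 2 * p * u) =
      (1 + p) / (1 - p) * (u / (u + (cosh t - 1))) / 2"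
  proof -
    have e: "exp t = 1 / p" by (simp add: p_def exp_minus field_simps)
    have "cosh t - 1 = (1 - p)\<^sup>2 / (2 * p)"
      using p unfolding cosh_field_def e p_def[symmetric] by (simp add: field_simps power2_eq_square)
    then have cD: "u + (cosh t - 1) = ((1 - p)\<^sup>2 + 2 * p * u) / (2 * p)"
      using p by (simp add: field_simps)
    define D where "D = (1 - p)\<^sup>2 + 2 * p * u"
    have "(1 + p) / (1 - p) * (u / (u + (cosh t - 1))) / 2 = p * (1 + p) * u / ((1 - p) * D)"
      unfolding cD D_def[symmetric] by simp
    moreover have D: "D > 0" using p u by (auto simp: D_def intro!: add_pos_nonneg)
    moreover have "1 / (1 - p) - (1 - p + p * u) / D = (D - (1 - p + p * u) * (1 - p)) / ((1 - p) * D)"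
      using p D by (simp add: field_simps)
    moreover have "D - (1 - p + p * u) * (1 - p) = p * (1 + p) * u"
      by (simp add: D_def power2_eq_square algebra_simps)
    ultimately show ?thesis by (simp add: D_def)
  qed
  ultimately show ?thesis by (simp add: p_def right_diff_distrib)
qed

text \<open>
  The convex function \<open>1 / (1 + p)\<^sup>2\<close> lies above its tangent at \<open>p = 1 / 3\<close>. This tangent is
  \<open>27 / 32 * (1 - p)\<close>, which vanishes at \<open>p = 1\<close>.
\<close>
lemma inverse_one_plus_square_ge:
  fixes p :: real
  assumes "p \<ge> 0"
  shows "27 / 32 * (p - p\<^sup>2) \<le> p / (1 + p)\<^sup>2"
proof -
  have "32 - 27 * (1 - p) * (1 + p)\<^sup>2 = (3 * p - 1)\<^sup>2 * (3 * p + 5)"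
    by (simp add: power2_eq_square algebra_simps)
  then have "27 * (1 - p) * (1 + p)\<^sup>2 \<le> 32" using assms by (smt (verit) mult_nonneg_nonneg zero_le_power2)
  then have "p * (27 * (1 - p) * (1 + p)\<^sup>2) \<le> p * 32" using assms by (intro mult_left_mono)
  then show ?thesis using assms by (simp add: divide_simps) (simp add: power2_eq_square algebra_simps)
qed

text \<open>
  The exponent that controls the decay of the generating function away from the positive axis. The
  tangent bound replaces the weights by \<open>27 / 32 * (p ^ k - p ^ (2 * k))\<close>, and both resulting series have
  closed forms. In the coordinate \<open>x\<close>, which is close to \<open>(\<theta> / t)\<^sup>2\<close> for small \<open>\<theta>\<close>, the series at \<open>2 * t\<close>
  contributes \<open>x / (x + 4)\<close> with a weight only slightly above \<open>1 / 2\<close>; the constant \<open>5002 / 10000\<close>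
  pays for \<open>t \<le> 1 / 34\<close>.
\<close>
lemma tail_exponent_lower_bound:
  fixes t \<theta> :: real
  assumes t: "0 < t" "t \<le> 1 / 34"
  defines "x \<equiv> (1 - cos \<theta>) / (cosh t - 1)"
  shows "summable (\<lambda>k. exp (-t) ^ k / (1 + exp (-t) ^ k)\<^sup>2 * (1 - cos (real k * \<theta>)))"
    and "27 / 32 / t * (x / (x + 1) - 5002 / 10000 * (x / (x + 4))) \<le>
         (\<Sum>k. exp (-t) ^ k / (1 + exp (-t) ^ k)\<^sup>2 * (1 - cos (real k * \<theta>)))"
proof -
  define p where "p = exp (-t)"
  have p: "0 < p" "p < 1" using t by (auto simp: p_def)
  have p2: "exp (- (2 * t)) = p\<^sup>2" by (simp add: p_def power2_eq_square flip: exp_add)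
  define u where "u = 1 - cos \<theta>"
  define c where "c = cosh t - 1"
  have c: "c > 0" using t cosh_real_one_iff[of t] cosh_real_ge_1[of t] by (simp add: c_def less_le)
  have u: "u \<ge> 0" by (simp add: u_def)
  define K where "K = (1 + p) / (1 - p)"
  define K2 where "K2 = (1 + p\<^sup>2) / (1 - p\<^sup>2)"
  note A1 = sums_geometric_one_minus_cos[OF t(1), of \<theta>, folded p_def u_def c_def, folded K_def]
  have "2 * t > 0" using t by simp
  note A2 = sums_geometric_one_minus_cos[OF this, of \<theta>, unfolded p2, folded u_def K2_def]
  have v: "p ^ k / (1 + p ^ k)\<^sup>2 \<le> p ^ k" "0 \<le> p ^ k / (1 + p ^ k)\<^sup>2" for k
  proof -
    have "p ^ k > 0" using p by simp
    moreover have "1 \<le> (1 + p ^ k)\<^sup>2" using \<open>p ^ k > 0\<close> by (intro one_le_power) auto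
    ultimately show "p ^ k / (1 + p ^ k)\<^sup>2 \<le> p ^ k" "0 \<le> p ^ k / (1 + p ^ k)\<^sup>2"
      using divide_left_mono[of 1 "(1 + p ^ k)\<^sup>2" "p ^ k"] by auto
  qed
  have "summable (\<lambda>k. p ^ k / (1 + p ^ k)\<^sup>2 * (1 - cos (real k * \<theta>)))"
  proof (rule summable_comparison_test'[OF sums_summable[OF A1], of 0])
    fix k :: nat
    have "0 \<le> p ^ k / (1 + p ^ k)\<^sup>2 * (1 - cos (real k * \<theta>))"
      using v(2)[of k] by (intro mult_nonneg_nonneg) auto
    moreover have "p ^ k / (1 + p ^ k)\<^sup>2 * (1 - cos (real k * \<theta>)) \<le> p ^ k * (1 - cos (real k * \<theta>))"
      using v(1)[of k] by (intro mult_right_mono) auto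
    ultimately show "norm (p ^ k / (1 + p ^ k)\<^sup>2 * (1 - cos (real k * \<theta>))) \<le> p ^ k * (1 - cos (real k * \<theta>))"
      by simp
  qed
  then show "summable (\<lambda>k. exp (-t) ^ k / (1 + exp (-t) ^ k)\<^sup>2 * (1 - cos (real k * \<theta>)))"
    and "27 / 32 / t * (x / (x + 1) - 5002 / 10000 * (x / (x + 4))) \<le>
         (\<Sum>k. exp (-t) ^ k / (1 + exp (-t) ^ k)\<^sup>2 * (1 - cos (real k * \<theta>)))"
    unfolding p_def[symmetric]
  proof -
    assume S: "summable (\<lambda>k. p ^ k / (1 + p ^ k)\<^sup>2 * (1 - cos (real k * \<theta>)))"
    have "27 / 32 * (K * (u / (u + c)) / 2 - K2 * (u / (u + (cosh (2 * t) - 1))) / 2) \<le>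
         (\<Sum>k. p ^ k / (1 + p ^ k)\<^sup>2 * (1 - cos (real k * \<theta>)))"
    proof (rule sums_le[OF _ sums_mult[OF sums_diff[OF A1 A2]] summable_sums[OF S]])
      fix k
      have "27 / 32 * (p ^ k - (p ^ k)\<^sup>2) * (1 - cos (real k * \<theta>)) \<le> p ^ k / (1 + p ^ k)\<^sup>2 * (1 - cos (real k * \<theta>))"
        using p by (intro mult_right_mono inverse_one_plus_square_ge) auto
      moreover have "(p ^ k)\<^sup>2 = (p\<^sup>2) ^ k" by (simp flip: power_mult add: mult.commute)
      then have "27 / 32 * (p ^ k * (1 - cos (real k * \<theta>)) - p\<^sup>2 ^ k * (1 - cos (real k * \<theta>))) =
          27 / 32 * (p ^ k - (p ^ k)\<^sup>2) * (1 - cos (real k * \<theta>))"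
        by (simp only: left_diff_distrib right_diff_distrib mult.assoc)
      ultimately show "27 / 32 * (p ^ k * (1 - cos (real k * \<theta>)) - p\<^sup>2 ^ k * (1 - cos (real k * \<theta>))) \<le>
          p ^ k / (1 + p ^ k)\<^sup>2 * (1 - cos (real k * \<theta>))" by simp
    qed
    also have "27 / 32 / t * (x / (x + 1) - 5002 / 10000 * (x / (x + 4))) \<le>
        27 / 32 * (K * (u / (u + c)) / 2 - K2 * (u / (u + (cosh (2 * t) - 1))) / 2)"
    proof -
      have x: "x \<ge> 0" using c u by (simp add: x_def u_def c_def)
      have ux: "u = x * c" using c t by (simp add: x_def u_def c_def)
      have "u / (u + c) = x * c / ((x + 1) * c)" by (simp add: ux algebra_simps)
      then have 1: "u / (u + c) = x / (x + 1)" using c by simp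
      have "u / (u + 4 * c) = x * c / ((x + 4) * c)" by (simp add: ux algebra_simps)
      then have 4: "u / (u + 4 * c) = x / (x + 4)" using c by simp
      have "cosh (2 * t) - 1 = 2 * c * (c + 2)"
        unfolding cosh_double_cosh c_def by (simp add: power2_eq_square algebra_simps)
      then have c2: "cosh (2 * t) - 1 \<ge> 4 * c" using c by (simp add: algebra_simps)
      have le4: "u / (u + (cosh (2 * t) - 1)) \<le> x / (x + 4)"
        unfolding 4[symmetric] using c c2 u by (intro divide_left_mono mult_pos_pos) auto
      have th: "(1 - p) / (1 + p) \<le> t / 2"
      proof -
        define e where "e = exp (-(t/2))"
        have e: "0 < e" by (auto simp: e_def)
        have pe: "p = e\<^sup>2" by (simp add: e_def p_def power2_eq_square flip: exp_add)
        have i: "exp (t/2) = 1 / e" by (simp add: e_def exp_minus field_simps)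
        have S: "sinh (t/2) = (1 - p) / (2 * e)" and C: "cosh (t/2) = (1 + p) / (2 * e)"
          using e unfolding sinh_field_def cosh_field_def i e_def[symmetric] pe by (simp_all add: field_simps power2_eq_square)
        have "(1 - p) / (2 * e) \<le> (t / 2 * (1 + p)) / (2 * e)"
          using sinh_le_x_cosh[of "t/2"] t unfolding S C by simp
        then have "1 - p \<le> t / 2 * (1 + p)"
          using e by (subst (asm) divide_le_cancel) auto
        then show ?thesis using p by (simp add: field_simps)
      qed
      have th0: "(1 - p) / (1 + p) > 0" using p by simp
      have K: "K / 2 \<ge> 1 / t"
        using th th0 t p unfolding K_def by (simp add: field_simps)
      have "(1 - p) / (1 + p) \<le> 1 / 68" using th t by linarith
      then have "((1 - p) / (1 + p))\<^sup>2 \<le> (1 / 68)\<^sup>2" using th0 by (intro power_mono) linarith+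
      then have "(1 - p)\<^sup>2 \<le> (1 / 68)\<^sup>2 * (1 + p)\<^sup>2"
        using p by (simp add: power_divide pos_divide_le_eq)
      moreover have "(1 / 68)\<^sup>2 * (1 + p)\<^sup>2 \<le> 4 / 10000 * (1 + p)\<^sup>2"
        by (intro mult_right_mono) (auto simp: power2_eq_square)
      ultimately have "(1 - p)\<^sup>2 \<le> 4 / 10000 * (1 + p)\<^sup>2" by linarith
      then have "2 * (1 + p\<^sup>2) \<le> (1 + 4 / 10000) * (1 + p)\<^sup>2"
        by (simp add: power2_eq_square algebra_simps)
      then have "(1 + p\<^sup>2) * 10000 \<le> 5002 * (1 + p)\<^sup>2" by simp
      then have "K2 \<le> 5002 / 10000 * K"
      proof -
        assume *: "(1 + p\<^sup>2) * 10000 \<le> 5002 * (1 + p)\<^sup>2"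
        have "1 - p\<^sup>2 = (1 - p) * (1 + p)" by (simp add: power2_eq_square algebra_simps)
        then have K: "K2 = (1 + p\<^sup>2) / ((1 - p) * (1 + p))" "K = (1 + p)\<^sup>2 / ((1 - p) * (1 + p))"
          using p by (simp_all add: K_def K2_def power2_eq_square)
        have "(1 + p\<^sup>2) / ((1 - p) * (1 + p)) \<le> (5002 / 10000 * (1 + p)\<^sup>2) / ((1 - p) * (1 + p))"
          using * p by (intro divide_right_mono) auto
        then show ?thesis by (simp add: K)
      qed
      moreover have "K2 \<ge> 0" using p by (simp add: K2_def power_le_one)
      ultimately have A: "K2 * (u / (u + (cosh (2 * t) - 1))) \<le> (5002 / 10000 * K) * (x / (x + 4))"
        using le4 c2 c u x by (intro mult_mono) auto
      have "K / 2 * (x / (x + 1) - 5002 / 10000 * (x / (x + 4))) =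
          K * (x / (x + 1)) / 2 - (5002 / 10000 * K) * (x / (x + 4)) / 2"
      proof -
        have "K / 2 * (X - 5002 / 10000 * Y) = K * X / 2 - (5002 / 10000 * K) * Y / 2" for X Y :: real
          by (simp add: algebra_simps)
        then show ?thesis .
      qed
      moreover have "27 / 32 * W \<le> 27 / 32 * (P / 2 - A' / 2)"
        if "A' \<le> B'" "W = P / 2 - B' / 2" for A' B' P W :: real
        using that by simp
      ultimately have "27 / 32 * (K * (u / (u + c)) / 2 - K2 * (u / (u + (cosh (2 * t) - 1))) / 2) \<ge>
         27 / 32 * (K / 2 * (x / (x + 1) - 5002 / 10000 * (x / (x + 4))))"
        unfolding 1 using A by blast
      moreover have "K / 2 * (x / (x + 1) - 5002 / 10000 * (x / (x + 4))) \<ge> 1 / t * (x / (x + 1) - 5002 / 10000 * (x / (x + 4)))"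
      proof (rule mult_right_mono[OF K])
        have "x / (x + 4) \<le> x / (x + 1)" using x by (intro divide_left_mono) auto
        moreover have "x / (x + 4) \<ge> 0" using x by simp
        ultimately show "0 \<le> x / (x + 1) - 5002 / 10000 * (x / (x + 4))" by linarith
      qed
      moreover have "27 / 32 / t * X \<le> Z" if "27 / 32 * (K / 2 * X) \<le> Z" "1 / t * X \<le> K / 2 * X" for X Z
      proof -
        have "27 / 32 / t * X = 27 / 32 * (1 / t * X)" by simp
        also have "\<dots> \<le> 27 / 32 * (K / 2 * X)" using that(2) by (rule mult_left_mono) simp
        finally show ?thesis using that(1) by linarith
      qed
      ultimately show ?thesis by blast
    qed
    finally show "27 / 32 / t * (x / (x + 1) - 5002 / 10000 * (x / (x + 4))) \<le>
      (\<Sum>k. p ^ k / (1 + p ^ k)\<^sup>2 * (1 - cos (real k * \<theta>)))" .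
  qed
qed

section \<open>Modulus and phase of a single factor\<close>

lemma cmod_one_plus_rcis_sq:
  "(cmod (1 + rcis x y))\<^sup>2 = (1 + x)\<^sup>2 - 2 * x * (1 - cos y)"
proof -
  have "Re (1 + rcis x y) = 1 + x * cos y" "Im (1 + rcis x y) = x * sin y" by simp_all
  then show ?thesis
    unfolding cmod_power2 using sin_cos_squared_add2[of y] by algebra
qed

lemma cmod_one_plus_rcis_le:
  assumes "x \<ge> 0"
  shows "cmod (1 + rcis x y) \<le> (1 + x) * exp (- (x / (1 + x)\<^sup>2 * (1 - cos y)))"
proof (rule power2_le_imp_le)
  define w where "w = x / (1 + x)\<^sup>2 * (1 - cos y)"
  have "(cmod (1 + rcis x y))\<^sup>2 = (1 + x)\<^sup>2 * (1 + - (2 * w))"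
    using assms by (simp add: cmod_one_plus_rcis_sq w_def field_simps)
  also have "\<dots> \<le> (1 + x)\<^sup>2 * exp (- (2 * w))"
    by (intro mult_left_mono exp_ge_add_one_self) auto
  also have "exp (- (2 * w)) = (exp (- w))\<^sup>2" by (simp flip: exp_double)
  finally show "(cmod (1 + rcis x y))\<^sup>2 \<le> ((1 + x) * exp (- (x / (1 + x)\<^sup>2 * (1 - cos y))))\<^sup>2"
    by (simp add: power_mult_distrib w_def)
qed (use assms in auto)

lemma one_minus_cos_le_2: "1 - cos (y::real) \<le> 2"
  using cos_ge_minus_one[of y] by linarith

lemma one_minus_cos_le: "1 - cos (y::real) \<le> y\<^sup>2 / 2"
proof -
  have "1 - cos y = 2 * (sin (y / 2))\<^sup>2" using cos_double_sin[of "y / 2"] by simp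
  also have "(sin (y / 2))\<^sup>2 \<le> (y / 2)\<^sup>2"
    using abs_sin_x_le_abs_x[of "y / 2"] by (metis abs_le_square_iff)
  finally show ?thesis by (simp add: power2_eq_square)
qed

lemma cmod_one_plus_rcis_sq_ge:
  assumes "x \<ge> 0"
  shows "(1 + x)\<^sup>2 * (1 - x * y\<^sup>2) \<le> (cmod (1 + rcis x y))\<^sup>2"
proof -
  have "2 * x * (1 - cos y) \<le> 2 * x * (y\<^sup>2 / 2)"
    using one_minus_cos_le assms by (intro mult_left_mono) auto
  also have "\<dots> \<le> (1 + x)\<^sup>2 * (x * y\<^sup>2)"
    using assms mult_right_mono[of 1 "(1 + x)\<^sup>2" "x * y\<^sup>2"] by (simp add: one_le_power)
  finally show ?thesis by (simp add: cmod_one_plus_rcis_sq algebra_simps)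
qed

text \<open>
  The argument of \<open>1 + x * cis y\<close>, which lies in the right half plane for \<open>0 \<le> x < 1\<close>.
\<close>
definition phase :: "real \<Rightarrow> real \<Rightarrow> real" where
  "phase x y = arctan (x * sin y / (1 + x * cos y))"

lemma one_plus_mult_cos_pos:
  fixes x y :: real
  assumes "0 \<le> x" "x < 1"
  shows "1 + x * cos y > 0"
proof -
  have "- cos y \<le> 1" using cos_ge_minus_one[of y] by linarith
  from mult_left_mono[OF this assms(1)] assms(2) show ?thesis by simp
qed

lemma one_plus_rcis_polar:
  assumes "0 \<le> x" "x < 1"
  shows "1 + rcis x y = rcis (cmod (1 + rcis x y)) (phase x y)"
proof -
  define a b where "a = 1 + x * cos y" and "b = x * sin y"
  have a: "a > 0" using one_plus_mult_cos_pos[OF assms] by (simp add: a_def)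
  have z: "1 + rcis x y = Complex a b" by (simp add: complex_eq_iff a_def b_def)
  have "sqrt (a\<^sup>2 + b\<^sup>2) = sqrt (a\<^sup>2 * (1 + (b / a)\<^sup>2))" using a by (simp add: field_simps)
  also have "\<dots> = a * sqrt (1 + (b / a)\<^sup>2)" using a by (simp add: real_sqrt_mult)
  finally have m: "sqrt (a\<^sup>2 + b\<^sup>2) = a * sqrt (1 + (b / a)\<^sup>2)" .
  have "sqrt (1 + (b / a)\<^sup>2) > 0" by (simp add: add_pos_nonneg)
  then show ?thesis
    unfolding z phase_def a_def[symmetric] b_def[symmetric]
    using a by (simp add: complex_eq_iff cos_arctan sin_arctan complex_norm m)
qed

lemma phase_0 [simp]: "phase x 0 = 0" by (simp add: phase_def)

text \<open>
  The derivative is written as its value at \<open>y = 0\<close> minus a correction that is nonnegative and of order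
  \<open>y\<^sup>2\<close>; integrating the correction gives the cubic error of the linear approximation.
\<close>
lemma has_real_derivative_phase:
  assumes "0 \<le> x" "x < 1"
  shows "(phase x has_real_derivative
            (x / (1 + x) - x * (1 - x) * (1 - cos y) / ((1 + x) * ((1 + x)\<^sup>2 - 2 * x * (1 - cos y))))) (at y)"
proof -
  define a where "a = 1 + x * cos y"
  have a: "a > 0" using one_plus_mult_cos_pos[OF assms] by (simp add: a_def)
  have N: "a\<^sup>2 + (x * sin y)\<^sup>2 = (1 + x)\<^sup>2 - 2 * x * (1 - cos y)"
    unfolding a_def using sin_cos_squared_add2[of y] by algebra
  have N0: "a\<^sup>2 + (x * sin y)\<^sup>2 > 0" using a by (simp add: add_pos_nonneg)
  have q: "1 + (x * sin y / a)\<^sup>2 = (a\<^sup>2 + (x * sin y)\<^sup>2) / a\<^sup>2"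
    using a by (simp add: field_simps)
  have "((\<lambda>y. x * sin y / (1 + x * cos y)) has_real_derivative
      ((x * cos y) * a - (x * sin y) * (- (x * sin y))) / (a * a)) (at y)"
    unfolding a_def using a by (auto intro!: derivative_eq_intros simp: a_def)
  from DERIV_chain2[OF DERIV_arctan this]
  have "(phase x has_real_derivative
      ((x * cos y) * a - (x * sin y) * (- (x * sin y))) / (a * a) / (1 + (x * sin y / a)\<^sup>2)) (at y)"
    by (simp add: phase_def[abs_def] a_def divide_inverse mult_ac)
  also have "((x * cos y) * a - (x * sin y) * (- (x * sin y))) / (a * a) / (1 + (x * sin y / a)\<^sup>2) =
      (x * cos y * a + (x * sin y)\<^sup>2) / (a\<^sup>2 + (x * sin y)\<^sup>2)"
    unfolding q using a by (simp add: power2_eq_square)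
  also have "x * cos y * a + (x * sin y)\<^sup>2 = x * cos y + x\<^sup>2"
    unfolding a_def using sin_cos_squared_add2[of y] by algebra
  also have "(x * cos y + x\<^sup>2) / (a\<^sup>2 + (x * sin y)\<^sup>2) =
      x / (1 + x) - x * (1 - x) * (1 - cos y) / ((1 + x) * (a\<^sup>2 + (x * sin y)\<^sup>2))"
  proof -
    define D where "D = a\<^sup>2 + (x * sin y)\<^sup>2"
    have eq: "(x * cos y + x\<^sup>2) * (1 + x) = x * D - x * (1 - x) * (1 - cos y)"
      unfolding D_def N by (simp add: power2_eq_square algebra_simps)
    have "1 + x > 0" "D > 0" using assms N0 by (auto simp: D_def)
    then have "(x * cos y + x\<^sup>2) / D = (x * cos y + x\<^sup>2) * (1 + x) / ((1 + x) * D)" by simp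
    moreover have "x / (1 + x) - x * (1 - x) * (1 - cos y) / ((1 + x) * D) =
        (x * D - x * (1 - x) * (1 - cos y)) / ((1 + x) * D)"
      using \<open>1 + x > 0\<close> \<open>D > 0\<close> by (simp add: diff_divide_distrib)
    ultimately show ?thesis unfolding D_def[symmetric] eq by simp
  qed
  finally show ?thesis unfolding N .
qed

text \<open>
  The hypothesis says that the correction in the derivative of the phase is at most \<open>x * y\<^sup>2 / 2\<close>, so its
  integral is at most \<open>x * Y ^ 3 / 6\<close>.
\<close>
lemma phase_cubic_bound:
  assumes x: "0 \<le> x" "x < 1" and Y: "0 \<le> Y"
    and cond: "\<And>y. 0 \<le> y \<Longrightarrow> y \<le> Y \<Longrightarrow>
      (1 - x) * (1 - cos y) \<le> (1 + x) * ((1 + x)\<^sup>2 - 2 * x * (1 - cos y)) * (y\<^sup>2 / 2)"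
  shows "\<bar>phase x Y - Y * (x / (1 + x))\<bar> \<le> x * Y ^ 3 / 6"
proof -
  let ?D = "\<lambda>y. (1 + x)\<^sup>2 - 2 * x * (1 - cos y)"
  let ?g = "\<lambda>y. x * (1 - x) * (1 - cos y) / ((1 + x) * ?D y)"
  have D: "?D y > 0" for y
  proof -
    have "2 * x * (1 - cos y) \<le> 2 * x * 2" using x one_minus_cos_le_2[of y] by (intro mult_left_mono) auto
    moreover have "(1 + x)\<^sup>2 - 4 * x = (1 - x)\<^sup>2" by algebra
    moreover have "(1 - x)\<^sup>2 > 0" using x by simp
    ultimately show ?thesis by linarith
  qed
  have g: "0 \<le> ?g y" for y using x D[of y] by (intro divide_nonneg_nonneg mult_nonneg_nonneg) auto
  have d1: "((\<lambda>y. y * (x / (1 + x)) - phase x y) has_real_derivative ?g y) (at y)" for y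
    using x by (auto intro!: derivative_eq_intros has_real_derivative_phase)
  have "(\<lambda>y. y * (x / (1 + x)) - phase x y) 0 \<le> (\<lambda>y. y * (x / (1 + x)) - phase x y) Y"
    by (rule DERIV_nonneg_imp_nondecreasing[OF Y]) (use d1 g in blast)
  moreover have "(\<lambda>y. x * y ^ 3 / 6 - (y * (x / (1 + x)) - phase x y)) 0 \<le> (\<lambda>y. x * y ^ 3 / 6 - (y * (x / (1 + x)) - phase x y)) Y"
  proof (rule DERIV_nonneg_imp_nondecreasing[OF Y])
    fix y assume y: "0 \<le> y" "y \<le> Y"
    have "((\<lambda>y. x * y ^ 3 / 6 - (y * (x / (1 + x)) - phase x y)) has_real_derivative (x * (y\<^sup>2 / 2) - ?g y)) (at y)"
      by (rule DERIV_diff[OF _ d1]) (auto intro!: derivative_eq_intros)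
    moreover have "?g y \<le> x * (y\<^sup>2 / 2)"
    proof -
      have "x * ((1 - x) * (1 - cos y)) \<le> x * ((1 + x) * ?D y * (y\<^sup>2 / 2))"
        using cond[OF y] x by (intro mult_left_mono) auto
      moreover have "(1 + x) * ?D y > 0" using D x by simp
      ultimately show ?thesis by (simp add: pos_divide_le_eq mult_ac del: mult_pos_pos)
    qed
    ultimately show "\<exists>d. ((\<lambda>y. x * y ^ 3 / 6 - (y * (x / (1 + x)) - phase x y)) has_real_derivative d) (at y) \<and> 0 \<le> d"
      by (intro exI conjI) auto
  qed
  ultimately show ?thesis by simp
qed

text \<open>
  As long as \<open>cos y \<ge> -1 / 2\<close> one has \<open>\<bar>1 + x * cis y\<bar>\<^sup>2 \<ge> 1 - x\<close>, which is enough for every \<open>x\<close>. Otherwise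
  \<open>y > 2 * pi / 3\<close>, hence \<open>s > 1.39\<close>, and then \<open>x = exp (- s)\<close> is so small that the trivial bound
  \<open>\<bar>1 + x * cis y\<bar> \<ge> 1 - x\<close> suffices.
\<close>
lemma phase_condition:
  fixes x y s :: real
  assumes x: "x = exp (- s)" and s: "s > 0" and y: "0 \<le> y" "y \<le> 3 / 2 * s"
  shows "(1 - x) * (1 - cos y) \<le> (1 + x) * ((1 + x)\<^sup>2 - 2 * x * (1 - cos y)) * (y\<^sup>2 / 2)"
proof -
  have x01: "0 < x" "x < 1" using s by (auto simp: x)
  show ?thesis
  proof (cases "cos y \<ge> - (1 / 2)")
    case True
    have "2 * x * (1 - cos y) \<le> 2 * x * (3 / 2)" using True x01 by (intro mult_left_mono) auto
    moreover have "(1 + x)\<^sup>2 - 3 * x = 1 - x + x\<^sup>2" by algebra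
    moreover have "x\<^sup>2 \<ge> 0" by simp
    ultimately have D: "1 - x \<le> (1 + x)\<^sup>2 - 2 * x * (1 - cos y)" by linarith
    define D where "D = (1 + x)\<^sup>2 - 2 * x * (1 - cos y)"
    have "1 * D \<le> (1 + x) * D" by (rule mult_right_mono) (use D x01 in \<open>simp_all add: D_def\<close>)
    with D have D': "1 - x \<le> (1 + x) * D" by (simp add: D_def)
    show ?thesis unfolding D_def[symmetric]
    proof (rule mult_mono[OF D' one_minus_cos_le])
      show "0 \<le> (1 + x) * D" using D' x01 by linarith
    qed simp
  next
    case False
    have y2: "y > 2 * pi / 3"
    proof (rule ccontr)
      assume "\<not> y > 2 * pi / 3"
      then have "cos (2 * pi / 3) \<le> cos y" using y by (intro cos_monotone_0_pi_le) auto
      then show False using False by (simp add: cos_120)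
    qed
    then have "y > 2.09" using pi_approx by simp
    with y have "s > 139 / 100" by simp
    then have "exp (139 / 100) < exp s" by simp
    moreover have "exp (139 / 100 :: real) = (exp (695 / 1000))\<^sup>2" by (simp flip: exp_double)
    moreover have "(193 / 100 :: real) \<le> exp (695 / 1000)"
      using exp_lower_Taylor_quadratic[of "695 / 1000 :: real"] by (simp add: power2_eq_square)
    then have "(193 / 100 :: real)\<^sup>2 \<le> (exp (695 / 1000))\<^sup>2" by (intro power_mono) auto
    moreover have "(193 / 100 :: real)\<^sup>2 = 37249 / 10000" by (simp add: power2_eq_square)
    ultimately have "37 / 10 < exp s" by linarith
    then have "x < 10 / 37" unfolding x exp_minus by (simp add: field_simps)
    then have "x\<^sup>2 \<le> (10 / 37)\<^sup>2" using x01 by (intro power_mono) auto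
    then have x2: "x\<^sup>2 \<le> 0.0731" by (simp add: power2_eq_square)
    have "(2.09::real)\<^sup>2 \<le> y\<^sup>2" using \<open>y > 2.09\<close> by (intro power_mono) auto
    then have "4.36 \<le> y\<^sup>2" by (simp add: power2_eq_square)
    have "(1 - x) * (1 - cos y) \<le> (1 - x) * 2" using x01 one_minus_cos_le_2[of y] by (intro mult_left_mono) auto
    also have "\<dots> \<le> (1 - x) * ((1 - x\<^sup>2) * (y\<^sup>2 / 2))"
    proof (rule mult_left_mono)
      have "(0.9269::real) * 2.18 \<le> (1 - x\<^sup>2) * (y\<^sup>2 / 2)" using x2 \<open>4.36 \<le> y\<^sup>2\<close> by (intro mult_mono) auto
      then show "2 \<le> (1 - x\<^sup>2) * (y\<^sup>2 / 2)" by simp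
    qed (use x01 in auto)
    also have "\<dots> = (1 + x) * (1 - x)\<^sup>2 * (y\<^sup>2 / 2)"
    proof -
      have "(1 - x) * (1 - x\<^sup>2) = (1 + x) * (1 - x)\<^sup>2" by algebra
      then show ?thesis by (simp only: mult.assoc[symmetric])
    qed
    also have "\<dots> \<le> (1 + x) * ((1 + x)\<^sup>2 - 2 * x * (1 - cos y)) * (y\<^sup>2 / 2)"
    proof -
      have "2 * x * (1 - cos y) \<le> 2 * x * 2" using x01 one_minus_cos_le_2[of y] by (intro mult_left_mono) auto
      moreover have "(1 + x)\<^sup>2 - 4 * x = (1 - x)\<^sup>2" by algebra
      ultimately have "(1 - x)\<^sup>2 \<le> (1 + x)\<^sup>2 - 2 * x * (1 - cos y)" by linarith
      then show ?thesis using x01 by (intro mult_right_mono mult_left_mono) auto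
    qed
    finally show ?thesis .
  qed
qed

section \<open>The generating polynomial near the saddle point\<close>

definition dp_weight :: "nat \<Rightarrow> real \<Rightarrow> real" where
  "dp_weight M p = (\<Prod>k=1..M. 1 + p ^ k)"

lemma dp_weight_pos: "p \<ge> 0 \<Longrightarrow> dp_weight M p > 0"
  unfolding dp_weight_def by (intro prod_pos) (auto intro: add_pos_nonneg)

lemma cmod_dp_poly: "cmod (dp_poly M (rcis p \<theta>)) = (\<Prod>k=1..M. cmod (1 + rcis (p ^ k) (real k * \<theta>)))"
  by (simp add: dp_poly_def DeMoivre2 flip: prod_norm)

lemma cmod_dp_poly_le:
  assumes "p \<ge> 0"
  shows "cmod (dp_poly M (rcis p \<theta>)) \<le>
    dp_weight M p * exp (- (\<Sum>k=1..M. p ^ k / (1 + p ^ k)\<^sup>2 * (1 - cos (real k * \<theta>))))"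
proof -
  have "cmod (dp_poly M (rcis p \<theta>)) \<le>
      (\<Prod>k=1..M. (1 + p ^ k) * exp (- (p ^ k / (1 + p ^ k)\<^sup>2 * (1 - cos (real k * \<theta>)))))"
    unfolding cmod_dp_poly
  proof (rule prod_mono)
    fix k :: nat
    show "0 \<le> cmod (1 + rcis (p ^ k) (real k * \<theta>)) \<and> cmod (1 + rcis (p ^ k) (real k * \<theta>)) \<le>
        (1 + p ^ k) * exp (- (p ^ k / (1 + p ^ k)\<^sup>2 * (1 - cos (real k * \<theta>))))"
      using cmod_one_plus_rcis_le[of "p ^ k" "real k * \<theta>"] assms by simp
  qed
  also have "\<dots> = dp_weight M p * exp (\<Sum>k=1..M. - (p ^ k / (1 + p ^ k)\<^sup>2 * (1 - cos (real k * \<theta>))))"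
    unfolding prod.distrib dp_weight_def by (simp add: exp_sum)
  finally show ?thesis by (simp add: sum_negf)
qed

lemma one_minus_sum_le_prod:
  fixes a :: "'a \<Rightarrow> real"
  assumes "finite A" "\<And>k. k \<in> A \<Longrightarrow> 0 \<le> a k \<and> a k \<le> 1"
  shows "1 - (\<Sum>k\<in>A. a k) \<le> (\<Prod>k\<in>A. 1 - a k)"
  using assms
proof (induction A rule: finite_induct)
  case (insert x A)
  have P: "(\<Prod>k\<in>A. 1 - a k) \<le> 1" "0 \<le> (\<Prod>k\<in>A. 1 - a k)"
    using insert.prems by (auto intro!: prod_le_1 prod_nonneg)
  have "a x * (\<Prod>k\<in>A. 1 - a k) \<le> a x * 1"
    using insert.prems P by (intro mult_left_mono) auto
  then show ?case using insert by (simp add: left_diff_distrib)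
qed simp

text \<open>
  A crude lower bound for the modulus near the positive axis: Weierstrass' inequality
  \<open>1 - \<Sum>a \<le> \<Prod>(1 - a)\<close> applied to the factors \<open>1 - p ^ k * (k * \<theta>)\<^sup>2\<close>. It only has to produce a lower
  bound of the right order for the total mass of the modulus.
\<close>
lemma cmod_dp_poly_sq_ge:
  assumes p: "p \<ge> 0" and small: "\<theta>\<^sup>2 * (\<Sum>k=1..M. (real k)\<^sup>2 * p ^ k) \<le> 1"
  shows "(dp_weight M p)\<^sup>2 * (1 - \<theta>\<^sup>2 * (\<Sum>k=1..M. (real k)\<^sup>2 * p ^ k)) \<le> (cmod (dp_poly M (rcis p \<theta>)))\<^sup>2"
proof -
  let ?a = "\<lambda>k. p ^ k * (real k * \<theta>)\<^sup>2"
  have S: "\<theta>\<^sup>2 * (\<Sum>k=1..M. (real k)\<^sup>2 * p ^ k) = (\<Sum>k=1..M. ?a k)"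
    by (simp add: sum_distrib_left power_mult_distrib mult_ac)
  have a0: "0 \<le> ?a k" for k using p by simp
  have a1: "?a k \<le> 1" if "k \<in> {1..M}" for k
    using member_le_sum[OF that, of ?a] a0 small unfolding S by fastforce
  have "(dp_weight M p)\<^sup>2 * (1 - (\<Sum>k=1..M. ?a k)) \<le> (dp_weight M p)\<^sup>2 * (\<Prod>k=1..M. 1 - ?a k)"
    by (intro mult_left_mono one_minus_sum_le_prod) (use a0 a1 in auto)
  also have "\<dots> = (\<Prod>k=1..M. (1 + p ^ k)\<^sup>2 * (1 - ?a k))"
    unfolding prod.distrib dp_weight_def by (simp add: prod_power_distrib)
  also have "\<dots> \<le> (\<Prod>k=1..M. (cmod (1 + rcis (p ^ k) (real k * \<theta>)))\<^sup>2)"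
  proof (rule prod_mono)
    fix k assume "k \<in> {1..M}"
    then have "0 \<le> (1 + p ^ k)\<^sup>2 * (1 - ?a k)" using a1[of k] by (intro mult_nonneg_nonneg) auto
    then show "0 \<le> (1 + p ^ k)\<^sup>2 * (1 - ?a k) \<and>
        (1 + p ^ k)\<^sup>2 * (1 - ?a k) \<le> (cmod (1 + rcis (p ^ k) (real k * \<theta>)))\<^sup>2"
      using cmod_one_plus_rcis_sq_ge[of "p ^ k" "real k * \<theta>"] p by simp
  qed
  also have "\<dots> = (cmod (dp_poly M (rcis p \<theta>)))\<^sup>2"
    unfolding cmod_dp_poly by (simp add: prod_power_distrib)
  finally show ?thesis unfolding S .
qed

lemma dp_poly_polar:
  assumes "0 \<le> p" "p < 1"
  shows "dp_poly M (rcis p \<theta>) = rcis (cmod (dp_poly M (rcis p \<theta>))) (\<Sum>k=1..M. phase (p ^ k) (real k * \<theta>))"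
proof (induction M)
  case 0
  then show ?case by (simp add: dp_poly_def)
next
  case (Suc M)
  let ?z = "1 + rcis (p ^ Suc M) (real (Suc M) * \<theta>)"
  have step: "dp_poly (Suc M) (rcis p \<theta>) = dp_poly M (rcis p \<theta>) * ?z"
    by (simp add: dp_poly_def DeMoivre2 del: power_Suc of_nat_Suc)
  have z: "?z = rcis (cmod ?z) (phase (p ^ Suc M) (real (Suc M) * \<theta>))"
    using assms by (intro one_plus_rcis_polar) (auto simp: power_less_one_iff simp del: power_Suc)
  have "dp_poly (Suc M) (rcis p \<theta>) =
      rcis (cmod (dp_poly M (rcis p \<theta>)) * cmod ?z)
        ((\<Sum>k=1..M. phase (p ^ k) (real k * \<theta>)) + phase (p ^ Suc M) (real (Suc M) * \<theta>))"
    unfolding step by (subst Suc.IH, subst z) (simp only: rcis_mult)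
  then show ?case
    unfolding step norm_mult by simp
qed

text \<open>
  The rotated polynomial has phase \<open>\<psi> = (\<Sum>k. phase (p ^ k) (k * \<theta>)) - n * \<theta>\<close>. The linear parts of the
  phases add up to the mean times \<open>\<theta>\<close>, which nearly cancels against \<open>n * \<theta>\<close>; the cubic errors add up to
  the third moment. Finally \<open>cos \<psi> \<ge> 1 - \<psi>\<^sup>2 / 2\<close>.
\<close>
lemma re_dp_poly_ge:
  assumes t: "t > 0" and \<theta>: "0 \<le> \<theta>" "\<theta> \<le> 3 / 2 * t"
    and T: "(\<Sum>k=1..M. (real k) ^ 3 * exp (-t) ^ k) \<le> T"
    and \<delta>: "\<bar>(\<Sum>k=1..M. real k * (exp (-t) ^ k / (1 + exp (-t) ^ k))) - real n\<bar> \<le> \<delta>"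
  shows "cmod (dp_poly M (rcis (exp (-t)) \<theta>)) * (1 - (\<delta> * \<theta> + T * \<theta> ^ 3 / 6)\<^sup>2 / 2) \<le>
         Re (dp_poly M (rcis (exp (-t)) \<theta>) * cis (- (real n * \<theta>)))"
proof -
  define p where "p = exp (-t)"
  have p: "0 < p" "p < 1" using t by (auto simp: p_def)
  define \<psi> where "\<psi> = (\<Sum>k=1..M. phase (p ^ k) (real k * \<theta>)) - real n * \<theta>"
  let ?G = "cmod (dp_poly M (rcis p \<theta>))"
  have "Re (dp_poly M (rcis p \<theta>) * cis (- (real n * \<theta>))) = Re (rcis ?G (\<Sum>k=1..M. phase (p ^ k) (real k * \<theta>)) * cis (- (real n * \<theta>)))"
    using dp_poly_polar[of p M \<theta>] p by simp
  also have "\<dots> = ?G * cos \<psi>"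
  proof -
    have "rcis a b * cis c = rcis a (b + c)" for a b c
      by (simp add: rcis_def cis_mult mult.assoc)
    then show ?thesis by (simp add: \<psi>_def del: times_complex.sel)
  qed
  finally have re: "Re (dp_poly M (rcis p \<theta>) * cis (- (real n * \<theta>))) = ?G * cos \<psi>" .
  have "\<bar>phase (p ^ k) (real k * \<theta>) - (real k * \<theta>) * (p ^ k / (1 + p ^ k))\<bar> \<le> p ^ k * (real k * \<theta>) ^ 3 / 6" if "k \<in> {1..M}" for k
  proof (rule phase_cubic_bound)
    show "0 \<le> p ^ k" "p ^ k < 1" "0 \<le> real k * \<theta>"
      using p \<theta> that by (auto simp: power_less_one_iff)
    fix y assume y: "0 \<le> y" "y \<le> real k * \<theta>"
    have "real k * \<theta> \<le> real k * (3 / 2 * t)" using \<theta> by (intro mult_left_mono) auto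
    then have "y \<le> 3 / 2 * (real k * t)" using y by simp
    moreover have "p ^ k = exp (- (real k * t))" by (simp add: p_def exp_of_nat_mult[symmetric])
    ultimately show "(1 - p ^ k) * (1 - cos y) \<le> (1 + p ^ k) * ((1 + p ^ k)\<^sup>2 - 2 * p ^ k * (1 - cos y)) * (y\<^sup>2 / 2)"
      using t that y(1) by (intro phase_condition[where s = "real k * t"]) auto
  qed
  then have "(\<Sum>k=1..M. \<bar>phase (p ^ k) (real k * \<theta>) - (real k * \<theta>) * (p ^ k / (1 + p ^ k))\<bar>) \<le> (\<Sum>k=1..M. p ^ k * (real k * \<theta>) ^ 3 / 6)"
    by (rule sum_mono)
  then have "\<bar>\<Sum>k=1..M. phase (p ^ k) (real k * \<theta>) - (real k * \<theta>) * (p ^ k / (1 + p ^ k))\<bar> \<le> (\<Sum>k=1..M. p ^ k * (real k * \<theta>) ^ 3 / 6)"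
    by (rule order_trans[OF sum_abs])
  also have "(\<Sum>k=1..M. p ^ k * (real k * \<theta>) ^ 3 / 6) = (\<Sum>k=1..M. (real k) ^ 3 * p ^ k) * \<theta> ^ 3 / 6"
    by (simp add: sum_distrib_left sum_distrib_right sum_divide_distrib power_mult_distrib mult_ac)
  also have "\<dots> \<le> T * \<theta> ^ 3 / 6"
    using T \<theta> by (intro divide_right_mono mult_right_mono) (auto simp: p_def)
  finally have 1: "\<bar>\<Sum>k=1..M. phase (p ^ k) (real k * \<theta>) - (real k * \<theta>) * (p ^ k / (1 + p ^ k))\<bar> \<le> T * \<theta> ^ 3 / 6" .
  have "\<bar>(\<Sum>k=1..M. real k * (p ^ k / (1 + p ^ k))) - real n\<bar> * \<theta> \<le> \<delta> * \<theta>"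
    using \<delta> \<theta> by (intro mult_right_mono) (auto simp: p_def)
  then have 2: "\<bar>((\<Sum>k=1..M. real k * (p ^ k / (1 + p ^ k))) - real n) * \<theta>\<bar> \<le> \<delta> * \<theta>"
    using \<theta> by (simp add: abs_mult)
  have "(\<Sum>k=1..M. (real k * \<theta>) * (p ^ k / (1 + p ^ k))) = (\<Sum>k=1..M. real k * (p ^ k / (1 + p ^ k))) * \<theta>"
    unfolding sum_distrib_right by (intro sum.cong refl) simp
  then have "\<psi> = (\<Sum>k=1..M. phase (p ^ k) (real k * \<theta>) - (real k * \<theta>) * (p ^ k / (1 + p ^ k))) +
      ((\<Sum>k=1..M. real k * (p ^ k / (1 + p ^ k))) - real n) * \<theta>"
    by (simp only: \<psi>_def sum_subtractf left_diff_distrib)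
  with 1 2 have "\<bar>\<psi>\<bar> \<le> \<delta> * \<theta> + T * \<theta> ^ 3 / 6" by linarith
  then have "\<psi>\<^sup>2 \<le> (\<delta> * \<theta> + T * \<theta> ^ 3 / 6)\<^sup>2" by (metis abs_ge_zero power2_abs power_mono)
  with one_minus_cos_le[of \<psi>] have "1 - (\<delta> * \<theta> + T * \<theta> ^ 3 / 6)\<^sup>2 / 2 \<le> cos \<psi>" by linarith
  then have "?G * (1 - (\<delta> * \<theta> + T * \<theta> ^ 3 / 6)\<^sup>2 / 2) \<le> ?G * cos \<psi>"
    by (intro mult_left_mono) auto
  then show ?thesis unfolding re[symmetric] unfolding p_def .
qed

lemma sum_1_eq_lessThan_Suc:
  fixes f :: "nat \<Rightarrow> real"
  assumes "f 0 = 0"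
  shows "(\<Sum>k=1..M. f k) = (\<Sum>k<Suc M. f k)"
proof -
  have "{..<Suc M} = insert 0 {1..M}" by auto
  then show ?thesis using assms by simp
qed

lemma sum_1_le_sums:
  fixes f :: "nat \<Rightarrow> real"
  assumes "f sums s" "\<And>k. 0 \<le> f k" "f 0 = 0"
  shows "(\<Sum>k=1..M. f k) \<le> s"
proof -
  have "(\<Sum>k<Suc M. f k) \<le> suminf f"
    using assms(1,2) by (intro sum_le_suminf) (auto simp: sums_iff)
  then show ?thesis using assms(1) sum_1_eq_lessThan_Suc[of f M, OF assms(3)] by (simp add: sums_iff)
qed

lemma sum_second_moment_le:
  assumes "t > 0"
  shows "(\<Sum>k=1..M. (real k)\<^sup>2 * exp (-t) ^ k) \<le> 2 / t ^ 3"
proof -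
  have "(\<Sum>k=1..M. (real k)\<^sup>2 * exp (-t) ^ k) \<le> cosh (t/2) / (4 * sinh (t/2) ^ 3)"
    using sums_exp_moments(2)[OF assms] by (intro sum_1_le_sums) auto
  also have "\<dots> \<le> 2 / t ^ 3"
  proof -
    have s: "sinh (t/2) > 0" using assms by simp
    have "(t/2) ^ 3 * cosh (t/2) \<le> sinh (t/2) ^ 3" using cube_cosh_le_sinh_cube[of "t/2"] assms by simp
    then show ?thesis using assms s by (simp add: divide_simps power_divide) (simp add: algebra_simps)
  qed
  finally show ?thesis .
qed

lemma sum_third_moment_le:
  assumes "t > 0"
  shows "(\<Sum>k=1..M. (real k) ^ 3 * exp (-t) ^ k) \<le> (6 + t\<^sup>2) / t ^ 4"
proof -
  define s where "s = sinh (t/2)"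
  have s: "t / 2 \<le> s" using x_le_sinh[of "t/2"] assms by (simp add: s_def)
  then have s0: "s > 0" using assms by linarith
  have "(\<Sum>k=1..M. (real k) ^ 3 * exp (-t) ^ k) \<le> (3 + 2 * s\<^sup>2) / (8 * s ^ 4)"
    using sums_exp_moments(3)[OF assms] unfolding s_def by (intro sum_1_le_sums) auto
  also have "\<dots> = 3 / (8 * s ^ 4) + 1 / (4 * s\<^sup>2)"
    using s0 by (simp add: field_simps power2_eq_square power4_eq_xxxx)
  also have "\<dots> \<le> 3 / (8 * (t / 2) ^ 4) + 1 / (4 * (t / 2)\<^sup>2)"
    using s s0 assms by (intro add_mono divide_left_mono mult_left_mono power_mono mult_pos_pos) auto
  also have "\<dots> = (6 + t\<^sup>2) / t ^ 4"
    using assms by (simp add: field_simps power_divide)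
  finally show ?thesis .
qed

lemma partial_sum_ge_suminf_minus_tail:
  fixes f g :: "nat \<Rightarrow> real"
  assumes f: "summable f" and g: "summable g"
    and le: "\<And>k. k \<ge> N \<Longrightarrow> f k \<le> c * g k" and tail: "(\<Sum>k. g (k + N)) \<le> e" and c: "c \<ge> 0"
  shows "suminf f - c * e \<le> (\<Sum>k<N. f k)"
proof -
  have "(\<Sum>k. f (k + N)) \<le> (\<Sum>k. c * g (k + N))"
    using f g by (intro suminf_le le summable_mult summable_ignore_initial_segment) auto
  also have "\<dots> = c * (\<Sum>k. g (k + N))"
    using g by (intro suminf_mult summable_ignore_initial_segment)
  also have "\<dots> \<le> c * e" using tail c by (intro mult_left_mono)
  finally show ?thesis using suminf_split_initial_segment[OF f, of N] by simp
qed

text \<open>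
  For \<open>pi\<^sup>2 / (12 * t\<^sup>2) = n + 1 / 24\<close> the mean of the tilted distribution is within \<open>1 / 2\<close> of \<open>n\<close>, so
  \<open>exp (-t)\<close> is an approximate saddle point for \<open>q n\<close>. The number \<open>M\<close> of factors is chosen so large that
  truncating the infinite series above at \<open>M\<close> costs no more than \<open>1 / 200\<close> in the exponent.
\<close>
lemma saddle_point_bounds:
  fixes t :: real and n m :: nat
  assumes t: "0 < t" "t \<le> 1 / 34" and n: "pi\<^sup>2 / (12 * t\<^sup>2) = real n + 1 / 24"
  shows "\<exists>M\<ge>m. (\<forall>\<theta>. let x = (1 - cos \<theta>) / (cosh t - 1) in
            cmod (dp_poly M (rcis (exp (-t)) \<theta>)) \<le> dp_weight M (exp (-t)) *
              (exp (1/200) * exp (- (27 / 32 / t * (x / (x + 1) - 5002 / 10000 * (x / (x + 4))))))) \<and>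
          \<bar>(\<Sum>k=1..M. real k * (exp (-t) ^ k / (1 + exp (-t) ^ k))) - real n\<bar> \<le> 1 / 2"
proof -
  define p where "p = exp (-t)"
  have p: "0 < p" "p < 1" using t by (auto simp: p_def)
  have pk: "0 < p ^ k" for k using p by simp
  define g where "g = (\<lambda>k. real k * p ^ k)"
  have g: "summable g" using sums_exp_moments(1)[OF t(1)] by (auto simp: sums_iff g_def p_def)
  from suminf_exist_split[of "1/400", OF _ g] obtain N0 where N0: "\<And>N. N \<ge> N0 \<Longrightarrow> norm (\<Sum>i. g (i + N)) < 1/400" by auto
  define M where "M = max m N0"
  have "N0 \<le> Suc M" by (simp add: M_def)
  from N0[OF this] have tail: "(\<Sum>i. g (i + Suc M)) \<le> 1 / 400" unfolding real_norm_def by linarith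
  define x where "x = (\<lambda>\<theta>. (1 - cos \<theta>) / (cosh t - 1))"
  have A: "cmod (dp_poly M (rcis p \<theta>)) \<le> dp_weight M p *
      (exp (1/200) * exp (- (27 / 32 / t * (x \<theta> / (x \<theta> + 1) - 5002 / 10000 * (x \<theta> / (x \<theta> + 4))))))" for \<theta>
  proof -
    let ?f = "\<lambda>k. p ^ k / (1 + p ^ k)\<^sup>2 * (1 - cos (real k * \<theta>))"
    note V = tail_exponent_lower_bound[OF t, of \<theta>, folded p_def]
    have "suminf ?f - 2 * (1 / 400) \<le> (\<Sum>k<Suc M. ?f k)"
    proof (rule partial_sum_ge_suminf_minus_tail[OF V(1) g _ tail])
      fix k assume "k \<ge> Suc M"
      have "p ^ k / (1 + p ^ k)\<^sup>2 \<le> p ^ k"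
        using pk[of k] divide_left_mono[of 1 "(1 + p ^ k)\<^sup>2" "p ^ k"] by (simp add: one_le_power)
      then have "?f k \<le> p ^ k * 2" using one_minus_cos_le_2[of "real k * \<theta>"] pk[of k] by (intro mult_mono) auto
      also have "\<dots> \<le> 2 * g k" using \<open>k \<ge> Suc M\<close> pk[of k] by (simp add: g_def)
      finally show "?f k \<le> 2 * g k" .
    qed simp
    also have "(\<Sum>k<Suc M. ?f k) = (\<Sum>k=1..M. ?f k)" by (rule sum_1_eq_lessThan_Suc[symmetric]) simp
    finally have "- (\<Sum>k=1..M. ?f k) \<le> 1 / 200 + - (27 / 32 / t * (x \<theta> / (x \<theta> + 1) - 5002 / 10000 * (x \<theta> / (x \<theta> + 4))))"
      using V(2) unfolding x_def by linarith
    then have "exp (- (\<Sum>k=1..M. ?f k)) \<le> exp (1 / 200 + - (27 / 32 / t * (x \<theta> / (x \<theta> + 1) - 5002 / 10000 * (x \<theta> / (x \<theta> + 4)))))"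
      by simp
    also have "\<dots> = exp (1 / 200) * exp (- (27 / 32 / t * (x \<theta> / (x \<theta> + 1) - 5002 / 10000 * (x \<theta> / (x \<theta> + 4)))))"
      by (rule exp_add)
    finally have "dp_weight M p * exp (- (\<Sum>k=1..M. ?f k)) \<le> dp_weight M p * (exp (1 / 200) * exp (- (27 / 32 / t * (x \<theta> / (x \<theta> + 1) - 5002 / 10000 * (x \<theta> / (x \<theta> + 4))))))"
      using dp_weight_pos[of p M] p by (intro mult_left_mono) auto
    with cmod_dp_poly_le[of p M \<theta>] p show ?thesis by linarith
  qed
  let ?h = "\<lambda>k. real k * (p ^ k / (1 + p ^ k))"
  note mean = fermi_mean_bounds[OF t(1), folded p_def, unfolded n]
  have h0: "0 \<le> ?h k" for k using pk[of k] by simp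
  have "suminf ?h - 1 * (1 / 400) \<le> (\<Sum>k<Suc M. ?h k)"
  proof (rule partial_sum_ge_suminf_minus_tail[OF mean(1) g _ tail])
    fix k
    have "p ^ k / (1 + p ^ k) \<le> p ^ k" using pk[of k] by (simp add: divide_simps)
    then have "real k * (p ^ k / (1 + p ^ k)) \<le> real k * p ^ k" by (intro mult_left_mono) auto
    then show "?h k \<le> 1 * g k" by (simp add: g_def)
  qed simp
  moreover have "(\<Sum>k<Suc M. ?h k) \<le> suminf ?h" using mean(1) h0 by (intro sum_le_suminf) auto
  moreover have "(\<Sum>k<Suc M. ?h k) = (\<Sum>k=1..M. ?h k)" by (rule sum_1_eq_lessThan_Suc[symmetric]) simp
  ultimately have "\<bar>(\<Sum>k=1..M. ?h k) - real n\<bar> \<le> 1 / 2" using mean(2,3) unfolding abs_le_iff by linarith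
  with A show ?thesis unfolding p_def x_def Let_def by (intro exI[of _ M]) (auto simp: M_def)
qed

section \<open>Elementary integrals and inequalities\<close>

lemma has_integral_power5_gaussian:
  fixes k a :: real
  assumes k: "k > 0" and a: "a \<ge> 0"
  obtains I where "((\<lambda>x. x ^ 5 * exp (- k * x\<^sup>2)) has_integral I) {0..a}" "I \<le> 1 / k ^ 3"
proof -
  let ?F = "\<lambda>x. - ((x ^ 4 / (2 * k) + x\<^sup>2 / k\<^sup>2 + 1 / k ^ 3) * exp (- k * x\<^sup>2))"
  have "(?F has_real_derivative x ^ 5 * exp (- k * x\<^sup>2)) (at x within {0..a})" for x
    using k by (auto intro!: derivative_eq_intros) (simp add: field_simps eval_nat_numeral)
  then have "((\<lambda>x. x ^ 5 * exp (- k * x\<^sup>2)) has_integral (?F a - ?F 0)) {0..a}"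
    using a by (intro fundamental_theorem_of_calculus) (auto simp flip: has_real_derivative_iff_has_vector_derivative)
  moreover have "?F a \<le> 0" using k by (simp add: add_nonneg_nonneg)
  ultimately show thesis by (intro that[of "?F a - ?F 0"]) auto
qed

lemma has_integral_power7_gaussian:
  fixes k a :: real
  assumes k: "k > 0" and a: "a \<ge> 0"
  obtains I where "((\<lambda>x. x ^ 7 * exp (- k * x\<^sup>2)) has_integral I) {0..a}" "I \<le> 3 / k ^ 4"
proof -
  let ?F = "\<lambda>x. - ((x ^ 6 / (2 * k) + 3 * x ^ 4 / (2 * k\<^sup>2) + 3 * x\<^sup>2 / k ^ 3 + 3 / k ^ 4) * exp (- k * x\<^sup>2))"
  have "(?F has_real_derivative x ^ 7 * exp (- k * x\<^sup>2)) (at x within {0..a})" for x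
    using k by (auto intro!: derivative_eq_intros) (simp add: field_simps eval_nat_numeral)
  then have "((\<lambda>x. x ^ 7 * exp (- k * x\<^sup>2)) has_integral (?F a - ?F 0)) {0..a}"
    using a by (intro fundamental_theorem_of_calculus) (auto simp flip: has_real_derivative_iff_has_vector_derivative)
  moreover have "?F a \<le> 0" using k by (simp add: add_nonneg_nonneg)
  ultimately show thesis by (intro that[of "?F a - ?F 0"]) auto
qed

text \<open>
  The odd moments have elementary antiderivatives, and \<open>2 * x ^ 6 \<le> b * x ^ 5 + x ^ 7 / b\<close> reduces the
  even one to them. With \<open>b\<close> close to \<open>sqrt (3 / k)\<close> this loses about four per cent.
\<close>
lemma integral_sixth_moment_gaussian_le:
  fixes k a b :: real
  assumes k: "k > 0" and a: "a \<ge> 0" and b: "b > 0"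
  shows "integral {0..a} (\<lambda>x. x ^ 6 * exp (- k * x\<^sup>2)) \<le> (b / k ^ 3 + 3 / (b * k ^ 4)) / 2"
proof -
  obtain I5 where I5: "((\<lambda>x. x ^ 5 * exp (- k * x\<^sup>2)) has_integral I5) {0..a}" "I5 \<le> 1 / k ^ 3"
    using has_integral_power5_gaussian[OF k a] .
  obtain I7 where I7: "((\<lambda>x. x ^ 7 * exp (- k * x\<^sup>2)) has_integral I7) {0..a}" "I7 \<le> 3 / k ^ 4"
    using has_integral_power7_gaussian[OF k a] .
  have "integral {0..a} (\<lambda>x. x ^ 6 * exp (- k * x\<^sup>2)) \<le> b / 2 * I5 + 1 / (2 * b) * I7"
  proof (rule has_integral_le)
    show "((\<lambda>x. x ^ 6 * exp (- k * x\<^sup>2)) has_integral integral {0..a} (\<lambda>x. x ^ 6 * exp (- k * x\<^sup>2))) {0..a}"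
      by (intro integrable_integral integrable_continuous_interval continuous_intros)
    show "((\<lambda>x. b / 2 * (x ^ 5 * exp (- k * x\<^sup>2)) + 1 / (2 * b) * (x ^ 7 * exp (- k * x\<^sup>2)))
        has_integral b / 2 * I5 + 1 / (2 * b) * I7) {0..a}"
      by (intro has_integral_add has_integral_mult_right I5 I7)
    fix x assume "x \<in> {0..a}"
    then have x: "x \<ge> 0" by simp
    have "0 \<le> x ^ 5 * (x - b)\<^sup>2 / (2 * b)" using x b by simp
    also have "\<dots> = b / 2 * x ^ 5 + 1 / (2 * b) * x ^ 7 - x ^ 6"
      using b by (simp add: field_simps eval_nat_numeral)
    finally have "x ^ 6 * exp (- k * x\<^sup>2) \<le> (b / 2 * x ^ 5 + 1 / (2 * b) * x ^ 7) * exp (- k * x\<^sup>2)"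
      by (intro mult_right_mono) auto
    then show "x ^ 6 * exp (- k * x\<^sup>2) \<le> b / 2 * (x ^ 5 * exp (- k * x\<^sup>2)) + 1 / (2 * b) * (x ^ 7 * exp (- k * x\<^sup>2))"
      by (simp only: distrib_right mult.assoc)
  qed
  also have "\<dots> \<le> b / 2 * (1 / k ^ 3) + 1 / (2 * b) * (3 / k ^ 4)"
    using I5 I7 b by (intro add_mono mult_left_mono) auto
  finally show ?thesis by (simp add: add_divide_distrib)
qed

lemma integral_quarter_disc:
  fixes s :: real
  assumes s: "s > 0"
  shows "((\<lambda>x. sqrt (1 - (x / s)\<^sup>2)) has_integral (pi / 4 * s)) {0..s}"
proof -
  let ?F = "\<lambda>x. x / 2 * sqrt (1 - (x / s)\<^sup>2) + s / 2 * arcsin (x / s)"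
  have "((\<lambda>x. sqrt (1 - (x / s)\<^sup>2)) has_integral (?F s - ?F 0)) {0..s}"
  proof (rule fundamental_theorem_of_calculus_interior)
    show "continuous_on {0..s} ?F"
      using s by (intro continuous_intros) (auto simp: divide_simps)
    fix x assume x: "x \<in> {0<..<s}"
    define y where "y = x / s"
    have y: "0 < y" "y < 1" using x s by (auto simp: y_def)
    have xs: "x = y * s" using s by (simp add: y_def)
    define r where "r = sqrt (1 - y\<^sup>2)"
    have "y\<^sup>2 < 1" using y by (simp add: power_less_one_iff)
    then have r: "r > 0" "r\<^sup>2 = 1 - y\<^sup>2" by (simp_all add: r_def)
    have "(?F has_real_derivative (1 / 2 * sqrt (1 - (x / s)\<^sup>2) + x / 2 * (inverse (sqrt (1 - (x / s)\<^sup>2)) / 2 * (- (2 * (x / s) * (1 / s))))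
        + s / 2 * (inverse (sqrt (1 - (x / s)\<^sup>2)) * (1 / s)))) (at x)"
      using y s \<open>y\<^sup>2 < 1\<close> unfolding y_def
      by (auto intro!: derivative_eq_intros simp: divide_simps) (simp add: algebra_simps eval_nat_numeral)
    also have "1 / 2 * sqrt (1 - (x / s)\<^sup>2) + x / 2 * (inverse (sqrt (1 - (x / s)\<^sup>2)) / 2 * (- (2 * (x / s) * (1 / s))))
        + s / 2 * (inverse (sqrt (1 - (x / s)\<^sup>2)) * (1 / s)) = r / 2 + (1 - y\<^sup>2) / (2 * r)"
      unfolding y_def[symmetric] unfolding r_def[symmetric] unfolding xs using s r(1) by (simp add: field_simps power2_eq_square)
    also have "\<dots> = r" unfolding r(2)[symmetric] using r(1) by (simp add: power2_eq_square)
    finally show "(?F has_vector_derivative sqrt (1 - (x / s)\<^sup>2)) (at x)"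
      by (simp add: has_real_derivative_iff_has_vector_derivative r_def y_def)
  qed (use s in simp)
  then show ?thesis using s by (simp add: mult.commute)
qed

lemma sin_ge_x_cos:
  fixes x :: real
  assumes "0 \<le> x" "x \<le> pi"
  shows "x * cos x \<le> sin x"
proof -
  have "(\<lambda>x. sin x - x * cos x) 0 \<le> (\<lambda>x. sin x - x * cos x) x"
  proof (rule DERIV_nonneg_imp_nondecreasing[OF assms(1)])
    fix y assume "0 \<le> y" "y \<le> x"
    then show "\<exists>d. ((\<lambda>x. sin x - x * cos x) has_real_derivative d) (at y) \<and> d \<ge> 0"
      using assms by (intro exI[of _ "y * sin y"]) (auto intro!: derivative_eq_intros mult_nonneg_nonneg sin_ge_zero)
  qed
  then show ?thesis by simp
qed

lemma one_minus_cos_ge: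
  fixes x :: real
  assumes "0 \<le> x" "x \<le> pi"
  shows "x\<^sup>2 / 2 * (1 - x\<^sup>2 / 4) \<le> 1 - cos x"
proof -
  define y where "y = x / 2"
  have y: "0 \<le> y" "y \<le> pi / 2" and x: "x = 2 * y" using assms by (auto simp: y_def)
  have "0 \<le> cos y" using y by (intro cos_ge_zero) auto
  then have "(y * cos y)\<^sup>2 \<le> (sin y)\<^sup>2" using y by (intro power_mono sin_ge_x_cos) auto
  moreover have "(sin y)\<^sup>2 \<le> y\<^sup>2" using abs_sin_x_le_abs_x[of y] by (metis abs_le_square_iff)
  moreover have "(cos y)\<^sup>2 = 1 - (sin y)\<^sup>2" by (rule cos_squared_eq)
  ultimately have "y\<^sup>2 * (1 - y\<^sup>2) \<le> (sin y)\<^sup>2"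
    using mult_left_mono[of "1 - y\<^sup>2" "(cos y)\<^sup>2" "y\<^sup>2"] by (simp add: power_mult_distrib)
  then show ?thesis using cos_double_sin[of y] unfolding x by (simp add: power_mult_distrib algebra_simps)
qed

lemma cosh_minus_one_bounds:
  fixes t :: real
  assumes "0 < t" "t < 2"
  shows "t\<^sup>2 / 2 \<le> cosh t - 1" "(cosh t - 1) * (1 - t\<^sup>2 / 4) \<le> t\<^sup>2 / 2"
proof -
  define s where "s = sinh (t / 2)"
  have c: "cosh t - 1 = 2 * s\<^sup>2"
    using cosh_double_cosh[of "t / 2"] cosh_square_eq[of "t / 2"] by (simp add: s_def)
  have s: "t / 2 \<le> s" using x_le_sinh[of "t/2"] assms by (simp add: s_def)
  then have "(t / 2)\<^sup>2 \<le> s\<^sup>2" using assms by (intro power_mono) auto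
  then show "t\<^sup>2 / 2 \<le> cosh t - 1" by (simp add: c power_divide)
  have "s\<^sup>2 \<le> (t / 2 * cosh (t / 2))\<^sup>2"
    using sinh_le_x_cosh[of "t/2"] s assms by (intro power_mono) (auto simp: s_def)
  also have "\<dots> = t\<^sup>2 / 4 * (1 + s\<^sup>2)" by (simp add: power_mult_distrib power_divide cosh_square_eq s_def)
  finally show "(cosh t - 1) * (1 - t\<^sup>2 / 4) \<le> t\<^sup>2 / 2" by (simp add: c algebra_simps)
qed

section \<open>The three ranges of the angle\<close>

text \<open>
  \<open>x\<close> agrees with \<open>(\<theta> / t)\<^sup>2\<close> up to a factor \<open>1 + O(t\<^sup>2)\<close> on \<open>{0..3 / 2 * t}\<close>, and is increasing in \<open>\<theta>\<close>.
\<close>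
lemma saddle_coordinate_bounds:
  fixes t \<theta> :: real
  assumes t: "0 < t" "t \<le> 1 / 34" and \<theta>: "0 \<le> \<theta>"
  defines "x \<equiv> (1 - cos \<theta>) / (cosh t - 1)"
  shows "x \<le> (\<theta> / t)\<^sup>2" and "0 \<le> x"
    and "\<theta> \<le> 3 / 2 * t \<Longrightarrow> 999 / 1000 * (\<theta> / t)\<^sup>2 \<le> x"
    and "3 / 2 * t \<le> \<theta> \<Longrightarrow> \<theta> \<le> pi \<Longrightarrow> 22 / 10 \<le> x"
proof -
  define c where "c = cosh t - 1"
  have c: "t\<^sup>2 / 2 \<le> c" "c * (1 - t\<^sup>2 / 4) \<le> t\<^sup>2 / 2"
    using cosh_minus_one_bounds[of t] t by (auto simp: c_def)
  have t2: "0 < t\<^sup>2" "t\<^sup>2 \<le> 1 / 1156"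
    using t power_mono[of t "1/34" 2] by (auto simp: power2_eq_square)
  have c0: "c > 0" using c t2 by linarith
  have "(1 - cos \<theta>) / c \<le> (\<theta>\<^sup>2 / 2) / (t\<^sup>2 / 2)"
    using one_minus_cos_le[of \<theta>] c t2 by (intro frac_le) auto
  then show "x \<le> (\<theta> / t)\<^sup>2" by (simp add: x_def c_def power_divide)
  show "0 \<le> x" using c0 by (simp add: x_def c_def)
  have lower: "999 / 1000 * (\<phi> / t)\<^sup>2 \<le> (1 - cos \<phi>) / c" if \<phi>: "0 \<le> \<phi>" "\<phi> \<le> 3 / 2 * t" for \<phi>
  proof -
    have "\<phi>\<^sup>2 \<le> (3 / 2 * t)\<^sup>2" using \<phi> by (intro power_mono) auto
    then have p2: "\<phi>\<^sup>2 \<le> 9 / 4 * t\<^sup>2" by (simp add: power_mult_distrib power2_eq_square)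
    have "\<phi> \<le> pi" using \<phi> t pi_gt3 by linarith
    note one_minus_cos_ge[OF \<phi>(1) this]
    moreover have "999 / 1000 * (\<phi> / t)\<^sup>2 * c \<le> \<phi>\<^sup>2 / 2 * (1 - \<phi>\<^sup>2 / 4)"
    proof -
      have "999 / 1000 * c \<le> (1 - \<phi>\<^sup>2 / 4) * (t\<^sup>2 / 2)"
      proof -
        have "c * (4623 / 4624) \<le> c * (1 - t\<^sup>2 / 4)" using t2 c0 by (intro mult_left_mono) auto
        then have 1: "c \<le> 4624 / 4623 * (t\<^sup>2 / 2)" using c(2) by linarith
        have 2: "(18487 / 18496) * (t\<^sup>2 / 2) \<le> (1 - \<phi>\<^sup>2 / 4) * (t\<^sup>2 / 2)"
          using p2 t2 by (intro mult_right_mono) auto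
        have "999 / 1000 * c \<le> B"
          if "c \<le> 4624 / 4623 * T" "(18487 / 18496) * T \<le> B" "T \<ge> 0" for B T :: real
          using that by linarith
        from this[OF 1 2] show ?thesis by simp
      qed
      then have "(\<phi> / t)\<^sup>2 * (999 / 1000 * c) \<le> (\<phi> / t)\<^sup>2 * ((1 - \<phi>\<^sup>2 / 4) * (t\<^sup>2 / 2))"
        by (intro mult_left_mono) auto
      also have "\<dots> = \<phi>\<^sup>2 / 2 * (1 - \<phi>\<^sup>2 / 4)" using t by (simp add: power_divide)
      finally show ?thesis by (simp add: mult_ac)
    qed
    ultimately have "999 / 1000 * (\<phi> / t)\<^sup>2 * c \<le> 1 - cos \<phi>" by (rule order_trans[rotated])
    then show ?thesis using c0 by (simp only: pos_le_divide_eq)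
  qed
  show "\<theta> \<le> 3 / 2 * t \<Longrightarrow> 999 / 1000 * (\<theta> / t)\<^sup>2 \<le> x"
    using lower[of \<theta>] \<theta> by (simp add: x_def c_def)
  assume "3 / 2 * t \<le> \<theta>" "\<theta> \<le> pi"
  then have "cos \<theta> \<le> cos (3 / 2 * t)" using t by (intro cos_monotone_0_pi_le) auto
  then have "(1 - cos (3 / 2 * t)) / c \<le> x" using c0 by (simp add: x_def c_def divide_right_mono)
  moreover have sq: "(3 / 2 * t / t)\<^sup>2 = 9 / 4" using t by (simp add: power2_eq_square)
  have "999 / 1000 * (9 / 4) \<le> (1 - cos (3 / 2 * t)) / c" using lower[of "3 / 2 * t"] t unfolding sq by simp
  ultimately show "22 / 10 \<le> x" by linarith
qed

text \<open>
  The three ranges of the angle: a Gaussian bound in the central range, and constants in the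
  intermediate range and on the rest of the half circle. They all follow from bounds for the rational
  function \<open>x / (x + 1) - 5002 / 10000 * (x / (x + 4))\<close>, which behaves like \<open>7 / 8 * x\<close> near \<open>0\<close> and tends to
  about \<open>1 / 2\<close> at infinity.
\<close>
lemma saddle_exponent_bounds:
  fixes t \<theta> :: real
  assumes t: "0 < t" "t \<le> 1 / 34" and \<theta>: "0 \<le> \<theta>"
  defines "x \<equiv> (1 - cos \<theta>) / (cosh t - 1)"
  defines "V \<equiv> 27 / 32 / t * (x / (x + 1) - 5002 / 10000 * (x / (x + 4)))"
  shows "\<theta> \<le> 55 / 100 * t \<Longrightarrow> 548 / 1000 / t ^ 3 * \<theta>\<^sup>2 \<le> V"
    and "55 / 100 * t \<le> \<theta> \<Longrightarrow> \<theta> \<le> 3 / 2 * t \<Longrightarrow> 164 / 1000 / t \<le> V"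
    and "3 / 2 * t \<le> \<theta> \<Longrightarrow> \<theta> \<le> pi \<Longrightarrow> 413 / 1000 / t \<le> V"
proof -
  note x = saddle_coordinate_bounds[OF t \<theta>, folded x_def]
  define g where "g = x / (x + 1) - 5002 / 10000 * (x / (x + 4))"
  have V: "V = 27 / 32 / t * g" by (simp add: V_def g_def)
  have g: "g = x * ((4998 / 10000 * x + 34998 / 10000) / ((x + 1) * (x + 4)))"
    using x(2) by (simp add: g_def divide_simps) (simp add: algebra_simps)
  show "548 / 1000 / t ^ 3 * \<theta>\<^sup>2 \<le> V" if "\<theta> \<le> 55 / 100 * t"
  proof -
    have "\<theta> / t \<le> 55 / 100" using that t by (simp add: divide_simps)
    then have "(\<theta> / t)\<^sup>2 \<le> (55 / 100)\<^sup>2" using \<theta> t by (intro power_mono) auto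
    moreover have sq: "(55 / 100 :: real)\<^sup>2 = 3025 / 10000" by (simp add: power2_eq_square)
    ultimately have x1: "x \<le> 3025 / 10000" using x(1) by linarith
    have "651 / 1000 * ((x + 1) * (x + 4)) \<le> 4998 / 10000 * x + 34998 / 10000"
    proof -
      have "x * x \<le> 3025 / 10000 * x" using x1 x(2) by (intro mult_right_mono) auto
      then have "651 / 1000 * (x * x + 5 * x + 4) \<le> 4998 / 10000 * x + 34998 / 10000"
        using x1 by argo
      then show ?thesis by (simp add: algebra_simps)
    qed
    then have "651 / 1000 \<le> (4998 / 10000 * x + 34998 / 10000) / ((x + 1) * (x + 4))"
      using x(2) by (simp add: pos_le_divide_eq)
    then have "x * (651 / 1000) \<le> g" unfolding g using x(2) by (intro mult_left_mono)
    moreover have "999 / 1000 * (\<theta> / t)\<^sup>2 \<le> x" using x(3) that t by simp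
    ultimately have "(999 / 1000 * (\<theta> / t)\<^sup>2) * (651 / 1000) \<le> g" by linarith
    then have "27 / 32 / t * ((999 / 1000 * (\<theta> / t)\<^sup>2) * (651 / 1000)) \<le> V"
      unfolding V using t by (intro mult_left_mono) auto
    moreover have "548 / 1000 / t ^ 3 * \<theta>\<^sup>2 \<le> 27 / 32 / t * ((999 / 1000 * (\<theta> / t)\<^sup>2) * (651 / 1000))"
      using t by (simp add: power_divide field_simps eval_nat_numeral)
    ultimately show ?thesis by linarith
  qed
  have gen: "c * (27 / 32) / t \<le> V" if "c * ((x + 1) * (x + 4)) \<le> 4998 / 10000 * (x * x) + 34998 / 10000 * x" for c
  proof -
    have "c \<le> (4998 / 10000 * (x * x) + 34998 / 10000 * x) / ((x + 1) * (x + 4))"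
      using that x(2) by (simp add: pos_le_divide_eq)
    also have "\<dots> = g" unfolding g by (simp add: algebra_simps)
    finally have "27 / 32 / t * c \<le> V" unfolding V using t by (intro mult_left_mono) auto
    then show ?thesis by (simp add: mult_ac)
  qed
  show "164 / 1000 / t \<le> V" if "55 / 100 * t \<le> \<theta>" "\<theta> \<le> 3 / 2 * t"
  proof -
    have "55 / 100 \<le> \<theta> / t" using that t by (simp add: divide_simps)
    then have "(55 / 100)\<^sup>2 \<le> (\<theta> / t)\<^sup>2" by (intro power_mono) auto
    moreover have sq: "(55 / 100 :: real)\<^sup>2 = 3025 / 10000" by (simp add: power2_eq_square)
    ultimately have x2: "302 / 1000 \<le> x" using x(3)[OF that(2)] by linarith
    then have "302 / 1000 * x \<le> x * x" by (intro mult_right_mono) auto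
    then have "195 / 1000 * (x * x + 5 * x + 4) \<le> 4998 / 10000 * (x * x) + 34998 / 10000 * x"
      using x2 by argo
    then have "195 / 1000 * ((x + 1) * (x + 4)) \<le> 4998 / 10000 * (x * x) + 34998 / 10000 * x"
      by (simp add: algebra_simps)
    from gen[OF this] have "195 / 1000 * (27 / 32) / t \<le> V" .
    moreover have "164 / 1000 / t \<le> 195 / 1000 * (27 / 32) / t" using t by (intro divide_right_mono) auto
    ultimately show ?thesis by linarith
  qed
  show "413 / 1000 / t \<le> V" if "3 / 2 * t \<le> \<theta>" "\<theta> \<le> pi"
  proof -
    have x2: "22 / 10 \<le> x" using x(4) that by simp
    then have "22 / 10 * x \<le> x * x" by (intro mult_right_mono) auto
    then have "49 / 100 * (x * x + 5 * x + 4) \<le> 4998 / 10000 * (x * x) + 34998 / 10000 * x"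
      using x2 by argo
    then have "49 / 100 * ((x + 1) * (x + 4)) \<le> 4998 / 10000 * (x * x) + 34998 / 10000 * x"
      by (simp add: algebra_simps)
    from gen[OF this] have "49 / 100 * (27 / 32) / t \<le> V" .
    moreover have "413 / 1000 / t \<le> 49 / 100 * (27 / 32) / t" using t by (intro divide_right_mono) auto
    ultimately show ?thesis by linarith
  qed
qed

lemma mult_exp_minus_antimono:
  fixes w w0 :: real
  assumes "1 \<le> w0" "w0 \<le> w"
  shows "w * exp (- w) \<le> w0 * exp (- w0)"
proof -
  have "w \<le> w0 * (1 + (w - w0))"
    using assms mult_right_mono[of 1 w0 "w - w0"] by (simp add: algebra_simps)
  also have "\<dots> \<le> w0 * exp (w - w0)" using assms by (intro mult_left_mono exp_ge_add_one_self) auto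
  finally have "w * exp (- w) \<le> w0 * exp (w - w0) * exp (- w)" by (intro mult_right_mono) auto
  also have "\<dots> = w0 * exp (- w0)" by (simp add: mult.assoc flip: exp_add)
  finally show ?thesis .
qed

text \<open>
  The numerical heart of the analytic part. After division by \<open>z ^ 4\<close> every term on the left increases
  with \<open>z\<close>, so that the largest admissible value \<open>t = 287 / 10000\<close> decides. The first two terms bound the
  contribution of the central range, the other two those of the outer ranges.
\<close>
lemma dominating_terms_small:
  fixes z :: real
  assumes z: "0 < z" and t: "t = z\<^sup>2" "t \<le> 287 / 10000"
  shows "7506 / 1000 * z ^ 5 + 440 / 1000 * z ^ 6 + 192 / 100 * t * exp (- (164 / 1000 / t))
     + 632 / 100 * exp (- (413 / 1000 / t)) \<le> 1687 / 1000 * z ^ 4"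
proof -
  have t0: "t > 0" using z t by simp
  have zle: "z \<le> 1695 / 10000"
  proof (rule power2_le_imp_le)
    show "z\<^sup>2 \<le> (1695 / 10000)\<^sup>2" using t by (simp add: power2_eq_square)
  qed simp
  define w where "w = 164 / 1000 / t"
  have w: "57 / 10 \<le> w" using t t0 by (simp add: w_def field_simps)
  have e57: "220 \<le> exp (57 / 10 :: real)"
  proof -
    have "(1966 / 1000 :: real) \<le> exp (7125 / 10000)"
      using exp_lower_Taylor_quadratic[of "7125 / 10000 :: real"] by (simp add: power2_eq_square)
    then have "(1966 / 1000 :: real) ^ 8 \<le> exp (7125 / 10000) ^ 8" by (intro power_mono) auto
    also have "\<dots> = exp (57 / 10 :: real)" by (simp flip: exp_of_nat_mult)
    finally show ?thesis by (simp add: power_divide)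
  qed
  have "w * exp (- w) \<le> 57 / 10 * exp (- (57 / 10))" using w by (intro mult_exp_minus_antimono) auto
  also have "\<dots> \<le> 57 / 10 * (1 / 220)"
    using e57 by (intro mult_left_mono) (auto simp: exp_minus divide_simps)
  finally have w1: "w * exp (- w) \<le> 26 / 1000" by simp
  have A: "192 / 100 * t * exp (- w) \<le> 305 / 1000 * z ^ 4"
  proof -
    have "t * exp (- w) = t * (w * exp (- w)) * (t / (164 / 1000))" using t0 by (simp add: w_def)
    also have "\<dots> \<le> t * (26 / 1000) * (t / (164 / 1000))"
      using w1 t0 by (intro mult_right_mono mult_left_mono) auto
    also have "\<dots> = 26 / 164 * z ^ 4" using t by (simp add: eval_nat_numeral)
    finally have "t * exp (- w) \<le> 26 / 164 * z ^ 4" .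
    moreover have "0 \<le> z ^ 4" by simp
    ultimately show ?thesis by linarith
  qed
  \<comment> \<open>here \<open>1 / t\<^sup>2\<close> has to be absorbed, so half of the exponent is used for each factor \<open>1 / t\<close>\<close>
  define v where "v = 413 / 1000 / t"
  have v: "143 / 10 \<le> v" using t t0 by (simp add: v_def field_simps)
  have B: "632 / 100 * exp (- v) \<le> 60 / 1000 * z ^ 4"
  proof -
    have "v / 2 * exp (- (v / 2)) \<le> 143 / 20 * exp (- (143 / 20))" using v by (intro mult_exp_minus_antimono) auto
    also have "exp (- (143 / 20)) \<le> 1 / (680 :: real)"
    proof -
      have "(226 / 100 :: real) \<le> exp (8937 / 10000)"
        using exp_lower_Taylor_quadratic[of "8937 / 10000 :: real"] by (simp add: power2_eq_square)
      then have "(226 / 100 :: real) ^ 8 \<le> exp (8937 / 10000) ^ 8" by (intro power_mono) auto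
      also have "\<dots> = exp (8 * (8937 / 10000) :: real)" by (simp flip: exp_of_nat_mult)
      also have "\<dots> \<le> exp (143 / 20)" by simp
      finally have "680 \<le> exp (143 / 20 :: real)" by (simp add: power_divide)
      then show ?thesis by (simp add: exp_minus divide_simps)
    qed
    finally have "v / 2 * exp (- (v / 2)) \<le> 106 / 10000" by simp
    then have "(v / 2 * exp (- (v / 2)))\<^sup>2 \<le> (106 / 10000)\<^sup>2" using v by (intro power_mono) auto
    then have "v\<^sup>2 / 4 * exp (- v) \<le> (106 / 10000)\<^sup>2"
      by (simp add: power_mult_distrib power_divide flip: exp_double)
    moreover have "exp (- v) = v\<^sup>2 / 4 * exp (- v) * (4 * (t / (413 / 1000))\<^sup>2)"
      using t0 by (simp add: v_def power_divide)
    ultimately have "exp (- v) \<le> (106 / 10000)\<^sup>2 * (4 * (t / (413 / 1000))\<^sup>2)"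
      by (smt (verit) mult_right_mono zero_le_power2)
    also have "\<dots> = (106 / 10000)\<^sup>2 * 4 / (413 / 1000)\<^sup>2 * z ^ 4"
      using t by (simp add: power_divide flip: power_mult)
    also have "\<dots> \<le> 27 / 10000 * z ^ 4" using z by (intro mult_right_mono) (auto simp: power2_eq_square)
    finally have "632 / 100 * exp (- v) \<le> 632 / 100 * (27 / 10000 * z ^ 4)" by (rule mult_left_mono) simp
    also have "\<dots> \<le> 60 / 1000 * z ^ 4" using z by simp
    finally show ?thesis .
  qed
  have "7506 / 1000 * z + 440 / 1000 * z\<^sup>2 \<le> 1290 / 1000"
    using zle t by simp
  then have "(7506 / 1000 * z + 440 / 1000 * z\<^sup>2) * z ^ 4 \<le> 1290 / 1000 * z ^ 4"
    using z by (intro mult_right_mono) auto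
  then have "7506 / 1000 * z ^ 5 + 440 / 1000 * z ^ 6 \<le> 1290 / 1000 * z ^ 4"
    by (simp add: eval_nat_numeral algebra_simps)
  moreover have "0 \<le> z ^ 4" using z by simp
  ultimately show ?thesis using A B unfolding w_def v_def by linarith
qed

section \<open>The saddle point estimate\<close>

lemma continuous_on_dp_poly_rcis [continuous_intros]:
  "continuous_on A (\<lambda>\<theta>. dp_poly M (rcis p \<theta>))"
  unfolding dp_poly_def rcis_def cis.ctr complex_eq_iff
  by (auto intro!: continuous_intros simp: cis_conv_exp)

lemma integral_le_const_interval:
  fixes f :: "real \<Rightarrow> real"
  assumes "a \<le> b" "continuous_on {a..b} f" "\<And>x. a \<le> x \<Longrightarrow> x \<le> b \<Longrightarrow> f x \<le> c"
  shows "integral {a..b} f \<le> (b - a) * c"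
proof -
  have "integral {a..b} f \<le> integral {a..b} (\<lambda>x. c)"
    using assms by (intro integral_le integrable_continuous_interval) auto
  then show ?thesis using assms(1) by simp
qed

text \<open>
  With \<open>G\<close> the modulus of the polynomial on the circle and \<open>I\<close> its integral, \<open>pi * q (n + L) * p ^ (n + L)\<close> is at most
  \<open>I\<close>, whatever \<open>L\<close> is. On the other hand \<open>pi * q n * p ^ n\<close> is \<open>I\<close> minus the integral of
  \<open>G * (1 - cos \<psi>)\<close>. This is a small multiple of \<open>I\<close>, because \<open>\<psi>\<close> is of order \<open>\<theta> ^ 3 / t ^ 4\<close> in the central
  range and \<open>G\<close> is concentrated on angles \<open>\<theta>\<close> of order \<open>t powr (3 / 2)\<close>. The true loss is of order \<open>t\<close>;
  the factor \<open>sqrt t\<close> has the size of the slack that it is compared with below, which leaves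
  room for crude constants.
\<close>
lemma q_shift_bound_saddle:
  fixes n L :: nat and t :: real
  assumes t: "0 < t" "t \<le> 287 / 10000" and n: "pi\<^sup>2 / (12 * t\<^sup>2) = real n + 1 / 24"
  shows "(1 - 304 / 100 * sqrt t) * (real (q (n + L)) * exp (- t * real L)) \<le> real (q n)"
proof -
  define p where "p = exp (-t)"
  have p: "0 < p" "p < 1" using t by (auto simp: p_def)
  define z where "z = sqrt t"
  have z: "z > 0" "z\<^sup>2 = t" using t by (auto simp: z_def)
  have zpow: "t ^ k = z ^ (2 * k)" for k unfolding z(2)[symmetric] power_mult ..
  have t34: "t \<le> 1 / 34" using t by simp
  from saddle_point_bounds[OF t(1) t34 n, of "n + L"] obtain M where M: "n + L \<le> M"
    and up: "\<And>\<theta>. let x = (1 - cos \<theta>) / (cosh t - 1) in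
            cmod (dp_poly M (rcis p \<theta>)) \<le> dp_weight M p *
              (exp (1/200) * exp (- (27 / 32 / t * (x / (x + 1) - 5002 / 10000 * (x / (x + 4))))))"
    and mean: "\<bar>(\<Sum>k=1..M. real k * (exp (-t) ^ k / (1 + exp (-t) ^ k))) - real n\<bar> \<le> 1 / 2"
    unfolding p_def by blast
  define W where "W = dp_weight M p"
  have W: "W > 0" using dp_weight_pos[of p M] p by (simp add: W_def)
  define G where "G = (\<lambda>\<theta>. cmod (dp_poly M (rcis p \<theta>)))"
  define R where "R = (\<lambda>m \<theta>. Re (dp_poly M (rcis p \<theta>) * cis (- (real m * \<theta>))))"
  have contG: "continuous_on A G" for A unfolding G_def by (intro continuous_intros)
  have contR: "continuous_on A (R m)" for A m unfolding R_def cis_conv_exp by (intro continuous_intros)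
  have RG: "R m \<theta> \<le> G \<theta>" for m \<theta>
    unfolding R_def G_def by (rule order_trans[OF complex_Re_le_cmod]) (simp add: norm_mult)
  have RG2: "G \<theta> - R m \<theta> \<le> 2 * G \<theta>" for m \<theta>
    using abs_Re_le_cmod[of "dp_poly M (rcis p \<theta>) * cis (- (real m * \<theta>))"]
    unfolding R_def G_def by (simp add: norm_mult del: times_complex.sel)
  define I where "I = integral {0..pi} G"
  have coeff: "integral {0..pi} (R m) = pi * (real (q m) * p ^ m)" if "m \<le> M" for m
    using has_integral_dp_poly_coeff[OF that, of p] unfolding R_def by (rule integral_unique)
  have intG: "G integrable_on {a..b}" for a b using contG by (rule integrable_continuous_interval)
  have intR: "R m integrable_on {a..b}" for m a b using contR by (rule integrable_continuous_interval)
  have up': "G \<theta> \<le> W * (exp (1/200) * exp (- V))"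
    if "V \<le> 27 / 32 / t * (x / (x + 1) - 5002 / 10000 * (x / (x + 4)))" "x = (1 - cos \<theta>) / (cosh t - 1)" for \<theta> V x
  proof -
    have "G \<theta> \<le> W * (exp (1/200) * exp (- (27 / 32 / t * (x / (x + 1) - 5002 / 10000 * (x / (x + 4))))))"
      unfolding that(2) using up[of \<theta>] unfolding Let_def G_def W_def .
    also have "\<dots> \<le> W * (exp (1/200) * exp (- V))"
      using that(1) W by (intro mult_left_mono) auto
    finally show ?thesis .
  qed
  have E: "exp (1/200 :: real) \<le> 1005025 / 1000000"
    using exp_bound[of "1/200 :: real"] by (simp add: power2_eq_square)
  have large: "(b - a) * (2 * W * exp (1/200) * exp (- V)) \<ge> integral {a..b} (\<lambda>\<theta>. G \<theta> - R n \<theta>)"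
    if "a \<le> b" "\<And>\<theta>. a \<le> \<theta> \<Longrightarrow> \<theta> \<le> b \<Longrightarrow> V \<le> 27 / 32 / t * ((1 - cos \<theta>) / (cosh t - 1) / ((1 - cos \<theta>) / (cosh t - 1) + 1) - 5002 / 10000 * ((1 - cos \<theta>) / (cosh t - 1) / ((1 - cos \<theta>) / (cosh t - 1) + 4)))" for a b V
  proof (rule integral_le_const_interval[OF that(1)])
    show "continuous_on {a..b} (\<lambda>\<theta>. G \<theta> - R n \<theta>)" by (intro continuous_intros contG contR)
    fix \<theta> assume "a \<le> \<theta>" "\<theta> \<le> b"
    from up'[OF that(2)[OF this] refl] RG2[of \<theta> n] show "G \<theta> - R n \<theta> \<le> 2 * W * exp (1/200) * exp (- V)" by linarith
  qed
  \<comment> \<open>\<open>a1\<close> balances the Gaussian bound, which degrades with growing \<open>\<theta>\<close>, against the trivial bound \<open>2 * G\<close> beyond it\<close>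
  define a1 where "a1 = 55 / 100 * t"
  define a2 where "a2 = 3 / 2 * t"
  have a: "0 \<le> a1" "a1 \<le> a2" "a2 \<le> pi" using t pi_gt3 by (auto simp: a1_def a2_def)
  have far: "integral {a2..pi} (\<lambda>\<theta>. G \<theta> - R n \<theta>) \<le> W * (632 / 100 * exp (- (413 / 1000 / t)))"
  proof -
    have "integral {a2..pi} (\<lambda>\<theta>. G \<theta> - R n \<theta>) \<le> (pi - a2) * (2 * W * exp (1/200) * exp (- (413 / 1000 / t)))"
      using a by (intro large saddle_exponent_bounds(3)[OF t(1) t34]) (auto simp: a2_def)
    also have "\<dots> = W * (((pi - a2) * 2 * exp (1/200)) * exp (- (413 / 1000 / t)))" by simp
    also have "\<dots> \<le> W * (632 / 100 * exp (- (413 / 1000 / t)))"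
    proof (intro mult_left_mono mult_right_mono)
      have "(pi - a2) * 2 * exp (1/200) \<le> (31416 / 10000 * 2) * (1005025 / 1000000)"
        using E a pi_approx t by (intro mult_mono) (auto simp: a2_def)
      then show "(pi - a2) * 2 * exp (1/200) \<le> 632 / 100" by simp
    qed (use W in auto)
    finally show ?thesis .
  qed
  have mid: "integral {a1..a2} (\<lambda>\<theta>. G \<theta> - R n \<theta>) \<le> W * (192 / 100 * t * exp (- (164 / 1000 / t)))"
  proof -
    have "integral {a1..a2} (\<lambda>\<theta>. G \<theta> - R n \<theta>) \<le> (a2 - a1) * (2 * W * exp (1/200) * exp (- (164 / 1000 / t)))"
      using a by (intro large saddle_exponent_bounds(2)[OF t(1) t34]) (auto simp: a2_def a1_def)
    also have "\<dots> = W * ((190 / 100 * exp (1/200)) * t * exp (- (164 / 1000 / t)))" by (simp add: a1_def a2_def)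
    also have "\<dots> \<le> W * (192 / 100 * t * exp (- (164 / 1000 / t)))"
      using W t E by (intro mult_left_mono mult_right_mono) auto
    finally show ?thesis .
  qed
  have near: "integral {0..a1} (\<lambda>\<theta>. G \<theta> - R n \<theta>) \<le> W * (7506 / 1000 * z ^ 5 + 440 / 1000 * z ^ 6)"
  proof -
    define \<kappa> where "\<kappa> = 548 / 1000 / t ^ 3"
    have \<kappa>: "\<kappa> > 0" using t by (simp add: \<kappa>_def)
    define T where "T = (6 + t\<^sup>2) / t ^ 4"
    have point: "G \<theta> - R n \<theta> \<le> W * exp (1/200) * (5252 / 10000 / t ^ 8 * (\<theta> ^ 6 * exp (- \<kappa> * \<theta>\<^sup>2)) + 7941 / 10000 * t\<^sup>2)"
      if \<theta>: "0 \<le> \<theta>" "\<theta> \<le> a1" for \<theta>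
    proof -
      have \<theta>2: "\<theta> \<le> 3 / 2 * t" using \<theta> a by (simp add: a2_def)
      have "G \<theta> * (1 - (1 / 2 * \<theta> + T * \<theta> ^ 3 / 6)\<^sup>2 / 2) \<le> R n \<theta>"
        unfolding G_def R_def p_def T_def
        by (rule re_dp_poly_ge[OF t(1) \<theta>(1) \<theta>2 sum_third_moment_le[OF t(1)] mean])
      then have 1: "G \<theta> - R n \<theta> \<le> G \<theta> * ((1 / 2 * \<theta> + T * \<theta> ^ 3 / 6)\<^sup>2 / 2)" by (simp add: algebra_simps)
      have 2: "G \<theta> \<le> W * (exp (1/200) * exp (- (\<kappa> * \<theta>\<^sup>2)))"
        using saddle_exponent_bounds(1)[OF t(1) t34 \<theta>(1)] \<theta>(2) by (intro up'[OF _ refl]) (auto simp: \<kappa>_def a1_def)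
      have 3: "(1 / 2 * \<theta> + T * \<theta> ^ 3 / 6)\<^sup>2 / 2 \<le> 5252 / 10000 / t ^ 8 * \<theta> ^ 6 + 7941 / 10000 * t\<^sup>2"
      proof -
        define A where "A = 1 / 2 * \<theta>"
        define B where "B = T * \<theta> ^ 3 / 6"
        \<comment> \<open>the weight favours \<open>B\<close>, because \<open>A\<close> comes from the small error of the mean\<close>
        have "0 \<le> (A - B / 20)\<^sup>2" by simp
        then have "(A + B)\<^sup>2 \<le> 21 * A\<^sup>2 + 105 / 100 * B\<^sup>2" by (simp add: power2_eq_square algebra_simps)
        moreover have "B\<^sup>2 \<le> 100031 / 100000 / t ^ 8 * \<theta> ^ 6"
        proof -
          have t2: "t\<^sup>2 \<le> (287 / 10000)\<^sup>2" using t by (intro power_mono) auto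
          then have "(1 + t\<^sup>2 / 6) \<le> 100015 / 100000" by (simp add: power2_eq_square)
          then have "(1 + t\<^sup>2 / 6)\<^sup>2 \<le> (100015 / 100000)\<^sup>2" by (intro power_mono) auto
          moreover have "(100015 / 100000 :: real)\<^sup>2 \<le> 100031 / 100000" by (simp add: power2_eq_square)
          ultimately have "(1 + t\<^sup>2 / 6)\<^sup>2 \<le> 100031 / 100000" by linarith
          then have *: "(1 + t\<^sup>2 / 6)\<^sup>2 * (\<theta> ^ 6 / t ^ 8) \<le> 100031 / 100000 * (\<theta> ^ 6 / t ^ 8)"
            using \<theta> t by (intro mult_right_mono) auto
          have "B = (1 + t\<^sup>2 / 6) * (\<theta> ^ 3 / t ^ 4)" using t by (simp add: B_def T_def field_simps)
          then have "B\<^sup>2 = (1 + t\<^sup>2 / 6)\<^sup>2 * (\<theta> ^ 6 / t ^ 8)"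
            by (simp add: power_mult_distrib power_divide flip: power_mult)
          with * show ?thesis by simp
        qed
        moreover have "A\<^sup>2 \<le> 3025 / 40000 * t\<^sup>2"
        proof -
          have "\<theta>\<^sup>2 \<le> (55 / 100 * t)\<^sup>2" using \<theta> by (intro power_mono) (auto simp: a1_def)
          then show ?thesis by (simp add: A_def power_mult_distrib power2_eq_square)
        qed
        moreover have "5252 / 10000 / t ^ 8 * \<theta> ^ 6 = 5252 / 10000 * (\<theta> ^ 6 / t ^ 8)"
          "100031 / 100000 / t ^ 8 * \<theta> ^ 6 = 100031 / 100000 * (\<theta> ^ 6 / t ^ 8)" by simp_all
        moreover have "0 \<le> \<theta> ^ 6 / t ^ 8" "0 \<le> t\<^sup>2" using \<theta> t by auto
        ultimately show ?thesis unfolding A_def[symmetric] B_def[symmetric] by linarith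
      qed
      have "G \<theta> - R n \<theta> \<le> (W * (exp (1/200) * exp (- (\<kappa> * \<theta>\<^sup>2)))) * (5252 / 10000 / t ^ 8 * \<theta> ^ 6 + 7941 / 10000 * t\<^sup>2)"
        using 1 W by (intro order_trans[OF 1] mult_mono[OF 2 3]) auto
      also have "\<dots> = W * exp (1/200) * (5252 / 10000 / t ^ 8 * (\<theta> ^ 6 * exp (- \<kappa> * \<theta>\<^sup>2)) + 7941 / 10000 * t\<^sup>2 * exp (- \<kappa> * \<theta>\<^sup>2))"
        by (simp add: algebra_simps)
      also have "\<dots> \<le> W * exp (1/200) * (5252 / 10000 / t ^ 8 * (\<theta> ^ 6 * exp (- \<kappa> * \<theta>\<^sup>2)) + 7941 / 10000 * t\<^sup>2 * 1)"
        using W \<kappa> by (intro mult_left_mono add_left_mono) auto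
      finally show ?thesis by simp
    qed
    have "integral {0..a1} (\<lambda>\<theta>. G \<theta> - R n \<theta>) \<le>
        integral {0..a1} (\<lambda>\<theta>. W * exp (1/200) * (5252 / 10000 / t ^ 8 * (\<theta> ^ 6 * exp (- \<kappa> * \<theta>\<^sup>2)) + 7941 / 10000 * t\<^sup>2))"
      by (intro integral_le integrable_continuous_interval continuous_intros contG contR) (use point t in auto)
    also have "\<dots> = W * exp (1/200) * (5252 / 10000 / t ^ 8 * integral {0..a1} (\<lambda>\<theta>. \<theta> ^ 6 * exp (- \<kappa> * \<theta>\<^sup>2)) + a1 * (7941 / 10000 * t\<^sup>2))"
      using a t by (subst integral_mult_right, subst integral_add)
        (auto intro!: integrable_continuous_interval continuous_intros)
    also have "\<dots> \<le> W * exp (1/200) * (7468 / 1000 * z ^ 5 + 437 / 1000 * z ^ 6)"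
    proof (intro mult_left_mono add_mono)
      \<comment> \<open>nearly the optimal parameter \<open>sqrt (3 / \<kappa>)\<close>\<close>
      define b where "b = 234 / 100 * z ^ 3"
      have b: "b > 0" using z by (simp add: b_def)
      have kz: "\<kappa> = 548 / 1000 / z ^ 6" by (simp add: \<kappa>_def zpow)
      have "b / \<kappa> ^ 3 = 234 / 100 / (548 / 1000) ^ 3 * z ^ 21"
        unfolding b_def kz using z(1) by (simp add: power_divide flip: power_mult power_add)
      moreover have "3 / (b * \<kappa> ^ 4) = 3 / (234 / 100 * (548 / 1000) ^ 4) * z ^ 21"
      proof -
        have "b * \<kappa> ^ 4 * z ^ 21 = 234 / 100 * (548 / 1000) ^ 4"
          unfolding b_def kz using z(1) by (simp add: power_divide flip: power_mult power_add)
        then show ?thesis using b \<kappa> z(1) by (simp add: divide_simps) (simp add: mult_ac)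
      qed
      ultimately have "(b / \<kappa> ^ 3 + 3 / (b * \<kappa> ^ 4)) / 2 = ((234 / 100 / (548 / 1000) ^ 3 + 3 / (234 / 100 * (548 / 1000) ^ 4)) / 2) * z ^ 21"
        by (simp only: distrib_right times_divide_eq_left)
      also have "\<dots> \<le> 14219 / 1000 * z ^ 21"
        using z by (intro mult_right_mono) (auto simp: power_divide)
      finally have "integral {0..a1} (\<lambda>\<theta>. \<theta> ^ 6 * exp (- \<kappa> * \<theta>\<^sup>2)) \<le> 14219 / 1000 * z ^ 21"
        using integral_sixth_moment_gaussian_le[OF \<kappa> a(1) b] by linarith
      then have "5252 / 10000 / t ^ 8 * integral {0..a1} (\<lambda>\<theta>. \<theta> ^ 6 * exp (- \<kappa> * \<theta>\<^sup>2)) \<le>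
          5252 / 10000 / t ^ 8 * (14219 / 1000 * z ^ 21)"
        using t by (intro mult_left_mono) auto
      also have "\<dots> = 5252 / 10000 * (14219 / 1000) * z ^ 5"
      proof -
        have "z ^ 21 = z ^ 5 * t ^ 8" by (simp add: zpow flip: power_add)
        then show ?thesis using t by simp
      qed
      also have "\<dots> \<le> 7468 / 1000 * z ^ 5" using z by (intro mult_right_mono) auto
      finally show "5252 / 10000 / t ^ 8 * integral {0..a1} (\<lambda>\<theta>. \<theta> ^ 6 * exp (- \<kappa> * \<theta>\<^sup>2)) \<le> 7468 / 1000 * z ^ 5" .
      have "a1 * (7941 / 10000 * t\<^sup>2) = 55 / 100 * (7941 / 10000) * t ^ 3"
        by (simp add: a1_def power2_eq_square power3_eq_cube)
      also have "\<dots> \<le> 437 / 1000 * t ^ 3" using t by (intro mult_right_mono) auto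
      finally show "a1 * (7941 / 10000 * t\<^sup>2) \<le> 437 / 1000 * z ^ 6" by (simp add: zpow)
    qed (use W in auto)
    also have "\<dots> = W * (exp (1/200) * (7468 / 1000 * z ^ 5 + 437 / 1000 * z ^ 6))" by simp
    also have "\<dots> \<le> W * (1005025 / 1000000 * (7468 / 1000 * z ^ 5 + 437 / 1000 * z ^ 6))"
      using W E z by (intro mult_left_mono mult_right_mono) auto
    also have "\<dots> \<le> W * (7506 / 1000 * z ^ 5 + 440 / 1000 * z ^ 6)"
    proof (rule mult_left_mono)
      have "0 \<le> z ^ 5" "0 \<le> z ^ 6" using z by auto
      then show "1005025 / 1000000 * (7468 / 1000 * z ^ 5 + 437 / 1000 * z ^ 6) \<le> 7506 / 1000 * z ^ 5 + 440 / 1000 * z ^ 6"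
        by argo
    qed (use W in simp)
    finally show ?thesis .
  qed
  have "I - integral {0..pi} (R n) = integral {0..pi} (\<lambda>\<theta>. G \<theta> - R n \<theta>)"
    unfolding I_def using intG intR by (subst integral_diff) auto
  also have "\<dots> = integral {0..a1} (\<lambda>\<theta>. G \<theta> - R n \<theta>) + (integral {a1..a2} (\<lambda>\<theta>. G \<theta> - R n \<theta>) + integral {a2..pi} (\<lambda>\<theta>. G \<theta> - R n \<theta>))"
  proof -
    have i: "(\<lambda>\<theta>. G \<theta> - R n \<theta>) integrable_on {a..b}" for a b using intG intR by (rule integrable_diff)
    have "integral {0..a2} (\<lambda>\<theta>. G \<theta> - R n \<theta>) + integral {a2..pi} (\<lambda>\<theta>. G \<theta> - R n \<theta>) = integral {0..pi} (\<lambda>\<theta>. G \<theta> - R n \<theta>)"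
      using a i by (intro Henstock_Kurzweil_Integration.integral_combine) auto
    moreover have "integral {0..a1} (\<lambda>\<theta>. G \<theta> - R n \<theta>) + integral {a1..a2} (\<lambda>\<theta>. G \<theta> - R n \<theta>) = integral {0..a2} (\<lambda>\<theta>. G \<theta> - R n \<theta>)"
      using a i by (intro Henstock_Kurzweil_Integration.integral_combine) auto
    ultimately show ?thesis by simp
  qed
  also have "\<dots> \<le> W * (7506 / 1000 * z ^ 5 + 440 / 1000 * z ^ 6 + 192 / 100 * t * exp (- (164 / 1000 / t))
     + 632 / 100 * exp (- (413 / 1000 / t)))"
    using near mid far by (simp add: distrib_left)
  also have "\<dots> \<le> W * (1687 / 1000 * z ^ 4)"
    using W dominating_terms_small[OF z(1) z(2)[symmetric] t(2)] by (intro mult_left_mono) auto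
  finally have defect: "I - integral {0..pi} (R n) \<le> W * (1687 / 1000 * z ^ 4)" .
  have mass: "W * (555 / 1000 * z ^ 3) \<le> I"
  proof -
    \<comment> \<open>\<open>1 / s\<^sup>2\<close> is the bound for the second moment, so the modulus dominates a quarter ellipse on \<open>{0..s}\<close>\<close>
    define s where "s = sqrt (t ^ 3 / 2)"
    have s: "s > 0" "s\<^sup>2 = t ^ 3 / 2" using t by (auto simp: s_def)
    have "7071 / 10000 * z ^ 3 \<le> s"
    proof (rule power2_le_imp_le)
      show "(7071 / 10000 * z ^ 3)\<^sup>2 \<le> s\<^sup>2"
        unfolding s(2) using z by (simp add: zpow power_mult_distrib power_divide flip: power_mult)
    qed (use s in simp)
    have "s \<le> pi"
    proof (rule power2_le_imp_le)
      have "t ^ 3 \<le> 1 ^ 3" using t by (intro power_mono) auto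
      moreover have "1\<^sup>2 \<le> pi\<^sup>2" using pi_gt3 by (intro power_mono) auto
      ultimately show "s\<^sup>2 \<le> pi\<^sup>2" unfolding s(2) by simp
    qed simp
    have "W * (pi / 4 * s) = integral {0..s} (\<lambda>\<theta>. W * sqrt (1 - (\<theta> / s)\<^sup>2))"
      by (rule integral_unique[symmetric, OF has_integral_mult_right[OF integral_quarter_disc[OF s(1)]]])
    also have "\<dots> \<le> integral {0..s} G"
    proof (rule integral_le)
      show "(\<lambda>\<theta>. W * sqrt (1 - (\<theta> / s)\<^sup>2)) integrable_on {0..s}"
        using has_integral_mult_right[OF integral_quarter_disc[OF s(1)], of W] by (rule has_integral_integrable)
      show "G integrable_on {0..s}" by (rule intG)
      fix \<theta> assume \<theta>: "\<theta> \<in> {0..s}"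
      have "\<theta>\<^sup>2 * (\<Sum>k=1..M. (real k)\<^sup>2 * p ^ k) \<le> \<theta>\<^sup>2 * (2 / t ^ 3)"
        unfolding p_def by (intro mult_left_mono sum_second_moment_le t) auto
      also have "\<dots> = (\<theta> / s)\<^sup>2" unfolding power_divide s(2) by simp
      finally have le: "\<theta>\<^sup>2 * (\<Sum>k=1..M. (real k)\<^sup>2 * p ^ k) \<le> (\<theta> / s)\<^sup>2" .
      have "(\<theta> / s)\<^sup>2 \<le> 1\<^sup>2" using \<theta> s by (intro power_mono) auto
      then have one: "(\<theta> / s)\<^sup>2 \<le> 1" by simp
      have "W\<^sup>2 * (1 - (\<theta> / s)\<^sup>2) \<le> W\<^sup>2 * (1 - \<theta>\<^sup>2 * (\<Sum>k=1..M. (real k)\<^sup>2 * p ^ k))"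
        using le by (intro mult_left_mono) auto
      also have "\<dots> \<le> (G \<theta>)\<^sup>2"
        unfolding W_def G_def using p le one by (intro cmod_dp_poly_sq_ge) auto
      finally have "W\<^sup>2 * (1 - (\<theta> / s)\<^sup>2) \<le> (G \<theta>)\<^sup>2" .
      then have "(W * sqrt (1 - (\<theta> / s)\<^sup>2))\<^sup>2 \<le> (G \<theta>)\<^sup>2"
        using one by (simp add: power_mult_distrib)
      then show "W * sqrt (1 - (\<theta> / s)\<^sup>2) \<le> G \<theta>"
        by (rule power2_le_imp_le) (simp add: G_def)
    qed
    also have "\<dots> \<le> I"
      unfolding I_def using \<open>s \<le> pi\<close> intG by (intro integral_subset_le) (auto simp: G_def)
    finally have "W * (pi / 4 * s) \<le> I" .
    moreover have "555 / 1000 * z ^ 3 \<le> pi / 4 * s"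
    proof -
      have "785 / 1000 * (7071 / 10000 * z ^ 3) \<le> pi / 4 * s"
        using \<open>7071 / 10000 * z ^ 3 \<le> s\<close> pi_approx z by (intro mult_mono) auto
      moreover have "0 \<le> z ^ 3" using z by simp
      ultimately show ?thesis by linarith
    qed
    then have "W * (555 / 1000 * z ^ 3) \<le> W * (pi / 4 * s)" using W by (intro mult_left_mono) auto
    ultimately show ?thesis by linarith
  qed
  have zle: "z \<le> 1695 / 10000"
  proof (rule power2_le_imp_le)
    show "z\<^sup>2 \<le> (1695 / 10000)\<^sup>2" unfolding z(2) using t by (simp add: power2_eq_square)
  qed simp
  have "W * (1687 / 1000 * z ^ 4) \<le> 304 / 100 * z * (W * (555 / 1000 * z ^ 3))"
    using W z by (simp add: eval_nat_numeral)
  also have "\<dots> \<le> 304 / 100 * z * I" using mass z by (intro mult_left_mono) auto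
  finally have "(1 - 304 / 100 * z) * I \<le> integral {0..pi} (R n)" using defect by (simp add: algebra_simps)
  also have "\<dots> = pi * (real (q n) * p ^ n)" using M by (intro coeff) simp
  finally have A: "(1 - 304 / 100 * z) * I \<le> pi * (real (q n) * p ^ n)" .
  have "pi * (real (q (n + L)) * p ^ (n + L)) \<le> I"
    unfolding coeff[OF M, symmetric] I_def by (intro integral_le intG intR RG)
  then have "(1 - 304 / 100 * z) * (pi * (real (q (n + L)) * p ^ (n + L))) \<le> (1 - 304 / 100 * z) * I"
    using zle by (intro mult_left_mono) auto
  with A have "(pi * p ^ n) * ((1 - 304 / 100 * z) * (real (q (n + L)) * p ^ L)) \<le> (pi * p ^ n) * real (q n)"
    by (simp add: power_add algebra_simps)
  then have "(1 - 304 / 100 * z) * (real (q (n + L)) * p ^ L) \<le> real (q n)"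
    using p by (simp only: mult_le_cancel_left_pos[OF mult_pos_pos[OF pi_gt_zero zero_less_power[OF p(1)]]])
  moreover have "p ^ L = exp (- t * real L)" by (simp add: p_def mult.commute flip: exp_of_nat_mult)
  ultimately show ?thesis by (simp add: z_def)
qed

section \<open>A recurrence for distinct partitions\<close>

text \<open>
  For \<open>j = 0\<close> this is the sum. The weight on the largest element makes the counting functions for
  consecutive \<open>j\<close> satisfy the two-term recurrence that is used to tabulate \<open>q\<close>.
\<close>
definition max_weighted :: "nat \<Rightarrow> nat set \<Rightarrow> nat" where
  "max_weighted j S = \<Sum>S + (if S = {} then 0 else j * Max S)"

definition pos_sets :: "nat \<Rightarrow> nat \<Rightarrow> nat set set" where
  "pos_sets j n = {S. finite S \<and> 0 \<notin> S \<and> max_weighted j S = n}"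

lemma finite_pos_sets: "finite (pos_sets j n)"
proof (rule finite_subset)
  show "pos_sets j n \<subseteq> Pow {..n}"
  proof
    fix S assume "S \<in> pos_sets j n"
    then have S: "finite S" "\<Sum>S \<le> n" by (auto simp: pos_sets_def max_weighted_def)
    have "x \<le> n" if "x \<in> S" for x
      using member_le_sum[of x S "\<lambda>x. x"] S that by simp
    then show "S \<in> Pow {..n}" by auto
  qed
qed simp

definition raise_max :: "nat set \<Rightarrow> nat set" where
  "raise_max S = insert (Suc (Max S)) (S - {Max S})"

definition add_top :: "nat set \<Rightarrow> nat set" where
  "add_top S = insert (Suc (if S = {} then 0 else Max S)) S"

lemma raise_max_props:
  assumes "finite S" "S \<noteq> {}" "0 \<notin> S"
  shows "finite (raise_max S)" "0 \<notin> raise_max S" "raise_max S \<noteq> {}"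
    "Max (raise_max S) = Suc (Max S)" "raise_max S - {Suc (Max S)} = S - {Max S}" "Max S \<notin> raise_max S"
    "max_weighted j (raise_max S) = max_weighted j S + Suc j"
proof -
  have le: "x \<le> Max S" if "x \<in> S" for x using assms that by auto
  show "finite (raise_max S)" "0 \<notin> raise_max S" "raise_max S \<noteq> {}" "Max S \<notin> raise_max S"
    using assms by (auto simp: raise_max_def)
  show M: "Max (raise_max S) = Suc (Max S)"
    unfolding raise_max_def using assms le by (intro Max_eqI) (auto simp: le_SucI)
  have notin: "Suc (Max S) \<notin> S" using le[of "Suc (Max S)"] by auto
  then show "raise_max S - {Suc (Max S)} = S - {Max S}" by (auto simp: raise_max_def)
  have "\<Sum>(raise_max S) = Suc (Max S) + \<Sum>(S - {Max S})"
    unfolding raise_max_def using assms notin by (subst sum.insert) auto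
  moreover have "\<Sum>S = Max S + \<Sum>(S - {Max S})" using assms by (intro sum.remove) auto
  ultimately show "max_weighted j (raise_max S) = max_weighted j S + Suc j"
    using assms \<open>raise_max S \<noteq> {}\<close> by (simp add: max_weighted_def M)
qed

lemma add_top_props:
  assumes "finite S" "0 \<notin> S"
  shows "finite (add_top S)" "0 \<notin> add_top S" "add_top S \<noteq> {}"
    "Max (add_top S) = Suc (if S = {} then 0 else Max S)"
    "add_top S - {Max (add_top S)} = S"
    "max_weighted j (add_top S) = max_weighted (Suc j) S + Suc j"
proof -
  let ?m = "if S = {} then 0 else Max S"
  have le: "x \<le> ?m" if "x \<in> S" for x using assms that by auto
  show "finite (add_top S)" "0 \<notin> add_top S" "add_top S \<noteq> {}" using assms by (auto simp: add_top_def)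
  show M: "Max (add_top S) = Suc ?m"
  proof (rule Max_eqI)
    fix y assume "y \<in> add_top S"
    then show "y \<le> Suc ?m" using le unfolding add_top_def by (metis insertE le_SucI order_refl)
  qed (use assms in \<open>auto simp: add_top_def\<close>)
  have notin: "Suc ?m \<notin> S" using le Suc_n_not_le_n by blast
  then show "add_top S - {Max (add_top S)} = S"
    unfolding M unfolding add_top_def by (rule Diff_insert_absorb)
  have "\<Sum>(add_top S) = Suc ?m + \<Sum>S"
    unfolding add_top_def using assms notin by (subst sum.insert) auto
  then show "max_weighted j (add_top S) = max_weighted (Suc j) S + Suc j"
    using \<open>add_top S \<noteq> {}\<close> by (simp add: max_weighted_def M)
qed

text \<open>
  Let \<open>m\<close> be the largest element of \<open>S\<close>. If \<open>m - 1\<close> is a positive number outside \<open>S\<close>, then \<open>m\<close> can be lowered to \<open>m - 1\<close>;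
  otherwise deleting \<open>m\<close> leaves a set whose maximum is \<open>m - 1\<close> (or the empty set, if \<open>m = 1\<close>). Both
  operations decrease the weighted sum by \<open>Suc j\<close>, where in the second case the remaining set is
  measured with the weight \<open>Suc j\<close>.
\<close>
lemma pos_sets_nonempty_decomp:
  "{S \<in> pos_sets j (n + Suc j). S \<noteq> {}} =
     raise_max ` {S \<in> pos_sets j n. S \<noteq> {}} \<union> add_top ` pos_sets (Suc j) n" (is "?A = ?B \<union> ?C")
proof (intro equalityI subsetI)
  fix S assume "S \<in> ?A"
  then have S: "finite S" "0 \<notin> S" "S \<noteq> {}" "max_weighted j S = n + Suc j" by (auto simp: pos_sets_def)
  define T where "T = S - {Max S}"
  have T: "finite T" "0 \<notin> T" using S by (auto simp: T_def)
  have mS: "Max S \<in> S" using S by simp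
  then have m0: "Max S > 0" using S by (metis gr0I)
  show "S \<in> ?B \<union> ?C"
  proof (cases "Max S - 1 = 0 \<or> Max S - 1 \<in> S")
    case True
    have "(if T = {} then 0 else Max T) = Max S - 1"
    proof (cases "T = {}")
      case True': True
      then have "S \<subseteq> {Max S}" by (auto simp: T_def)
      with True True' m0 show ?thesis by auto
    next
      case False
      then obtain y where y: "y \<in> T" by auto
      then have "y < Max S" "y \<in> S" using S by (auto simp: T_def less_le)
      moreover have "y \<noteq> 0" using T(2) y by metis
      ultimately have "Max S - 1 \<in> S" using True by auto
      then have "Max S - 1 \<in> T" using m0 by (auto simp: T_def)
      moreover have "z \<le> Max S - 1" if "z \<in> T" for z
      proof -
        have "z \<le> Max S" "z \<noteq> Max S" using that S by (auto simp: T_def)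
        then show ?thesis by linarith
      qed
      ultimately have "Max T = Max S - 1" using T by (intro Max_eqI) auto
      with False show ?thesis by simp
    qed
    then have "add_top T = insert (Max S) T" using m0 by (simp add: add_top_def)
    then have eq: "add_top T = S" using mS by (auto simp: T_def)
    have "T \<in> pos_sets (Suc j) n"
      using add_top_props(6)[OF T, of j] S T unfolding eq by (simp add: pos_sets_def)
    with eq show ?thesis by blast
  next
    case False
    define U where "U = insert (Max S - 1) T"
    have U: "finite U" "0 \<notin> U" "U \<noteq> {}" using T False by (auto simp: U_def)
    have "z \<le> Max S - 1" if "z \<in> T" for z
    proof -
      have "z \<le> Max S" "z \<noteq> Max S" using that S by (auto simp: T_def)
      then show ?thesis by linarith
    qed
    then have MU: "Max U = Max S - 1" using T unfolding U_def by (intro Max_eqI) auto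
    have "Max S - 1 \<notin> T" using False by (auto simp: T_def)
    then have "raise_max U = insert (Max S) T" unfolding raise_max_def MU using m0 by (auto simp: U_def)
    then have eq: "raise_max U = S" using mS by (auto simp: T_def)
    have "U \<in> {S \<in> pos_sets j n. S \<noteq> {}}"
      using raise_max_props(7)[OF U(1,3,2), of j] S U unfolding eq by (simp add: pos_sets_def)
    with eq show ?thesis by blast
  qed
next
  fix S assume "S \<in> ?B \<union> ?C"
  then consider (raise) U where "S = raise_max U" "finite U" "U \<noteq> {}" "0 \<notin> U" "max_weighted j U = n"
    | (add) T where "S = add_top T" "finite T" "0 \<notin> T" "max_weighted (Suc j) T = n"
    by (auto simp: pos_sets_def)
  then show "S \<in> ?A"
  proof cases
    case raise
    then show ?thesis using raise_max_props[OF raise(2-4)] by (simp add: pos_sets_def)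
  next
    case add
    then show ?thesis using add_top_props[OF add(2,3)] by (simp add: pos_sets_def)
  qed
qed

definition weighted_count :: "nat \<Rightarrow> nat \<Rightarrow> nat" where "weighted_count j n = card (pos_sets j n)"
definition weighted_count_ne :: "nat \<Rightarrow> nat \<Rightarrow> nat" where "weighted_count_ne j n = card {S \<in> pos_sets j n. S \<noteq> {}}"

lemma q_eq_weighted_count: "q n = weighted_count 0 n"
proof -
  have "distinct_partitions n = pos_sets 0 n"
    by (auto simp: distinct_partitions_def pos_sets_def max_weighted_def)
  then show ?thesis by (simp add: q_def weighted_count_def)
qed

lemma weighted_count_eq: "weighted_count j n = weighted_count_ne j n + (if n = 0 then 1 else 0)"
proof -
  let ?A = "{S \<in> pos_sets j n. S \<noteq> {}}" and ?B = "{S \<in> pos_sets j n. S = {}}"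
  have "card (?A \<union> ?B) = card ?A + card ?B"
    using finite_pos_sets[of j n] by (intro card_Un_disjoint) auto
  moreover have "?A \<union> ?B = pos_sets j n" by auto
  moreover have "?B = (if n = 0 then {{}} else {})"
    by (auto simp: pos_sets_def max_weighted_def)
  ultimately show ?thesis by (simp add: weighted_count_def weighted_count_ne_def)
qed

lemma weighted_count_ne_eq_0: "n \<le> j \<Longrightarrow> weighted_count_ne j n = 0"
proof -
  assume n: "n \<le> j"
  have "max_weighted j S > n" if "finite S" "0 \<notin> S" "S \<noteq> {}" for S
  proof -
    have "Max S \<in> S" using that by simp
    then have "Max S \<ge> 1" using that by (metis One_nat_def Suc_leI gr0I)
    moreover have "Max S \<le> \<Sum>S" using member_le_sum[of "Max S" S "\<lambda>x. x"] that \<open>Max S \<in> S\<close> by simp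
    moreover have "j * 1 \<le> j * Max S" using calculation(1) by (intro mult_le_mono2)
    ultimately have "n < \<Sum>S + j * Max S" using n by linarith
    then show ?thesis using that by (simp add: max_weighted_def)
  qed
  then have "{S \<in> pos_sets j n. S \<noteq> {}} = {}" by (fastforce simp: pos_sets_def)
  then show ?thesis unfolding weighted_count_ne_def by (metis card.empty)
qed

lemma weighted_count_ne_rec: "weighted_count_ne j (n + Suc j) = weighted_count_ne j n + weighted_count (Suc j) n"
proof -
  let ?B = "{S \<in> pos_sets j n. S \<noteq> {}}" and ?C = "pos_sets (Suc j) n"
  have "inj_on raise_max ?B"
  proof (rule inj_onI)
    fix S T assume S: "S \<in> ?B" and T: "T \<in> ?B" and eq: "raise_max S = raise_max T"
    have S': "finite S" "S \<noteq> {}" "0 \<notin> S" and T': "finite T" "T \<noteq> {}" "0 \<notin> T" using S T by (auto simp: pos_sets_def)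
    have M: "Max S = Max T" using raise_max_props(4)[OF S'] raise_max_props(4)[OF T'] eq by simp
    have "S - {Max S} = T - {Max T}" using raise_max_props(5)[OF S'] raise_max_props(5)[OF T'] eq M by simp
    then have "insert (Max S) (S - {Max S}) = insert (Max T) (T - {Max T})" using M by simp
    then show "S = T" using S' T' Max_in by (simp add: insert_absorb)
  qed
  then have cB: "card (raise_max ` ?B) = card ?B" by (rule card_image)
  have "inj_on add_top ?C"
  proof (rule inj_onI)
    fix S T assume S: "S \<in> ?C" and T: "T \<in> ?C" and eq: "add_top S = add_top T"
    have S': "finite S" "0 \<notin> S" and T': "finite T" "0 \<notin> T" using S T by (auto simp: pos_sets_def)
    have "S = add_top T - {Max (add_top T)}" using add_top_props(5)[OF S', symmetric] unfolding eq .
    also have "\<dots> = T" by (rule add_top_props(5)[OF T'])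
    finally show "S = T" .
  qed
  then have cC: "card (add_top ` ?C) = card ?C" by (rule card_image)
  have disj: "raise_max ` ?B \<inter> add_top ` ?C = {}"
  proof (rule equals0I)
    fix X assume X: "X \<in> raise_max ` ?B \<inter> add_top ` ?C"
    from IntD1[OF X] obtain S where S: "S \<in> ?B" and XS: "X = raise_max S" by (rule imageE)
    from IntD2[OF X] obtain T where T: "T \<in> ?C" and XT: "X = add_top T" by (rule imageE)
    have eq: "raise_max S = add_top T" using XS XT by simp
    have S': "finite S" "S \<noteq> {}" "0 \<notin> S" and T': "finite T" "0 \<notin> T" using S T by (auto simp: pos_sets_def)
    have M: "Max S = (if T = {} then 0 else Max T)"
      using raise_max_props(4)[OF S'] add_top_props(4)[OF T'] eq by simp
    have "Max S \<in> S" using S' by simp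
    then have "Max S \<noteq> 0" using S' by metis
    with M have "T \<noteq> {}" "Max S = Max T" by (auto split: if_splits)
    then have "Max S \<in> add_top T" using T' by (simp add: add_top_def)
    with raise_max_props(6)[OF S'] eq show False by simp
  qed
  have "finite (raise_max ` ?B)" "finite (add_top ` ?C)" using finite_pos_sets by simp_all
  then have "card (raise_max ` ?B \<union> add_top ` ?C) = card ?B + card ?C"
    using disj by (subst card_Un_disjoint) (simp_all only: cB cC)
  then show ?thesis unfolding weighted_count_ne_def weighted_count_def pos_sets_nonempty_decomp .
qed

text \<open>
  Raising the largest part by one is injective on nonempty partitions; this is the first summand of
  the recurrence for \<open>j = 0\<close>.
\<close>
lemma q_mono_Suc: "q n \<le> q (Suc n)"
proof (cases n)
  case 0
  have "weighted_count_ne 0 1 = weighted_count_ne 0 0 + weighted_count 1 0" using weighted_count_ne_rec[of 0 0] by simp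
  then show ?thesis using 0 weighted_count_eq[of 0 0] weighted_count_eq[of 0 1] weighted_count_eq[of 1 0] weighted_count_ne_eq_0[of 0 0] by (simp add: q_eq_weighted_count)
next
  case (Suc m)
  then show ?thesis using weighted_count_ne_rec[of 0 n] weighted_count_eq[of 0 n] weighted_count_eq[of 0 "Suc n"] by (simp add: q_eq_weighted_count)
qed

lemma q_mono: "m \<le> n \<Longrightarrow> q m \<le> q n"
  using q_mono_Suc by (rule lift_Suc_mono_le)

section \<open>Tabulating the recurrence\<close>

text \<open>
  The recurrence is evaluated on lists, chunk by chunk. These list functions recurse
  structurally on lists, without numerical indices, so that the simplifier can evaluate them quickly.
\<close>
primrec add_prefix :: "int list \<Rightarrow> int list \<Rightarrow> int list" where
  "add_prefix [] ys = []"
| "add_prefix (x # xs) ys = (case ys of [] \<Rightarrow> [] | y # ys' \<Rightarrow> (x + y) # add_prefix xs ys')"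

primrec drop_prefix :: "int list \<Rightarrow> int list \<Rightarrow> int list" where
  "drop_prefix [] ys = ys"
| "drop_prefix (x # xs) ys = (case ys of [] \<Rightarrow> [] | y # ys' \<Rightarrow> drop_prefix xs ys')"

lemma drop_prefix_eq: "drop_prefix xs ys = drop (length xs) ys"
  by (induction xs arbitrary: ys) (auto split: list.split)

lemma add_prefix_eq: "add_prefix xs ys = map2 (+) xs ys"
  by (induction xs arbitrary: ys) (auto split: list.split)

lemma length_drop_prefix_less [termination_simp]: "length (drop_prefix d ps) < Suc (length ps)"
  by (simp add: drop_prefix_eq)

text \<open>
  Extends the values \<open>T a, ..., T (a + s - 1)\<close> of a function with \<open>T (n + s) = T n + f n\<close> by chunks of
  length \<open>s\<close>, the newest chunk first.
\<close>
fun stride_chunks :: "int list list \<Rightarrow> int list \<Rightarrow> int list list" where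
  "stride_chunks cs [] = cs"
| "stride_chunks [] (p # ps) = []"
| "stride_chunks ([] # cs) (p # ps) = []"
| "stride_chunks ((c # d) # cs) (p # ps) = stride_chunks (((c + p) # add_prefix d ps) # (c # d) # cs) (drop_prefix d ps)"

text \<open>
  The oldest chunk, at the end of the list, is left out: it is the carry from the previous segment.
\<close>
fun join_chunks :: "int list list \<Rightarrow> int list \<Rightarrow> int list" where
  "join_chunks [] ys = ys"
| "join_chunks [xs] ys = ys"
| "join_chunks (xs # xs' # xss) ys = join_chunks (xs' # xss) (xs @ ys)"

text \<open>
  A table is kept as a list of short segments: the cost of a rewrite step grows with the size of the
  terms involved, and short segments keep these small. The carry \<open>c\<close> holds the last \<open>s\<close> known values.
\<close>
fun stride_segments :: "int list \<Rightarrow> int list list \<Rightarrow> int list list" and stride_segments_step where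
  "stride_segments c [] = []"
| "stride_segments c (h # hs) = stride_segments_step c (join_chunks (stride_chunks [c] h) []) hs"
| "stride_segments_step c t hs = t # stride_segments (drop_prefix t (c @ t)) hs"

primrec set_head_one :: "int list \<Rightarrow> int list" where
  "set_head_one [] = []"
| "set_head_one (x # xs) = 1 # xs"

text \<open>
  One step turns a table of \<open>weighted_count (Suc j)\<close> into one of \<open>weighted_count j\<close>, where \<open>z\<close> consists of
  \<open>Suc j\<close> zeros; replacing the leading zero by one accounts for the empty set.
\<close>
primrec count_rows :: "int list list \<Rightarrow> int list list \<Rightarrow> int list list" where
  "count_rows [] h = h"
| "count_rows (z # zs) h = count_rows zs (set_head_one z # stride_segments z h)"

primrec nonempty_suffixes :: "int list \<Rightarrow> int list list" where
  "nonempty_suffixes [] = []"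
| "nonempty_suffixes (x # xs) = (x # xs) # nonempty_suffixes xs"

lemma join_chunks_append: "join_chunks xss ys = join_chunks xss [] @ ys"
proof (induction xss arbitrary: ys)
  case (Cons xs xss)
  show ?case
  proof (cases xss)
    case xss: (Cons x' xss')
    have "join_chunks (xs # xss) ys = join_chunks xss (xs @ ys)" "join_chunks (xs # xss) [] = join_chunks xss xs"
      unfolding xss by simp_all
    then show ?thesis using Cons.IH[of "xs @ ys"] Cons.IH[of xs] by (metis append.assoc)
  qed simp
qed simp

lemma join_chunks_Cons:
  assumes "cs \<noteq> []"
  shows "join_chunks (y # cs) [] = join_chunks cs [] @ y"
proof -
  obtain c cs' where "cs = c # cs'" using assms by (cases cs) auto
  then show ?thesis using join_chunks_append[of "c # cs'" y] by simp
qed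

lemma upt_append: "a \<le> b \<Longrightarrow> b \<le> c \<Longrightarrow> [a..<b] @ [b..<c] = [a..<c]"
  using upt_add_eq_append[of a b "c - b"] by simp

lemma map2_shift:
  assumes "\<And>n. T (n + s) = T n + (f n :: int)"
  shows "map2 (+) (map T [a..<a + l]) (map f [a..<b]) = map T [a + s..<min (a + l) b + s]"
proof (rule nth_equalityI)
  fix i assume i: "i < length (map2 (+) (map T [a..<a + l]) (map f [a..<b]))"
  then have "i < min (a + l) b + s - (a + s)" "i < l" "a + i < b" by auto
  then show "map2 (+) (map T [a..<a + l]) (map f [a..<b]) ! i = map T [a + s..<min (a + l) b + s] ! i"
    using assms[of "a + i"] i by (simp add: add_ac)
qed simp

lemma join_stride_chunks:
  assumes rec: "\<And>n. T (n + s) = T n + (f n :: int)" and s: "s > 0"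
  shows "join_chunks (stride_chunks (map T [a..<a + s] # cs) (map f [a..<b])) [] =
           join_chunks (map T [a..<a + s] # cs) [] @ map T [a + s..<b + s]"
proof (induction "b - a" arbitrary: a cs rule: less_induct)
  case less
  show ?case
  proof (cases "a < b")
    case False
    then show ?thesis by simp
  next
    case True
    let ?c = "map T [a..<a + s]" and ?p = "map f [a..<b]"
    obtain c d where cd: "?c = c # d" using s by (cases ?c) auto
    obtain p ps where p: "?p = p # ps" using True by (cases ?p) auto
    have "stride_chunks (?c # cs) ?p = stride_chunks (add_prefix ?c ?p # ?c # cs) (drop_prefix ?c ?p)"
      unfolding cd p by simp
    also have "add_prefix ?c ?p = map T [a + s..<min (a + s) b + s]"
      unfolding add_prefix_eq by (rule map2_shift) (rule rec)
    also have "drop_prefix ?c ?p = map f [a + s..<b]"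
      by (simp add: drop_prefix_eq drop_map)
    finally have step: "stride_chunks (?c # cs) ?p = stride_chunks (map T [a + s..<min (a + s) b + s] # ?c # cs) (map f [a + s..<b])" .
    show ?thesis
    proof (cases "a + s \<le> b")
      case True
      have "b - (a + s) < b - a" using \<open>a < b\<close> s by linarith
      note IH = less[OF this, of "?c # cs"]
      have m: "min (a + s) b = a + s" using True by simp
      have "map T [a + s..<a + s + s] @ map T [a + s + s..<b + s] = map T [a + s..<b + s]"
        using True by (simp add: upt_append flip: map_append)
      moreover have "join_chunks (map T [a + s..<a + s + s] # ?c # cs) [] = join_chunks (?c # cs) [] @ map T [a + s..<a + s + s]"
        by (rule join_chunks_Cons) simp
      ultimately show ?thesis unfolding step m IH by (simp only: append_assoc)
    next
      case False
      then have "min (a + s) b = b" by simp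
      moreover have "join_chunks (map T [a + s..<b + s] # ?c # cs) [] = join_chunks (?c # cs) [] @ map T [a + s..<b + s]"
        by (rule join_chunks_Cons) simp
      moreover have "[a + s..<b] = []" using False by simp
      ultimately show ?thesis unfolding step by (simp only: list.map stride_chunks.simps)
    qed
  qed
qed

lemma concat_stride_segments:
  assumes rec: "\<And>n. T (n + s) = T n + (f n :: int)" and s: "s > 0"
    and "a \<le> b" "concat hs = map f [a..<b]"
  shows "concat (stride_segments (map T [a..<a + s]) hs) = map T [a + s..<b + s]"
  using assms(3,4)
proof (induction hs arbitrary: a)
  case Nil
  then have "a = b" by auto
  then show ?case by simp
next
  case (Cons h hs)
  define l where "l = length h"
  have len: "length (map f [a..<b]) = l + length (concat hs)" unfolding Cons.prems(2)[symmetric] by (simp add: l_def)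
  then have l: "a + l \<le> b" using Cons.prems(1) by simp
  have "h @ concat hs = map f [a..<a + l] @ map f [a + l..<b]"
    using Cons.prems l by (simp add: upt_append flip: map_append)
  then have h: "h = map f [a..<a + l]" and hs: "concat hs = map f [a + l..<b]"
    by (auto simp: append_eq_append_conv l_def)
  have t: "join_chunks (stride_chunks [map T [a..<a + s]] h) [] = map T [a + s..<a + l + s]"
    unfolding h using join_stride_chunks[of T s f a "[]" "a + l", OF rec s] by simp
  have "map T [a..<a + s] @ map T [a + s..<a + l + s] = map T [a..<a + l + s]"
    by (simp add: upt_append flip: map_append)
  then have c: "drop_prefix (map T [a + s..<a + l + s]) (map T [a..<a + s] @ map T [a + s..<a + l + s]) = map T [a + l..<a + l + s]"
    by (simp add: drop_prefix_eq drop_map)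
  have "concat (stride_segments (map T [a..<a + s]) (h # hs)) =
      map T [a + s..<a + l + s] @ concat (stride_segments (map T [a + l..<a + l + s]) hs)"
    by (simp only: stride_segments.simps t stride_segments_step.simps c concat.simps)
  also have "\<dots> = map T [a + s..<a + l + s] @ map T [a + l + s..<b + s]"
    using Cons.IH[OF l hs] by simp
  also have "\<dots> = map T [a + s..<b + s]"
    using l by (simp add: upt_append flip: map_append)
  finally show ?case .
qed

lemma concat_count_rows:
  assumes "concat hs = map (\<lambda>n. int (weighted_count J n)) [0..<b]"
  shows "concat (count_rows (nonempty_suffixes (replicate J 0)) hs) = map (\<lambda>n. int (weighted_count 0 n)) [0..<b + \<Sum>{1..J}]"
  using assms
proof (induction J arbitrary: hs b)
  case 0
  then show ?case by simp
next
  case (Suc j)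
  let ?T = "\<lambda>n. int (weighted_count_ne j n)"
  let ?s = "Suc j"
  have z: "replicate ?s 0 = map ?T [0..<0 + ?s]"
    by (rule nth_equalityI) (auto simp: weighted_count_ne_eq_0 less_Suc_eq_le simp del: replicate_Suc upt_Suc)
  have rec: "?T (n + ?s) = ?T n + int (weighted_count ?s n)" for n by (simp only: weighted_count_ne_rec of_nat_add)
  have "concat (stride_segments (replicate ?s 0) hs) = map ?T [0 + ?s..<b + ?s]"
    unfolding z by (rule concat_stride_segments[OF rec _ _ Suc.prems]) auto
  also have "\<dots> = map (\<lambda>n. int (weighted_count j n)) [?s..<b + ?s]"
    by (auto simp: weighted_count_eq)
  finally have 1: "concat (stride_segments (replicate ?s 0) hs) = map (\<lambda>n. int (weighted_count j n)) [?s..<b + ?s]" .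
  have "set_head_one (replicate ?s 0) = map (\<lambda>n. int (weighted_count j n)) [0..<?s]"
  proof (rule nth_equalityI)
    fix i assume "i < length (set_head_one (replicate ?s 0))"
    then have "i < ?s" by simp
    then show "set_head_one (replicate ?s 0) ! i = map (\<lambda>n. int (weighted_count j n)) [0..<?s] ! i"
      by (cases i) (auto simp: weighted_count_eq weighted_count_ne_eq_0 simp del: upt_Suc)
  qed simp
  with 1 have "concat (set_head_one (replicate ?s 0) # stride_segments (replicate ?s 0) hs) = map (\<lambda>n. int (weighted_count j n)) ([0..<?s] @ [?s..<b + ?s])"
    by (simp only: concat.simps map_append)
  also have "[0..<?s] @ [?s..<b + ?s] = [0..<b + ?s]" using upt_add_eq_append[of 0 ?s b] by (simp add: add.commute)
  finally have "concat (set_head_one (replicate ?s 0) # stride_segments (replicate ?s 0) hs) = map (\<lambda>n. int (weighted_count j n)) [0..<b + ?s]" .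
  note IH = Suc.IH[OF this]
  have "b + ?s + \<Sum>{1..j} = b + \<Sum>{1..?s}" by simp
  with IH show ?case unfolding replicate_Suc nonempty_suffixes.simps count_rows.simps by argo
qed

text \<open>
  Walks along a table with \<open>x\<close> the entry of index \<open>n\<close>. The number \<open>w\<close> is the running integer upper
  approximation of \<open>sqrt (973 / 50 * (n + 1))\<close>, a slight upper bound for four times the reciprocal of the
  saddle point; multiplying by the small number \<open>w\<close> avoids squaring the large table entries.
\<close>
fun ratio_check :: "int \<Rightarrow> int \<Rightarrow> int \<Rightarrow> int list \<Rightarrow> int list list \<Rightarrow> bool" and ratio_check_step where
  "ratio_check n w x [] [] = True"
| "ratio_check n w x [] (ys # yss) = ratio_check n w x ys yss"
| "ratio_check n w x (y # ys) yss = ratio_check_step n (if 973 * (n + 1) \<le> 50 * w * w then w else w + 1) x y ys yss"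
| "ratio_check_step n w x y ys yss =
    (973 * (n + 1) \<le> 50 * w * w \<and> (n < 27 \<or> w * (y - x) \<le> 4 * x) \<and> ratio_check (n + 1) w y ys yss)"

primrec table_check :: "int list list \<Rightarrow> bool" where
  "table_check [] = False"
| "table_check (s # ss) = (s = [1] \<and> ratio_check 0 24 1 [] ss)"

lemma ratio_check_sound:
  assumes "ratio_check (int n) w (g n) ys yss" "ys @ concat yss = map g [Suc n..<N]" "w \<ge> 0"
    and "n \<le> m" "Suc m < N" "27 \<le> m"
  shows "\<exists>w'. w' \<ge> 0 \<and> 973 * (int m + 1) \<le> 50 * w' * w' \<and> w' * (g (Suc m) - g m) \<le> 4 * g m"
proof -
  have "\<exists>w'. w' \<ge> 0 \<and> 973 * (int m + 1) \<le> 50 * w' * w' \<and> w' * (g (Suc m) - g m) \<le> 4 * g m"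
    if "ratio_check n' w x ys yss" "n' = int n" "x = g n" "ys @ concat yss = map g [Suc n..<N]" "w \<ge> 0" "n \<le> m"
    for n' x w ys yss n
    using that
  proof (induction "length ys + length (concat yss) + length yss" arbitrary: n' x w ys yss n rule: less_induct)
    case less
    show ?case
    proof (cases ys)
      case Nil
      show ?thesis
      proof (cases yss)
        case Nil': Nil
        with Nil less.prems(4) have "N \<le> Suc n" by auto
        with less.prems(6) assms(5) show ?thesis by simp
      next
        case (Cons zs zss)
        have "length zs + length (concat zss) + length zss < length ys + length (concat yss) + length yss"
          using Nil Cons by simp
        from less.hyps[OF this] less.prems Nil Cons show ?thesis by auto
      qed
    next
      case (Cons y ys')
      define v where "v = (if 973 * (n' + 1) \<le> 50 * w * w then w else w + 1)"
      have v0: "v \<ge> 0" using less.prems(5) by (simp add: v_def)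
      have N: "Suc n < N" using less.prems(4) Cons by (cases "Suc n < N") auto
      have "y # (ys' @ concat yss) = g (Suc n) # map g [Suc (Suc n)..<N]"
        using less.prems(4) Cons N by (simp add: upt_conv_Cons)
      then have y: "y = g (Suc n)" and rest: "ys' @ concat yss = map g [Suc (Suc n)..<N]" by auto
      have c: "973 * (n' + 1) \<le> 50 * v * v" "n' < 27 \<or> v * (y - x) \<le> 4 * x" "ratio_check (n' + 1) v y ys' yss"
      proof -
        have "ratio_check_step n' v x y ys' yss"
          using less.prems(1) unfolding Cons ratio_check.simps v_def[symmetric] .
        then show "973 * (n' + 1) \<le> 50 * v * v" "n' < 27 \<or> v * (y - x) \<le> 4 * x" "ratio_check (n' + 1) v y ys' yss"
          by (simp_all only: ratio_check_step.simps)
      qed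
      show ?thesis
      proof (cases "n = m")
        case True
        with c v0 y less.prems(2,3) assms(6) show ?thesis by (intro exI[of _ v]) auto
      next
        case False
        then show ?thesis
          using Cons less.prems(2,6) c(3) y rest v0
          by (intro less.hyps[of ys' yss "n' + 1" v y "Suc n"]) auto
      qed
    qed
  qed
  with assms show ?thesis by blast
qed

text \<open>
  The only large computation. For \<open>n \<le> 10\<close> the function \<open>weighted_count 44\<close> counts nothing but the empty
  set at \<open>n = 0\<close>; forty-four steps of the recurrence lead from there to \<open>q 0, ..., q 1000\<close>, since
  \<open>11 + (1 + ... + 44) = 1001\<close>.
\<close>
lemma distinct_partition_table:
  "table_check (count_rows (nonempty_suffixes (replicate 44 0)) [[1,0,0,0,0,0,0,0,0,0,0]])"
  by code_simp

lemma q_ratio_table: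
  assumes "27 \<le> m" "m < 1000"
  shows "\<exists>w::int. w \<ge> 0 \<and> 973 * (int m + 1) \<le> 50 * w * w \<and> w * (int (q (Suc m)) - int (q m)) \<le> 4 * int (q m)"
proof -
  let ?init = "[[1,0,0,0,0,0,0,0,0,0,0]] :: int list list"
  let ?g = "\<lambda>n. int (weighted_count 0 n)"
  have init: "concat ?init = map (\<lambda>n. int (weighted_count 44 n)) [0..<11]"
  proof -
    have "map (\<lambda>n. int (weighted_count 44 n)) [Suc 0..<11] = map (\<lambda>_. 0) [Suc 0..<11]"
      by (rule map_cong) (auto simp: weighted_count_eq weighted_count_ne_eq_0)
    also have "\<dots> = replicate 10 0" by (simp add: map_replicate_const)
    finally have "map (\<lambda>n. int (weighted_count 44 n)) (0 # [Suc 0..<11]) = 1 # replicate 10 0"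
      by (simp add: weighted_count_eq weighted_count_ne_eq_0)
    moreover have "[0..<11::nat] = 0 # [Suc 0..<11]" by (rule upt_conv_Cons) simp
    moreover have "concat ?init = 1 # replicate 10 0" by (simp add: numeral_eq_Suc)
    ultimately show ?thesis by simp
  qed
  have tab: "concat (count_rows (nonempty_suffixes (replicate 44 0)) ?init) = map ?g [0..<1001]"
  proof -
    have len: "11 + \<Sum>{1..44::nat} = 1001" by (simp add: Sum_Icc_nat)
    from concat_count_rows[OF init] show ?thesis unfolding len .
  qed
  define R where "R = count_rows (nonempty_suffixes (replicate 44 0)) ?init"
  have "table_check R" unfolding R_def by (rule distinct_partition_table)
  then obtain ss where R: "R = [1] # ss" "ratio_check 0 24 1 [] ss" by (cases R) auto
  have "[0..<1001::nat] = 0 # [Suc 0..<1001]" by (rule upt_conv_Cons) simp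
  then have "1 # concat ss = ?g 0 # map ?g [Suc 0..<1001]"
    using tab unfolding R_def[symmetric] R(1) by (simp only: concat.simps list.map append.simps)
  then have "concat ss = map ?g [Suc 0..<1001]" and g0: "?g 0 = 1" by (simp_all only: list.inject)
  then have "ratio_check (int 0) 24 (?g 0) [] ss" "[] @ concat ss = map ?g [Suc 0..<1001]"
    using R(2) by (simp_all only: of_nat_0 append.simps)
  from ratio_check_sound[OF this, of m] assms show ?thesis by (simp only: q_eq_weighted_count)
qed

section \<open>Comparison of shifted values\<close>

text \<open>
  The saddle point of the leading asymptotics \<open>pi * sqrt ((n + 1 / 24) / 3)\<close> of \<open>ln (q n)\<close>, that is, its
  derivative with respect to \<open>n\<close>.
\<close>
definition saddle :: "nat \<Rightarrow> real" where
  "saddle n = pi / (2 * sqrt (3 * (real n + 1 / 24)))"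

text \<open>
  The conditions imposed by \<open>N_A\<close> and \<open>N_B\<close> say that \<open>(2 + \<epsilon>) / \<epsilon> * slack (n + L)\<close> is at most
  \<open>1 / A + 1 / B\<close>: the coefficients \<open>1.76\<close> and \<open>1.1\<close> are slightly below the fourth root of
  \<open>910787328 / (10000 * pi ^ 8)\<close> and below \<open>sqrt 12 / pi\<close>.
\<close>
definition slack :: "nat \<Rightarrow> real" where
  "slack m = 176 / 100 / sqrt (sqrt (real m + 1 / 24)) + 110 / 100 / sqrt (real m + 1 / 24)"

lemma saddle_pos: "saddle n > 0" by (simp add: saddle_def add_pos_pos)

lemma saddle_sq: "(saddle n)\<^sup>2 = pi\<^sup>2 / (12 * (real n + 1 / 24))"
  by (simp add: saddle_def power_divide power_mult_distrib)

lemma saddle_antimono: "m \<le> n \<Longrightarrow> saddle n \<le> saddle m"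
  unfolding saddle_def by (intro divide_left_mono mult_left_mono mult_pos_pos) auto

lemma slack_pos: "slack m > 0" unfolding slack_def by (intro add_pos_pos divide_pos_pos) auto

text \<open>
  The relative loss \<open>304 / 100 * sqrt (saddle n)\<close> of the saddle point estimate is affordable, because
  \<open>slack n\<close> itself is at least \<open>1.848 * sqrt (saddle n)\<close>. Passing from \<open>n\<close> to \<open>n + L\<close> shrinks the slack by at
  most the factor \<open>s = 1 / (1 + L / (n + 1 / 24))\<close>, and the growth of \<open>exp (saddle n * L)\<close> more than
  compensates for it.
\<close>
lemma slack_lower_bound:
  assumes n: "n \<ge> 1000"
  shows "304 / 100 * sqrt (saddle n) * (1 + slack (n + L)) \<le> slack (n + L) * (1 + exp (saddle n * real L))"
proof -
  define t z where "t = saddle n" and "z = sqrt t"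
  define v where "v = real n + 1 / 24"
  have v: "v \<ge> 1000" using n by (simp add: v_def)
  have t: "t > 0" "t\<^sup>2 = pi\<^sup>2 / (12 * v)" using saddle_pos saddle_sq by (auto simp: t_def v_def)
  have z: "z > 0" "z\<^sup>2 = t" using t by (auto simp: z_def)
  have pi2: "98 / 10 \<le> pi\<^sup>2" "pi\<^sup>2 \<le> 98697 / 10000"
    using power_mono[of "314159/100000" pi 2] power_mono[of pi "31416/10000" 2] pi_approx by (auto simp: power2_eq_square)
  have tv: "t\<^sup>2 * v = pi\<^sup>2 / 12" using t v by simp
  have t_le: "t \<le> 287 / 10000"
  proof (rule power2_le_imp_le)
    have "t\<^sup>2 * 1000 \<le> t\<^sup>2 * v" using v by (intro mult_left_mono) auto
    then show "t\<^sup>2 \<le> (287 / 10000)\<^sup>2" using tv pi2 by (simp add: power2_eq_square)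
  qed simp
  have zle: "z \<le> 1695 / 10000"
  proof (rule power2_le_imp_le)
    show "z\<^sup>2 \<le> (1695 / 10000)\<^sup>2" unfolding z(2) using t_le by (simp add: power2_eq_square)
  qed simp
  define s where "s = 1 / (1 + real L / v)"
  have u: "1 + real L / v \<ge> 1" using v by simp
  then have s: "0 < s" "s \<le> 1" by (simp_all add: s_def)
  define v' where "v' = v / s"
  have "v' = v * (1 + real L / v)" by (simp add: v'_def s_def)
  also have "\<dots> = v + real L" using v by (simp add: distrib_left)
  finally have v': "v' = real (n + L) + 1 / 24" by (simp add: v_def)
  have sq1: "sqrt v' \<le> sqrt v / s"
  proof (rule real_le_lsqrt)
    have "v / s \<le> v / s\<^sup>2" using s v by (intro divide_left_mono) (auto simp: power2_eq_square mult_le_one)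
    then show "v' \<le> (sqrt v / s)\<^sup>2" using v by (simp add: v'_def power_divide)
  qed (use v s in auto)
  have sq2: "sqrt (sqrt v') \<le> sqrt (sqrt v) / s"
  proof (rule real_le_lsqrt)
    have "sqrt v / s \<le> sqrt v / s\<^sup>2" using s v by (intro divide_left_mono) (auto simp: power2_eq_square mult_le_one)
    then show "sqrt v' \<le> (sqrt (sqrt v) / s)\<^sup>2" using sq1 v by (simp add: power_divide)
  qed (use v s in auto)
  have y2: "11026 / 10000 * t \<le> 1 / sqrt v"
  proof (rule power2_le_imp_le)
    have "(11026 / 10000)\<^sup>2 * (pi\<^sup>2 / 12) / v \<le> 1 / v"
      using v pi2 by (intro divide_right_mono) (auto simp: power2_eq_square)
    then show "(11026 / 10000 * t)\<^sup>2 \<le> (1 / sqrt v)\<^sup>2"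
      using v t by (simp add: power_mult_distrib power_divide)
  qed (use v in simp)
  have y1: "105 / 100 * z \<le> 1 / sqrt (sqrt v)"
  proof (rule power2_le_imp_le)
    have "(105 / 100)\<^sup>2 * t \<le> 11026 / 10000 * t" using t by (intro mult_right_mono) (auto simp: power2_eq_square)
    also note y2
    finally show "(105 / 100 * z)\<^sup>2 \<le> (1 / sqrt (sqrt v))\<^sup>2"
      using v z by (simp add: power_mult_distrib power_divide)
  qed (use v in simp)
  define b where "b = 1848 / 1000 * z + 121 / 100 * z\<^sup>2"
  define a where "a = slack (n + L)"
  have b0: "b > 0" using z by (auto simp: b_def intro!: add_pos_pos)
  have a: "s * b \<le> a"
  proof -
    have "s * (105 / 100 * z) \<le> s * (1 / sqrt (sqrt v))" using y1 s by (intro mult_left_mono) auto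
    also have "\<dots> = 1 / (sqrt (sqrt v) / s)" using s by simp
    also have "\<dots> \<le> 1 / sqrt (sqrt v')" using sq2 v s by (intro divide_left_mono mult_pos_pos) (auto simp: v'_def)
    finally have 1: "s * (105 / 100 * z) \<le> 1 / sqrt (sqrt v')" .
    have "s * (11026 / 10000 * t) \<le> s * (1 / sqrt v)" using y2 s by (intro mult_left_mono) auto
    also have "\<dots> = 1 / (sqrt v / s)" using s by simp
    also have "\<dots> \<le> 1 / sqrt v'" using sq1 v s by (intro divide_left_mono mult_pos_pos) (auto simp: v'_def)
    finally have 2: "s * (11026 / 10000 * t) \<le> 1 / sqrt v'" .
    have "s * b \<le> 176 / 100 * (s * (105 / 100 * z)) + 110 / 100 * (s * (11026 / 10000 * t))"
    proof -
      have "b \<le> 176 / 100 * (105 / 100 * z) + 110 / 100 * (11026 / 10000 * t)"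
        using z t by (simp add: b_def)
      then have "s * b \<le> s * (176 / 100 * (105 / 100 * z) + 110 / 100 * (11026 / 10000 * t))" using s by (intro mult_left_mono) auto
      then show ?thesis by (simp add: algebra_simps)
    qed
    also have "\<dots> \<le> 176 / 100 * (1 / sqrt (sqrt v')) + 110 / 100 * (1 / sqrt v')"
      using 1 2 by (intro add_mono mult_left_mono) auto
    also have "\<dots> = a" unfolding a_def slack_def v' by simp
    finally show ?thesis .
  qed
  define R where "R = exp (t * real L)"
  have R: "2 \<le> s * (1 + R)"
  proof -
    have "2 / v \<le> t"
    proof -
      have "t * (t * 24 / pi\<^sup>2) \<le> t * 1"
        using t t_le pi2 by (intro mult_left_mono) (auto simp: divide_simps)
      moreover have "2 / v = t * (t * 24 / pi\<^sup>2)"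
        using tv v by (simp add: divide_simps power2_eq_square)
      ultimately show ?thesis by simp
    qed
    then have "real L * (2 / v) \<le> real L * t" by (intro mult_left_mono) auto
    then have "2 * (1 + real L / v) \<le> 1 + (1 + t * real L)" by (simp add: mult_ac)
    also have "\<dots> \<le> 1 + R" unfolding R_def by (intro add_left_mono exp_ge_add_one_self)
    finally have "s * (2 * (1 + real L / v)) \<le> s * (1 + R)" using s by (intro mult_left_mono) auto
    moreover have "s * (1 + real L / v) = 1" using u by (simp add: s_def)
    moreover have "s * (2 * (1 + real L / v)) = 2 * (s * (1 + real L / v))" by (rule mult.left_commute)
    ultimately have "2 * 1 \<le> s * (1 + R)" by (simp only:)
    then show ?thesis by (simp only: mult_1_right)
  qed
  have R2: "R \<ge> 1" using t by (simp add: R_def)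
  define c where "c = 304 / 100 * z"
  have c: "0 < c" "c \<le> 1" using z zle by (auto simp: c_def)
  have "c \<le> b * (2 - c)"
  proof -
    have "3198 / 1000 * z + 3679 / 1000 * z\<^sup>2 \<le> 656 / 1000" using zle t_le z by simp
    then have "z * (3198 / 1000 * z + 3679 / 1000 * z\<^sup>2) \<le> z * (656 / 1000)" using z by (intro mult_left_mono) auto
    then have "3198 / 1000 * z\<^sup>2 + 3679 / 1000 * z ^ 3 \<le> 656 / 1000 * z"
      by (simp add: eval_nat_numeral algebra_simps)
    moreover have "b * (2 - c) = 3696 / 1000 * z - 319792 / 100000 * z\<^sup>2 - 36784 / 10000 * z ^ 3"
      by (simp add: b_def c_def eval_nat_numeral field_simps)
    moreover have "0 \<le> z\<^sup>2" "0 \<le> z ^ 3" using z by auto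
    ultimately show ?thesis unfolding c_def by linarith
  qed
  also have "b * (2 - c) \<le> b * (s * (1 + R)) - s * b * c"
  proof -
    have "b * 2 \<le> b * (s * (1 + R))" using R b0 by (intro mult_left_mono) auto
    moreover have "s * (b * c) \<le> 1 * (b * c)" using s b0 c by (intro mult_right_mono) auto
    ultimately show ?thesis by (simp add: algebra_simps)
  qed
  also have "\<dots> = s * b * (1 + R - c)" by (simp add: algebra_simps)
  also have "\<dots> \<le> a * (1 + R - c)" using a R2 c by (intro mult_right_mono) auto
  finally have "c * (1 + a) \<le> a * (1 + R)" by (simp add: algebra_simps)
  then show ?thesis by (simp add: c_def a_def R_def t_def z_def)
qed

lemma q_shift_bound_large:
  assumes n: "n \<ge> 1000"
  shows "(1 - exp (saddle n * real L) * slack (n + L)) * real (q (n + L)) \<le>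
         exp (saddle n * real L) * (1 + slack (n + L)) * real (q n)"
proof -
  define R a Q where "R = exp (saddle n * real L)" and "a = slack (n + L)" and "Q = real (q (n + L))"
  have R: "R > 0" and a: "a > 0" and Q: "Q \<ge> 0" by (auto simp: R_def a_def Q_def slack_pos)
  have v: "real n + 1 / 24 > 0" by simp
  have t: "0 < saddle n" "saddle n \<le> 287 / 10000"
  proof -
    show "saddle n \<le> 287 / 10000"
    proof (rule power2_le_imp_le)
      have "pi\<^sup>2 \<le> (31416 / 10000)\<^sup>2" using pi_approx by (intro power_mono) auto
      then have "pi\<^sup>2 \<le> (287 / 10000)\<^sup>2 * (12 * (real n + 1 / 24))" using n by (simp add: power2_eq_square)
      then show "(saddle n)\<^sup>2 \<le> (287 / 10000)\<^sup>2"
        unfolding saddle_sq using v by (simp add: pos_divide_le_eq)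
    qed simp
  qed (rule saddle_pos)
  have eq: "pi\<^sup>2 / (12 * (saddle n)\<^sup>2) = real n + 1 / 24" unfolding saddle_sq by simp
  define c where "c = 304 / 100 * sqrt (saddle n)"
  have shift: "(1 - c) * (Q * exp (- saddle n * real L)) \<le> real (q n)"
    unfolding c_def Q_def by (rule q_shift_bound_saddle[OF t eq])
  have "exp (- saddle n * real L) = 1 / R" by (simp add: R_def exp_minus inverse_eq_divide)
  with shift have "((1 - c) * Q) / R \<le> real (q n)" by (simp only: times_divide_eq_right mult_1_right mult.assoc)
  then have "(1 - c) * Q \<le> R * real (q n)" using R by (simp only: pos_divide_le_eq mult.commute[of R])
  then have 1: "(1 + a) * ((1 - c) * Q) \<le> (1 + a) * (R * real (q n))" using a by (intro mult_left_mono) auto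
  have "c * (1 + a) \<le> a * (1 + R)" unfolding c_def a_def R_def by (rule slack_lower_bound[OF n])
  then have "1 - R * a \<le> (1 + a) * (1 - c)" by (simp add: algebra_simps)
  then have "(1 - R * a) * Q \<le> (1 + a) * (1 - c) * Q" using Q by (rule mult_right_mono)
  with 1 show ?thesis by (simp add: R_def a_def Q_def mult_ac)
qed

text \<open>
  For small \<open>n\<close> the ratio of consecutive values is bounded by the table: \<open>q (Suc m) / q m \<le> 1 + 4 / w\<close>,
  and \<open>4 / w\<close> does not exceed the saddle point.
\<close>
lemma q_Suc_le_exp_saddle:
  assumes "27 \<le> m" "m < 1000"
  shows "real (q (Suc m)) \<le> exp (saddle m) * real (q m)"
proof -
  obtain w :: int where w: "w \<ge> 0" "973 * (int m + 1) \<le> 50 * w * w" "w * (int (q (Suc m)) - int (q m)) \<le> 4 * int (q m)"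
    using q_ratio_table[OF assms] by blast
  define W where "W = real_of_int w"
  have "real_of_int (973 * (int m + 1)) \<le> real_of_int (50 * w * w)" using w(2) by (simp only: of_int_le_iff)
  then have W2: "973 * (real m + 1) \<le> 50 * W\<^sup>2" by (simp add: W_def power2_eq_square)
  then have "W\<^sup>2 > 0" by (simp add: power2_eq_square)
  then have W: "W > 0" using w(1) by (auto simp: W_def)
  have "real_of_int (w * (int (q (Suc m)) - int (q m))) \<le> real_of_int (4 * int (q m))" using w(3) by (simp only: of_int_le_iff)
  then have "W * (real (q (Suc m)) - real (q m)) \<le> 4 * real (q m)" by (simp add: W_def)
  then have "real (q (Suc m)) \<le> (1 + 4 / W) * real (q m)" using W by (simp add: field_simps)
  also have "\<dots> \<le> exp (4 / W) * real (q m)" by (intro mult_right_mono exp_ge_add_one_self) auto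
  also have "\<dots> \<le> exp (saddle m) * real (q m)"
  proof -
    have "4 / W \<le> saddle m"
    proof (rule power2_le_imp_le)
      have "(314159 / 100000)\<^sup>2 \<le> pi\<^sup>2" using pi_approx by (intro power_mono) auto
      then have p: "98695 / 10000 \<le> pi\<^sup>2" by (simp add: power2_eq_square)
      have "16 * (12 * (real m + 1 / 24)) \<le> 192 * (real m + 1)" by simp
      also have "\<dots> \<le> 192 * (50 * W\<^sup>2 / 973)" using W2 by simp
      also have "\<dots> \<le> pi\<^sup>2 * W\<^sup>2"
      proof -
        have "98695 / 10000 * W\<^sup>2 \<le> pi\<^sup>2 * W\<^sup>2" by (rule mult_right_mono[OF p]) simp
        moreover have "0 \<le> W\<^sup>2" by simp
        ultimately show ?thesis by linarith
      qed
      finally have "16 / W\<^sup>2 \<le> pi\<^sup>2 / (12 * (real m + 1 / 24))"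
        using W by (simp add: frac_le_eq pos_divide_le_eq pos_le_divide_eq mult_ac)
      then show "(4 / W)\<^sup>2 \<le> (saddle m)\<^sup>2" unfolding saddle_sq by (simp add: power_divide)
    qed (use saddle_pos[of m] in simp)
    then show ?thesis by (intro mult_right_mono) auto
  qed
  finally show ?thesis .
qed

text \<open>
  Downward induction from \<open>n = 1000\<close>. The slack depends on \<open>n + L\<close> only, so trading one unit of \<open>L\<close> for
  one unit of \<open>n\<close> leaves it unchanged, while the exponential absorbs the ratio \<open>q (Suc n) / q n\<close>.
\<close>
lemma q_shift_bound:
  assumes "n \<ge> 27"
  shows "(1 - exp (saddle n * real L) * slack (n + L)) * real (q (n + L)) \<le>
         exp (saddle n * real L) * (1 + slack (n + L)) * real (q n)"
proof (cases "n \<ge> 1000")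
  case True
  then show ?thesis by (rule q_shift_bound_large)
next
  case False
  then have "n \<le> 1000" by simp
  then show ?thesis using assms
  proof (induction n arbitrary: L rule: inc_induct)
    case base
    show ?case by (rule q_shift_bound_large) simp
  next
    case (step n)
    note a = slack_pos[of "n + L"]
    show ?case
    proof (cases L)
      case 0
      then show ?thesis using a mult_right_mono[of "1 - slack n" "1 + slack n" "real (q n)"] by simp
    next
      case (Suc K)
      let ?a = "slack (n + L)" and ?Q = "real (q (n + L))"
      let ?R = "exp (saddle n * real L)" and ?R' = "exp (saddle (Suc n) * real K)"
      have RR: "exp (saddle n) * ?R' \<le> ?R"
      proof -
        have "saddle (Suc n) * real K \<le> saddle n * real K" using saddle_antimono[of n "Suc n"] by (intro mult_right_mono) auto
        then have "exp (saddle n + saddle (Suc n) * real K) \<le> exp (saddle n * real L)" using Suc by (simp add: algebra_simps)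
        then show ?thesis by (simp add: exp_add)
      qed
      have "1 * ?R' \<le> exp (saddle n) * ?R'" using saddle_pos[of n] by (intro mult_right_mono) auto
      with RR have "?R' \<le> ?R" by linarith
      then have "?R' * ?a \<le> ?R * ?a" using a by (intro mult_right_mono) auto
      then have "(1 - ?R * ?a) * ?Q \<le> (1 - ?R' * ?a) * ?Q" by (intro mult_right_mono) auto
      also have "\<dots> \<le> ?R' * (1 + ?a) * real (q (Suc n))"
        using step.IH[of K] step.prems Suc by simp
      also have "\<dots> \<le> ?R' * (1 + ?a) * (exp (saddle n) * real (q n))"
        using q_Suc_le_exp_saddle[of n] step.hyps step.prems a by (intro mult_left_mono) auto
      also have "\<dots> = (exp (saddle n) * ?R') * ((1 + ?a) * real (q n))" by (simp add: mult_ac)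
      also have "\<dots> \<le> ?R * ((1 + ?a) * real (q n))" using RR a by (intro mult_right_mono) auto
      finally show ?thesis by (simp add: mult_ac)
    qed
  qed
qed

text \<open>
  Write \<open>R\<close> for \<open>exp (saddle n * L)\<close> and \<open>a\<close> for the slack. \<open>N_D\<close> gives \<open>R * (1 + \<epsilon> * D) < 1 + \<epsilon>\<close>, and \<open>N_A\<close>, \<open>N_B\<close> give
  \<open>(2 + \<epsilon>) * a \<le> \<epsilon> * D\<close>. Together these say \<open>R * (1 + a) < (1 + \<epsilon>) * (1 - R * a)\<close>, which is just
  what is needed to divide the bound for \<open>(1 - R * a) * q (n + L)\<close> by \<open>1 - R * a\<close>.
\<close>
lemma q_shift_le:
  fixes A B C \<epsilon> :: real and n L :: nat
  assumes ABC: "A > 0" "B > 0" "C > 0" "1 / A + 1 / B + 1 / C < 1" and \<epsilon>: "\<epsilon> > 0"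
    and n: "real n > N_ABC A B C \<epsilon> L"
  shows "real (q (n + L)) \<le> (1 + \<epsilon>) * real (q n)"
proof (cases "L = 0")
  case True
  then show ?thesis using \<epsilon> mult_right_mono[of 1 "1 + \<epsilon>" "real (q n)"] by simp
next
  case False
  define D where "D = 1 / A + 1 / B + 1 / C"
  have nA: "N_A A \<epsilon> L < real n" and nB: "N_B B \<epsilon> L < real n"
    and nD: "N_D D \<epsilon> L < real n" and n26: "26 < real n"
    using n unfolding N_ABC_def D_def[symmetric] by auto
  have n27: "n \<ge> 27" using n26 by simp
  define v' where "v' = real (n + L) + 1 / 24"
  have v': "v' > 0" by (simp add: v'_def)
  have pi_up: "pi \<le> 31416 / 10000" using pi_approx by simp
  have frac: "k / w * P \<le> e / X" if "k * P * X \<le> e * w" "X > 0" "w > 0" for k w P e X :: real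
    using that by (simp add: divide_simps mult_ac)
  have A1: "110 / 100 / sqrt v' * (2 + \<epsilon>) \<le> \<epsilon> / A"
  proof -
    have "12 * A\<^sup>2 * (2 + \<epsilon>)\<^sup>2 / (pi\<^sup>2 * \<epsilon>\<^sup>2) < v'" using nA by (simp add: N_A_def v'_def)
    then have "12 * A\<^sup>2 * (2 + \<epsilon>)\<^sup>2 < v' * (pi\<^sup>2 * \<epsilon>\<^sup>2)" using \<epsilon> by (simp add: pos_divide_less_eq)
    moreover have "pi\<^sup>2 * (v' * \<epsilon>\<^sup>2) \<le> 98697 / 10000 * (v' * \<epsilon>\<^sup>2)"
    proof (rule mult_right_mono)
      have "pi\<^sup>2 \<le> (31416 / 10000)\<^sup>2" using pi_up by (intro power_mono) auto
      then show "pi\<^sup>2 \<le> 98697 / 10000" by (simp add: power2_eq_square)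
    qed (use v' in simp)
    moreover have "v' * (pi\<^sup>2 * \<epsilon>\<^sup>2) = pi\<^sup>2 * (v' * \<epsilon>\<^sup>2)" by simp
    ultimately have "12 * (A\<^sup>2 * (2 + \<epsilon>)\<^sup>2) \<le> 98697 / 10000 * (v' * \<epsilon>\<^sup>2)" by (simp only: mult.assoc)
    moreover have "0 \<le> v' * \<epsilon>\<^sup>2" using v' by simp
    ultimately have "121 / 100 * (A\<^sup>2 * (2 + \<epsilon>)\<^sup>2) \<le> v' * \<epsilon>\<^sup>2" by linarith
    moreover have sq: "(110 / 100 * y * x)\<^sup>2 = 121 / 100 * (x\<^sup>2 * y\<^sup>2)" for x y :: real
      by (simp add: power2_eq_square)
    moreover have "(\<epsilon> * sqrt v')\<^sup>2 = v' * \<epsilon>\<^sup>2" using v' by (simp add: power_mult_distrib)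
    ultimately have "(110 / 100 * (2 + \<epsilon>) * A)\<^sup>2 \<le> (\<epsilon> * sqrt v')\<^sup>2" unfolding sq by argo
    then have le: "110 / 100 * (2 + \<epsilon>) * A \<le> \<epsilon> * sqrt v'"
      by (rule power2_le_imp_le) (use \<epsilon> v' in simp)
    show ?thesis by (rule frac[OF le]) (use ABC v' in simp_all)
  qed
  have B1: "176 / 100 / sqrt (sqrt v') * (2 + \<epsilon>) \<le> \<epsilon> / B"
  proof -
    define X where "X = B ^ 4 * (2 + \<epsilon>) ^ 4"
    define Y where "Y = v' * \<epsilon> ^ 4"
    have X: "X \<ge> 0" by (simp add: X_def)
    have Y: "Y \<ge> 0" using v' by (simp add: Y_def)
    have pw: "x \<le> y" if "x ^ 4 \<le> y ^ 4" "0 \<le> y" for x y :: real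
      using power_le_imp_le_base[of x 3 y] that by (simp add: eval_nat_numeral)
    have "910787328 * B ^ 4 * (2 + \<epsilon>) ^ 4 / (10000 * pi ^ 8 * \<epsilon> ^ 4) < v'" using nB by (simp add: N_B_def v'_def)
    then have "910787328 * B ^ 4 * (2 + \<epsilon>) ^ 4 < v' * (10000 * pi ^ 8 * \<epsilon> ^ 4)" using \<epsilon> by (simp only: pos_divide_less_eq mult_pos_pos zero_less_power pi_gt_zero zero_less_numeral)
    then have "910787328 * X < pi ^ 8 * (10000 * Y)" by (simp only: X_def Y_def mult_ac)
    also have "pi ^ 8 * (10000 * Y) \<le> 9490 * (10000 * Y)"
    proof (rule mult_right_mono)
      have "pi ^ 8 \<le> (31416 / 10000) ^ 8" using pi_up by (intro power_mono) auto
      also have "\<dots> \<le> (9490 :: real)" by (simp add: power_divide)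
      finally show "pi ^ 8 \<le> 9490" .
    qed (use Y in simp)
    finally have "910787328 / 94900000 * X \<le> Y" by simp
    moreover have "(176 / 100) ^ 4 * X \<le> 910787328 / 94900000 * X" using X by (intro mult_right_mono) (auto simp: power_divide)
    ultimately have "(176 / 100) ^ 4 * X \<le> Y" by linarith
    moreover have "(176 / 100 * y * x) ^ 4 = (176 / 100) ^ 4 * (x ^ 4 * y ^ 4)" for x y :: real
      by (simp only: power_mult_distrib mult_ac)
    moreover have "(\<epsilon> * sqrt (sqrt v')) ^ 4 = Y"
    proof -
      have "sqrt (sqrt v') ^ 4 = ((sqrt (sqrt v'))\<^sup>2)\<^sup>2" by (simp flip: power_mult)
      then show ?thesis using v' by (simp add: power_mult_distrib Y_def)
    qed
    ultimately have "(176 / 100 * (2 + \<epsilon>) * B) ^ 4 \<le> (\<epsilon> * sqrt (sqrt v')) ^ 4" by (simp only: X_def)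
    then have le: "176 / 100 * (2 + \<epsilon>) * B \<le> \<epsilon> * sqrt (sqrt v')"
      by (rule pw) (use \<epsilon> v' in simp)
    show ?thesis by (rule frac[OF le]) (use ABC v' in simp_all)
  qed
  define a where "a = slack (n + L)"
  have a: "a > 0" by (simp add: a_def slack_pos)
  have "(2 + \<epsilon>) * a \<le> \<epsilon> / A + \<epsilon> / B"
  proof -
    have sl: "a = 176 / 100 / sqrt (sqrt v') + 110 / 100 / sqrt v'" by (simp only: a_def slack_def v'_def)
    have "(2 + \<epsilon>) * a = 176 / 100 / sqrt (sqrt v') * (2 + \<epsilon>) + 110 / 100 / sqrt v' * (2 + \<epsilon>)"
      unfolding sl by (subst mult.commute) (rule distrib_right)
    then show ?thesis using A1 B1 by linarith
  qed
  also have "\<dots> \<le> \<epsilon> * D" using ABC \<epsilon> by (simp add: D_def distrib_left)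
  finally have aD: "(2 + \<epsilon>) * a \<le> \<epsilon> * D" .
  have D: "0 < D" "D < 1" using ABC by (auto simp: D_def add_pos_pos)
  define R where "R = exp (saddle n * real L)"
  have R: "R > 0" by (simp add: R_def)
  have RD: "R * (1 + \<epsilon> * D) < 1 + \<epsilon>"
  proof -
    define l where "l = ln ((1 + \<epsilon>) / (1 + \<epsilon> * D))"
    have e: "1 + \<epsilon> * D > 0" "1 + \<epsilon> * D < 1 + \<epsilon>" using D \<epsilon> by (auto simp: add_pos_pos)
    then have "1 < (1 + \<epsilon>) / (1 + \<epsilon> * D)" by simp
    then have l: "l > 0" and exp_l: "exp l = (1 + \<epsilon>) / (1 + \<epsilon> * D)" by (simp_all add: l_def)
    have cross: "P / (12 * w) * x < y" if "x * P < w * (12 * y)" "w > 0" for P w x y :: real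
      using that by (simp add: pos_divide_less_eq mult_ac)
    have "(real L)\<^sup>2 * pi\<^sup>2 / (12 * l\<^sup>2) < real n + 1 / 24" using nD by (simp add: N_D_def l_def)
    then have "(real L)\<^sup>2 * pi\<^sup>2 < (real n + 1 / 24) * (12 * l\<^sup>2)" using l by (simp add: pos_divide_less_eq)
    then have "pi\<^sup>2 / (12 * (real n + 1 / 24)) * (real L)\<^sup>2 < l\<^sup>2"
      by (rule cross) simp
    then have "(saddle n * real L)\<^sup>2 < l\<^sup>2" by (simp only: saddle_sq power_mult_distrib)
    then have "saddle n * real L < l" by (rule power2_less_imp_less) (use l in simp)
    then have "R < (1 + \<epsilon>) / (1 + \<epsilon> * D)" unfolding R_def exp_l[symmetric] by simp
    then show ?thesis using e by (simp add: pos_less_divide_eq)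
  qed
  have "R * (1 + (2 + \<epsilon>) * a) \<le> R * (1 + \<epsilon> * D)" using aD R by (intro mult_left_mono) auto
  with RD have "R * (1 + (2 + \<epsilon>) * a) < 1 + \<epsilon>" by linarith
  then have key: "R * (1 + a) < (1 + \<epsilon>) * (1 - R * a)" by (simp add: algebra_simps)
  moreover have "0 < R * (1 + a)" using R a by simp
  ultimately have "0 < (1 + \<epsilon>) * (1 - R * a)" by linarith
  then have pos: "0 < 1 - R * a" using \<epsilon> by (simp add: zero_less_mult_iff)
  have "(1 - R * a) * real (q (n + L)) \<le> R * (1 + a) * real (q n)"
    unfolding R_def a_def by (rule q_shift_bound[OF n27])
  also have "\<dots> \<le> (1 + \<epsilon>) * (1 - R * a) * real (q n)" using key by (intro mult_right_mono) auto
  finally have "(1 - R * a) * real (q (n + L)) \<le> (1 - R * a) * ((1 + \<epsilon>) * real (q n))" by (simp add: mult_ac)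
  then show ?thesis using pos by simp
qed

section \<open>Linear inequalities\<close>

text \<open>
  By monotonicity all shifts on the left may be replaced by the largest one and all shifts on the right
  by \<open>0\<close>. Since \<open>1 + \<epsilon>\<close> is the quotient of the two coefficient sums, the claim becomes
  \<open>q (n + L) \<le> (1 + \<epsilon>) * q n\<close>.
\<close>
lemma weighted_sum_q_le:
  fixes r s :: nat and \<alpha> \<beta> :: "nat \<Rightarrow> real" and L :: nat and \<epsilon> A B C :: real
  assumes "r \<ge> 1"
    and \<alpha>: "\<forall>k\<in>{1..r}. \<alpha> k > 0" and \<beta>: "\<forall>l\<in>{1..s}. \<beta> l > 0"
    and less: "(\<Sum>k=1..r. \<alpha> k) < (\<Sum>l=1..s. \<beta> l)"
    and \<epsilon>: "\<epsilon> = inverse (\<Sum>k=1..r. \<alpha> k) * ((\<Sum>l=1..s. \<beta> l) - (\<Sum>k=1..r. \<alpha> k))"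
    and ABC: "A > 0" "B > 0" "C > 0" "1 / A + 1 / B + 1 / C < 1"
    and \<mu>: "strict_mono_on {1..r} \<mu>" "\<mu> r = L"
    and n: "real n > N_ABC A B C \<epsilon> L"
  shows "(\<Sum>k=1..r. \<alpha> k * real (q (n + \<mu> k))) \<le> (\<Sum>l=1..s. \<beta> l * real (q (n + \<nu> l)))"
proof -
  let ?a = "\<Sum>k=1..r. \<alpha> k" and ?b = "\<Sum>l=1..s. \<beta> l"
  have a: "?a > 0" using \<alpha> \<open>r \<ge> 1\<close> by (intro sum_pos) auto
  have eps: "\<epsilon> > 0" unfolding \<epsilon> using a less by simp
  have ab: "?a * (1 + \<epsilon>) = ?b" unfolding \<epsilon> using a by (simp add: field_simps)
  have "(\<Sum>k=1..r. \<alpha> k * real (q (n + \<mu> k))) \<le> (\<Sum>k=1..r. \<alpha> k * real (q (n + L)))"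
  proof (intro sum_mono mult_left_mono)
    fix k assume k: "k \<in> {1..r}"
    then have "\<mu> k \<le> \<mu> r" using \<mu>(1) \<open>r \<ge> 1\<close> strict_mono_on_leD[of "{1..r}" \<mu> k r] by auto
    then show "real (q (n + \<mu> k)) \<le> real (q (n + L))" using \<mu>(2) by (intro of_nat_mono q_mono) auto
    show "0 \<le> \<alpha> k" using \<alpha> k by (simp add: less_imp_le)
  qed
  also have "\<dots> = ?a * real (q (n + L))" by (simp add: sum_distrib_right)
  also have "\<dots> \<le> ?a * ((1 + \<epsilon>) * real (q n))"
    using q_shift_le[OF ABC eps n] a by (intro mult_left_mono) auto
  also have "\<dots> = ?b * real (q n)" unfolding ab[symmetric] by simp
  also have "\<dots> = (\<Sum>l=1..s. \<beta> l * real (q n))" by (simp add: sum_distrib_right)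
  also have "\<dots> \<le> (\<Sum>l=1..s. \<beta> l * real (q (n + \<nu> l)))"
  proof (intro sum_mono mult_left_mono)
    fix l assume "l \<in> {1..s}"
    then show "0 \<le> \<beta> l" using \<beta> by (simp add: less_imp_le)
    show "real (q n) \<le> real (q (n + \<nu> l))" by (intro of_nat_mono q_mono) simp
  qed
  finally show ?thesis .
qed

theorem theorem1p11:
  fixes r s :: nat and \<alpha> \<beta> :: "nat \<Rightarrow> real" and L :: nat and \<epsilon> :: real
  assumes "r \<ge> 1" and "s \<ge> 1"
    and "\<forall>k\<in>{1..r}. \<alpha> k > 0" and "\<forall>l\<in>{1..s}. \<beta> l > 0"
    and "(\<Sum>k=1..r. \<alpha> k) < (\<Sum>l=1..s. \<beta> l)"
    and "\<epsilon> = inverse (\<Sum>k=1..r. \<alpha> k) * ((\<Sum>l=1..s. \<beta> l) - (\<Sum>k=1..r. \<alpha> k))"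
  shows "(\<exists>N::real. \<forall>\<mu> \<nu> :: nat \<Rightarrow> nat.
           strict_mono_on {1..r} \<mu> \<and> strict_mono_on {1..s} \<nu> \<and> \<mu> r = L \<longrightarrow>
           (\<forall>n::nat. real n > N \<longrightarrow>
             (\<Sum>k=1..r. \<alpha> k * real (q (n + \<mu> k))) \<le> (\<Sum>l=1..s. \<beta> l * real (q (n + \<nu> l))))) \<and>
        (\<forall>A B C :: real. A > 0 \<and> B > 0 \<and> C > 0 \<and> 1 / A + 1 / B + 1 / C < 1 \<longrightarrow>
         (\<forall>\<mu> \<nu> :: nat \<Rightarrow> nat.
           strict_mono_on {1..r} \<mu> \<and> strict_mono_on {1..s} \<nu> \<and> \<mu> r = L \<longrightarrow>
           (\<forall>n::nat. real n > N_ABC A B C \<epsilon> L \<longrightarrow>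
             (\<Sum>k=1..r. \<alpha> k * real (q (n + \<mu> k))) \<le> (\<Sum>l=1..s. \<beta> l * real (q (n + \<nu> l))))))"
proof (intro conjI allI impI)
  show "\<exists>N::real. \<forall>\<mu> \<nu> :: nat \<Rightarrow> nat.
           strict_mono_on {1..r} \<mu> \<and> strict_mono_on {1..s} \<nu> \<and> \<mu> r = L \<longrightarrow>
           (\<forall>n::nat. real n > N \<longrightarrow>
             (\<Sum>k=1..r. \<alpha> k * real (q (n + \<mu> k))) \<le> (\<Sum>l=1..s. \<beta> l * real (q (n + \<nu> l))))"
    \<comment> \<open>any \<open>A\<close>, \<open>B\<close>, \<open>C\<close> with reciprocal sum below one will do\<close>
    by (intro exI[of _ "N_ABC 4 4 4 \<epsilon> L"] allI impI,
        rule weighted_sum_q_le[OF assms(1,3,4,5,6), where A = 4 and B = 4 and C = 4 and L = L]) auto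
next
  fix A B C :: real and \<mu> \<nu> :: "nat \<Rightarrow> nat" and n :: nat
  assume "A > 0 \<and> B > 0 \<and> C > 0 \<and> 1 / A + 1 / B + 1 / C < 1"
    and "strict_mono_on {1..r} \<mu> \<and> strict_mono_on {1..s} \<nu> \<and> \<mu> r = L"
    and "N_ABC A B C \<epsilon> L < real n"
  then show "(\<Sum>k=1..r. \<alpha> k * real (q (n + \<mu> k))) \<le> (\<Sum>l=1..s. \<beta> l * real (q (n + \<nu> l)))"
    by (intro weighted_sum_q_le[OF assms(1,3,4,5,6), where A = A and B = B and C = C and L = L]) auto
qed

end
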